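(* Let $r,k$ be positive integers. Then $F_0^{(r,k)}=1$, and for every $n\geq 1$, \begin{align*} F_n^{(r,k)} &= \frac{k}{rn+k}\sum_{\lambda\vdash n}\binom{rn+k}{d_1(\lambda),\dots,d_n(\lambda),\,rn+k-\ell(\lambda)}h_\lambda\\ &= \frac{k}{rn+k}\sum_{\lambda\vdash n}\varepsilon_\lambda\binom{rn+k+\ell(\lambda)-1}{d_1(\lambda),\dots,d_n(\lambda),\,rn+k-1}e_\lambda\\ &= \frac{k}{rn+k}\sum_{\lambda\vdash n}\Big[\prod_i\binom{\lambda_i+rn+k-1}{\lambda_i}\Big]m_\lambda\\ &= \frac{k}{rn+k}\sum_{\lambda\vdash n}s_\lambda(1^{rn+k})\,s_\lambda\\ &= k\sum_{\lambda\vdash n}z_\lambda^{-1}(rn+k)^{\ell(\lambda)-1}p_\lambda, \end{align*} \[\omega F_n^{(r,k)}=\frac{k}{rn+k}\sum_{\lambda\vdash n}\Big[\prod_i\binom{rn+k}{\lambda_i}\Big]m_\lambda,\] and \[F_n^{(r,k)}=\frac{k}{rn+k}[t^n]H(t)^{rn+k}.\]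
   Context: For positive integers $r,k$, an $(r,k)$-parking function of length $n$ is a sequence $(a_1,\dots,a_n)$ of positive integers whose increasing rearrangement $b_1\le\cdots\le b_n$ satisfies $b_i\le k+(i-1)r$ for all $i$. The symmetric group $\mathfrak{S}_n$ acts on the set of $(r,k)$-parking functions of length $n$ by permuting coordinates; $F_n^{(r,k)}$ denotes the Frobenius characteristic of this action, i.e. $\frac{1}{n!}\sum_{w\in\mathfrak{S}_n}\#\{\text{fixed points of }w\}\,p_{\rho(w)}$, where $\rho(w)$ is the cycle type of $w$. Here $h_\lambda,e_\lambda,m_\lambda,s_\lambda,p_\lambda$ are the complete homogeneous, elementary, monomial, Schur and power-sum symmetric functions; $\ell(\lambda)$ is the number of parts of $\lambda$, $d_i(\lambda)$ is the number of parts of $\lambda$ equal to $i$, $\varepsilon_\lambda=(-1)^{n-\ell(\lambda)}$, $z_\lambda=\prod_i i^{d_i(\lambda)}d_i(\lambda)!$; $s_\lambda(1^m)$ is $s_\lambda$ evaluated at $m$ variables equal to $1$ and the rest $0$; $\omega$ is the involution of the ring of symmetric functions with $\omega(e_n)=h_n$; $H(t)=\sum_{n\ge0}h_nt^n=\prod_i(1-x_it)^{-1}$; $[t^n]f(t)$ is the coefficient of $t^n$ in $f$. Multinomial notation: $\binom{K}{d_1,\dots,d_n,K-\sum d_i}=\frac{K(K-1)\cdots(K-\sum d_i+1)}{d_1!\cdots d_n!}$. *)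

theory Defs
  imports
    "HOL-Library.Multiset"
    "HOL-Computational_Algebra.Formal_Power_Series"
    "HOL-Combinatorics.Permutations"
    "HOL-Combinatorics.Orbits"
begin

section \<open>Formal power series in countably many variables\<close>

text \<open>
  The variables are \<open>x\<^sub>0, x\<^sub>1, \<dots>\<close>. A monomial is encoded as the finite multiset of the
  indices of its variables, so that \<open>{#0, 0, 3#}\<close> stands for \<open>x\<^sub>0\<^sup>2 x\<^sub>3\<close>, the product of
  monomials is multiset sum and the degree is the size. A power series over the rationals is
  an arbitrary function from monomials to coefficients.
\<close>

typedef mpseries = "UNIV :: (nat multiset \<Rightarrow> rat) set"
  morphisms coeff Mpseries by simp

setup_lifting type_definition_mpseries

lemma coeff_Mpseries [simp]: "coeff (Mpseries f) = f"
  by (simp add: Mpseries_inverse)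

lemma mpseries_eqI: "(\<And>M. coeff f M = coeff g M) \<Longrightarrow> f = g"
  by (metis coeff_inverse ext)

lemma finite_submultisets: "finite {A. A \<subseteq># M}"
proof (induction M)
  case empty
  then show ?case by simp
next
  case (add x M)
  have "{A. A \<subseteq># add_mset x M} \<subseteq> {A. A \<subseteq># M} \<union> add_mset x ` {A. A \<subseteq># M}"
  proof
    fix A assume "A \<in> {A. A \<subseteq># add_mset x M}"
    then have A: "A \<subseteq># add_mset x M" by simp
    show "A \<in> {A. A \<subseteq># M} \<union> add_mset x ` {A. A \<subseteq># M}"
    proof (cases "x \<in># A")
      case True
      then obtain B where B: "A = add_mset x B" by (meson mset_add)
      then show ?thesis using A by auto
    next
      case False
      then have "A \<subseteq># M" using A by (metis diff_single_trivial subset_eq_diff_conv add_mset_add_single)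
      then show ?thesis by simp
    qed
  qed
  then show ?case using add.IH finite_subset by blast
qed

lemma finite_mset_splittings: "finite {(A, B). A + B = (M :: 'a multiset)}"
proof -
  have "{(A, B). A + B = M} \<subseteq> {A. A \<subseteq># M} \<times> {A. A \<subseteq># M}" by auto
  then show ?thesis using finite_submultisets finite_subset by blast
qed

instantiation mpseries :: comm_ring_1
begin

lift_definition zero_mpseries :: mpseries is "\<lambda>_. 0" .

lift_definition one_mpseries :: mpseries is "\<lambda>M. if M = {#} then 1 else 0" .

lift_definition plus_mpseries :: "mpseries \<Rightarrow> mpseries \<Rightarrow> mpseries" is "\<lambda>f g M. f M + g M" .

lift_definition uminus_mpseries :: "mpseries \<Rightarrow> mpseries" is "\<lambda>f M. - f M" .

lift_definition minus_mpseries :: "mpseries \<Rightarrow> mpseries \<Rightarrow> mpseries" is "\<lambda>f g M. f M - g M" .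

lift_definition times_mpseries :: "mpseries \<Rightarrow> mpseries \<Rightarrow> mpseries" is
  "\<lambda>f g M. \<Sum>(A, B) | A + B = M. f A * g B" .

instance
proof
  fix a b c :: mpseries
  show "a * b * c = a * (b * c)"
  proof (rule mpseries_eqI)
    fix M :: "nat multiset"
    have "coeff (a * b * c) M = (\<Sum>(P, C) | P + C = M.
        \<Sum>(A, B) | A + B = P. coeff a A * coeff b B * coeff c C)"
      by (simp add: times_mpseries.rep_eq sum_distrib_right case_prod_unfold)
    also have "\<dots> = (\<Sum>((P, C), (A, B)) \<in> Sigma {(P, C). P + C = M} (\<lambda>(P, C). {(A, B). A + B = P}).
        coeff a A * coeff b B * coeff c C)"
      using finite_mset_splittings
      by (subst sum.Sigma[symmetric]) (auto simp: case_prod_unfold)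
    also have "\<dots> = (\<Sum>((A, Q), (B, C)) \<in> Sigma {(A, Q). A + Q = M} (\<lambda>(A, Q). {(B, C). B + C = Q}).
        coeff a A * coeff b B * coeff c C)"
      by (rule sum.reindex_bij_witness[where i = "\<lambda>((A, Q), (B, C)). ((A + B, C), (A, B))"
            and j = "\<lambda>((P, C), (A, B)). ((A, B + C), (B, C))"]) (auto simp: add.assoc)
    also have "\<dots> = (\<Sum>(A, Q) | A + Q = M. \<Sum>(B, C) | B + C = Q. coeff a A * coeff b B * coeff c C)"
      using finite_mset_splittings
      by (subst sum.Sigma[symmetric]) (auto simp: case_prod_unfold)
    also have "\<dots> = coeff (a * (b * c)) M"
      by (simp add: times_mpseries.rep_eq sum_distrib_left case_prod_unfold mult.assoc)
    finally show "coeff (a * b * c) M = coeff (a * (b * c)) M" .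
  qed
  show "a * b = b * a"
  proof (rule mpseries_eqI)
    fix M :: "nat multiset"
    show "coeff (a * b) M = coeff (b * a) M"
      unfolding times_mpseries.rep_eq
      by (rule sum.reindex_bij_witness[where i = "\<lambda>(A, B). (B, A)" and j = "\<lambda>(A, B). (B, A)"])
        (auto simp: add.commute mult.commute)
  qed
  show "1 * a = a"
  proof (rule mpseries_eqI)
    fix M :: "nat multiset"
    have "coeff (1 * a) M = (\<Sum>p | fst p + snd p = M. if p = ({#}, M) then coeff a M else 0)"
      unfolding times_mpseries.rep_eq one_mpseries.rep_eq case_prod_unfold
      by (rule sum.cong) (auto simp: prod_eq_iff)
    also have "\<dots> = coeff a M"
      using finite_mset_splittings[of M] by (simp add: case_prod_unfold)
    finally show "coeff (1 * a) M = coeff a M" .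
  qed
  show "(a + b) * c = a * c + b * c"
    by (rule mpseries_eqI)
      (simp add: times_mpseries.rep_eq plus_mpseries.rep_eq case_prod_unfold distrib_right sum.distrib)
  show "(0 :: mpseries) \<noteq> 1"
  proof
    assume "(0 :: mpseries) = 1"
    then have "coeff 0 {#} = coeff 1 {#}" by simp
    then show False by (simp add: zero_mpseries.rep_eq one_mpseries.rep_eq)
  qed
qed (transfer; auto)+

end

lift_definition scaleQ :: "rat \<Rightarrow> mpseries \<Rightarrow> mpseries" (infixr \<open>*\<^sub>Q\<close> 75) is
  "\<lambda>c f M. c * f M" .

section \<open>Symmetric functions\<close>

definition symmetric_functions :: "mpseries set" where
  "symmetric_functions = {f.
     (\<exists>d. \<forall>M. coeff f M \<noteq> 0 \<longrightarrow> size M \<le> d) \<and>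
     (\<forall>\<pi>. bij \<pi> \<longrightarrow> (\<forall>M. coeff f (image_mset \<pi> M) = coeff f M))}"

text \<open>Integer partitions are encoded as multisets of positive integers; thus \<open>\<ell>(\<mu>)\<close> is
  \<open>size \<mu>\<close> and \<open>d\<^sub>i(\<mu>)\<close> is \<open>count \<mu> i\<close>.\<close>

definition partitions :: "nat \<Rightarrow> nat multiset set" where
  "partitions n = {\<mu>. 0 \<notin># \<mu> \<and> sum_mset \<mu> = n}"

definition exponents :: "nat multiset \<Rightarrow> nat multiset" where
  "exponents M = image_mset (count M) (mset_set (set_mset M))"

definition m_sym :: "nat multiset \<Rightarrow> mpseries" where
  "m_sym \<mu> = Mpseries (\<lambda>M. of_bool (exponents M = \<mu>))"

definition h_gen :: "nat \<Rightarrow> mpseries" where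
  "h_gen n = Mpseries (\<lambda>M. of_bool (size M = n))"

definition e_gen :: "nat \<Rightarrow> mpseries" where
  "e_gen n = Mpseries (\<lambda>M. of_bool (size M = n \<and> (\<forall>i. count M i \<le> 1)))"

text \<open>\<open>p\<^sub>n = \<Sum>\<^sub>i x\<^sub>i\<^sup>n\<close>, meaningful for \<open>n \<ge> 1\<close> only.\<close>

definition p_gen :: "nat \<Rightarrow> mpseries" where
  "p_gen n = Mpseries (\<lambda>M. of_bool (\<exists>i. M = replicate_mset n i))"

definition h_sym :: "nat multiset \<Rightarrow> mpseries" where
  "h_sym \<mu> = (\<Prod>i\<in>#\<mu>. h_gen i)"

definition e_sym :: "nat multiset \<Rightarrow> mpseries" where
  "e_sym \<mu> = (\<Prod>i\<in>#\<mu>. e_gen i)"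

definition p_sym :: "nat multiset \<Rightarrow> mpseries" where
  "p_sym \<mu> = (\<Prod>i\<in>#\<mu>. p_gen i)"

text \<open>A semistandard Young tableau of shape \<open>\<mu>\<close> is the list of its rows (English notation).
  Entries are indices of variables and hence start from \<open>0\<close>.\<close>

definition ssyt :: "nat multiset \<Rightarrow> nat list list set" where
  "ssyt \<mu> = {T.
     map length T = rev (sorted_list_of_multiset \<mu>) \<and>
     (\<forall>row \<in> set T. sorted row) \<and>
     (\<forall>i j. Suc i < length T \<longrightarrow> j < length (T ! Suc i) \<longrightarrow> T ! i ! j < T ! Suc i ! j)}"

definition s_sym :: "nat multiset \<Rightarrow> mpseries" where
  "s_sym \<mu> = Mpseries (\<lambda>M. of_nat (card {T \<in> ssyt \<mu>. mset (concat T) = M}))"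

text \<open>\<open>f(1\<^sup>m)\<close>: set \<open>x\<^sub>0 = \<dots> = x\<^sub>m\<^sub>-\<^sub>1 = 1\<close> and all other variables to \<open>0\<close>. The sum is
  finite for series of bounded degree.\<close>

definition eval_ones :: "nat \<Rightarrow> mpseries \<Rightarrow> rat" where
  "eval_ones m f = (\<Sum>M | set_mset M \<subseteq> {..<m} \<and> coeff f M \<noteq> 0. coeff f M)"

definition H_series :: "mpseries fps" where
  "H_series = Abs_fps h_gen"

text \<open>\<open>\<omega>\<close> is the involutive ring automorphism (linear over the rationals) of the ring of symmetric
  functions with \<open>\<omega>(e\<^sub>n) = h\<^sub>n\<close>. These conditions determine its values on
  \<open>symmetric_functions\<close>; elsewhere they say nothing.\<close>

definition is_omega :: "(mpseries \<Rightarrow> mpseries) \<Rightarrow> bool" where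
  "is_omega \<omega> \<longleftrightarrow>
     (\<forall>f \<in> symmetric_functions. \<omega> f \<in> symmetric_functions \<and> \<omega> (\<omega> f) = f) \<and>
     (\<forall>f \<in> symmetric_functions. \<forall>g \<in> symmetric_functions.
        \<omega> (f + g) = \<omega> f + \<omega> g \<and> \<omega> (f * g) = \<omega> f * \<omega> g) \<and>
     \<omega> 1 = 1 \<and>
     (\<forall>c. \<forall>f \<in> symmetric_functions. \<omega> (c *\<^sub>Q f) = c *\<^sub>Q \<omega> f) \<and>
     (\<forall>n. \<omega> (e_gen n) = h_gen n)"

section \<open>Numerical notation\<close>

definition eps_part :: "nat multiset \<Rightarrow> rat" where
  "eps_part \<mu> = (- 1) ^ (sum_mset \<mu> - size \<mu>)"

definition z_part :: "nat multiset \<Rightarrow> rat" where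
  "z_part \<mu> = (\<Prod>i\<in>set_mset \<mu>. of_nat i ^ count \<mu> i * fact (count \<mu> i))"

text \<open>The multinomial coefficient with upper entry \<open>K\<close> and lower entries
  \<open>d 1, \<dots>, d n, K - (d 1 + \<dots> + d n)\<close>; it is \<open>0\<close> if \<open>K < d 1 + \<dots> + d n\<close>.\<close>

definition multinom :: "nat \<Rightarrow> nat \<Rightarrow> (nat \<Rightarrow> nat) \<Rightarrow> rat" where
  "multinom K n d =
     (\<Prod>j<(\<Sum>i=1..n. d i). of_nat K - of_nat j) / (\<Prod>i=1..n. fact (d i))"

section \<open>Parking functions and their Frobenius characteristic\<close>

text \<open>List positions are counted from \<open>0\<close>, so \<open>sort a ! i\<close> is \<open>b\<^sub>i\<^sub>+\<^sub>1\<close>.\<close>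

definition parking_functions :: "nat \<Rightarrow> nat \<Rightarrow> nat \<Rightarrow> nat list set" where
  "parking_functions r k n = {a. length a = n \<and> (\<forall>x \<in> set a. 1 \<le> x) \<and>
     (\<forall>i<n. sort a ! i \<le> k + i * r)}"

definition cycle_type :: "nat \<Rightarrow> (nat \<Rightarrow> nat) \<Rightarrow> nat multiset" where
  "cycle_type n w = image_mset card (mset_set (orbit w ` {..<n}))"

text \<open>Permutations of \<open>{..<n}\<close> act on lists of length \<open>n\<close> from the left by
  \<open>(w \<cdot> a) ! i = a ! (w\<^sup>-\<^sup>1 i)\<close>.\<close>

definition frobenius :: "nat \<Rightarrow> 'a list set \<Rightarrow> mpseries" where
  "frobenius n X = (1 / fact n) *\<^sub>Q
     (\<Sum>w | w permutes {..<n}.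
        of_nat (card {a \<in> X. permute_list (inv w) a = a}) *\<^sub>Q p_sym (cycle_type n w))"

definition F_park :: "nat \<Rightarrow> nat \<Rightarrow> nat \<Rightarrow> mpseries" where
  "F_park r k n = frobenius n (parking_functions r k n)"

end

theory Submission
  imports Defs
begin

text \<open>
  Put \<open>N = r * n + k\<close>. By the cycle lemma exactly \<open>k\<close> of the \<open>N\<close> cyclic shifts (adding a constant
  modulo \<open>N\<close>) of a word of length \<open>n\<close> over \<open>{1..N}\<close> are parking functions, and shifting commutes with
  permuting positions. Hence a permutation with \<open>l\<close> cycles fixes \<open>k / N * N ^ l\<close> parking functions, that
  is, \<open>F_park r k n\<close> is \<open>k / N\<close> times the characteristic of all words over \<open>N\<close> letters; by Burnside's
  lemma the latter is the coefficient of \<open>t ^ n\<close> in \<open>H(t) ^ N\<close>.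

  The expansions of this coefficient come from \<open>\<Prod>\<^sub>i (1 - x\<^sub>i) ^ - N\<close> (monomial), the multinomial theorem
  for \<open>H(t) ^ N\<close> and for \<open>E(- t) ^ - N\<close> (complete and elementary), the recursion obtained from
  \<open>H'(t) = P(t) H(t)\<close> (power sums), and the Cauchy identity (Schur). For the last, the number of tableaux
  with entries below \<open>N\<close> is an eigenfunction of the operator that sums over all ways to add a horizontal
  strip of given size.
\<close>

text \<open>All the expansions are statements about the single element
  \<open>(H_series ^ N) $ n\<close>; parking functions matter only for reaching it. In that passage
  a word of length n over N colours is refined to a word of pairs (variable, colour): a power sum
  p_c counts the ways to give one variable to a whole cycle of length c, so its coefficients become
  numbers of fixed words.

  For the Schur expansion one alphabet of the Cauchy identity consists of N ones. There the
  eigenvalue is h_a(1^N) = (a + N - 1 choose a), since summing over added strips of size a is the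
  Pieri rule for multiplication by h_a. Removing the letters of a tableau one at a time produces one
  such factor per variable, hence the coefficient of the product of (1 - x_i)^-N.

  The involution is given only by axioms, so it can be computed only on expressions in the e_n. The
  relations H(t) E(-t) = 1 and E(t) H(-t) = 1 have the same form; therefore H(t)^N in terms of the
  e_n and E(t)^N in terms of the h_n have the same coefficients, and the involution carries one to
  the other.\<close>

unbundle fps_syntax

section \<open>Horizontal strips\<close>

text \<open>Row lengths continued by zeros, so that conditions on neighbouring rows need no case
  distinction on the number of rows.\<close>

definition shapes :: "(nat \<Rightarrow> nat) set" where
  "shapes = {f. antimono f \<and> (\<exists>L. \<forall>i\<ge>L. f i = 0)}"

definition area :: "(nat \<Rightarrow> nat) \<Rightarrow> nat" where
  "area f = (\<Sum>i | f i \<noteq> 0. f i)"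

text \<open>Interlacing of the row lengths: the cells of g outside f lie in pairwise different
  columns.\<close>

definition hstrip :: "(nat \<Rightarrow> nat) \<Rightarrow> (nat \<Rightarrow> nat) \<Rightarrow> bool" where
  "hstrip f g \<longleftrightarrow> (\<forall>i. f i \<le> g i \<and> g (Suc i) \<le> f i)"

lemma area_eq:
  assumes "\<And>i. i \<ge> L \<Longrightarrow> f i = 0"
  shows "area f = sum f {..<L}"
proof -
  have "i < L" if "f i \<noteq> 0" for i using assms[of i] that by (cases "i < L") auto
  then show ?thesis unfolding area_def by (intro sum.mono_neutral_left) auto
qed

lemma shapes_vanish:
  assumes "f \<in> shapes"
  obtains L where "\<And>i. i \<ge> L \<Longrightarrow> f i = 0"
  using assms by (auto simp: shapes_def)

lemma hstrip_le: "hstrip f g \<Longrightarrow> f i \<le> g i" and hstrip_ge: "hstrip f g \<Longrightarrow> g (Suc i) \<le> f i"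
  by (auto simp: hstrip_def)

lemma hstrip_vanish_left: "hstrip f g \<Longrightarrow> \<forall>i\<ge>L. g i = 0 \<Longrightarrow> \<forall>i\<ge>L. f i = 0"
  unfolding hstrip_def by (metis le_zero_eq)

lemma hstrip_vanish_right:
  assumes "hstrip f g" "\<forall>i\<ge>L. f i = 0"
  shows "\<forall>i\<ge>Suc L. g i = 0"
  by (metis assms hstrip_ge Suc_le_D Suc_le_mono le_zero_eq)

lemma hstrip_shape_left:
  assumes "hstrip f g" "g \<in> shapes"
  shows "f \<in> shapes"
proof -
  have "f (Suc i) \<le> f i" for i
    using hstrip_le[OF assms(1), of "Suc i"] hstrip_ge[OF assms(1), of i] by simp
  moreover have "\<exists>L. \<forall>i\<ge>L. f i = 0"
    using assms hstrip_vanish_left[OF assms(1)] unfolding shapes_def by blast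
  ultimately show ?thesis
    by (auto simp: shapes_def antimono_iff_le_Suc)
qed

lemma hstrip_shape_right:
  assumes "hstrip f g" "f \<in> shapes"
  shows "g \<in> shapes"
proof -
  have "g (Suc i) \<le> g i" for i
    using hstrip_le[OF assms(1), of i] hstrip_ge[OF assms(1), of i] by simp
  moreover have "\<exists>L. \<forall>i\<ge>L. g i = 0"
    using assms hstrip_vanish_right[OF assms(1)] unfolding shapes_def by blast
  ultimately show ?thesis
    by (auto simp: shapes_def antimono_iff_le_Suc)
qed

lemma hstrip_area:
  assumes "hstrip f g" "g \<in> shapes"
  shows "area f \<le> area g"
proof -
  obtain L where L: "\<And>i. i \<ge> L \<Longrightarrow> g i = 0" using assms(2) shapes_vanish by blast
  then have "\<And>i. i \<ge> L \<Longrightarrow> f i = 0" using hstrip_vanish_left[OF assms(1)] by blast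
  with L show ?thesis
    by (simp add: area_eq[of L] sum_mono hstrip_le[OF assms(1)])
qed

lemma finite_bounded_area: "finite {f. (\<forall>i\<ge>L. f i = 0) \<and> area f \<le> n}"
proof (rule finite_subset)
  have "f i \<le> n" if "\<forall>i\<ge>L. f i = 0" "area f \<le> n" "i < L" for f i
  proof -
    have "f i \<le> sum f {..<L}" using that by (intro member_le_sum) auto
    then show ?thesis using that area_eq[of L f] by auto
  qed
  then show "{f. (\<forall>i\<ge>L. f i = 0) \<and> area f \<le> n}
      \<subseteq> {f. \<forall>i. (i \<in> {..<L} \<longrightarrow> f i \<in> {..n}) \<and> (i \<notin> {..<L} \<longrightarrow> f i = 0)}"
    by auto
  show "finite {f. \<forall>i. (i \<in> {..<L} \<longrightarrow> f i \<in> {..n}) \<and> (i \<notin> {..<L} \<longrightarrow> f i = (0::nat))}"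
    by (intro finite_set_of_finite_funs) auto
qed

lemma finite_hstrip_left:
  assumes "g \<in> shapes"
  shows "finite {f. hstrip f g}"
proof -
  obtain L where L: "\<And>i. i \<ge> L \<Longrightarrow> g i = 0" using assms shapes_vanish by blast
  have "{f. hstrip f g} \<subseteq> {f. (\<forall>i\<ge>L. f i = 0) \<and> area f \<le> area g}"
    using hstrip_vanish_left L hstrip_area assms by blast
  then show ?thesis using finite_bounded_area finite_subset by blast
qed

lemma finite_hstrip_right:
  assumes "f \<in> shapes"
  shows "finite {g. hstrip f g \<and> area g = n}"
proof -
  obtain L where L: "\<And>i. i \<ge> L \<Longrightarrow> f i = 0" using assms shapes_vanish by blast
  have "{g. hstrip f g \<and> area g = n} \<subseteq> {g. (\<forall>i\<ge>Suc L. g i = 0) \<and> area g \<le> n}"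
    using hstrip_vanish_right L by blast
  then show ?thesis using finite_bounded_area finite_subset by blast
qed

text \<open>A nonzero row i forces rows 0 to i to be nonzero, which already uses i + 1
  cells.\<close>

lemma shapes_vanish_area:
  assumes "f \<in> shapes" "i \<ge> area f"
  shows "f i = 0"
proof (rule ccontr)
  assume i: "f i \<noteq> 0"
  obtain L where L: "\<And>i. i \<ge> L \<Longrightarrow> f i = 0" using assms(1) shapes_vanish by blast
  have pos: "f j \<ge> 1" if "j \<le> i" for j
    using assms(1) that i by (auto simp: shapes_def dest!: antimonoD[of f j i])
  have "Suc i = (\<Sum>j\<le>i. 1)" by simp
  also have "\<dots> \<le> sum f {..i}" using pos by (intro sum_mono) auto
  also have "\<dots> \<le> sum f {..<L}"
  proof (intro sum_mono2)
    have "i < L" using i L[of i] by (cases "i < L") auto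
    then show "{..i} \<subseteq> {..<L}" by auto
  qed auto
  also have "\<dots> = area f" using L by (rule area_eq[symmetric])
  finally show False using assms(2) by simp
qed

lemma finite_shapes_area: "finite {f \<in> shapes. area f = n}"
  by (rule finite_subset[OF _ finite_bounded_area[of n n]]) (auto intro: shapes_vanish_area)

lemma area_zero: "area (\<lambda>_. 0) = 0"
  by (simp add: area_def)

lemma zero_in_shapes: "(\<lambda>_. 0) \<in> shapes"
  by (auto simp: shapes_def antimono_def)

lemma hstrip_zero_right: "hstrip f (\<lambda>_. 0) \<longleftrightarrow> f = (\<lambda>_. 0)"
  by (auto simp: hstrip_def)

text \<open>Counts chains of \<open>j\<close> horizontal strips from the empty shape to
  \<open>g\<close>; for a shape this is s_g(1^j), see \<open>card_tableaux\<close>.\<close>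

fun tab_num :: "nat \<Rightarrow> (nat \<Rightarrow> nat) \<Rightarrow> nat" where
  "tab_num 0 g = of_bool (g = (\<lambda>_. 0))"
| "tab_num (Suc j) g = (\<Sum>f | hstrip f g. tab_num j f)"

text \<open>Splits h_a(1^(j+1)) by the exponent of the last variable. For \<open>j = 0\<close>
  truncated subtraction makes the term at \<open>k = 0\<close> equal to 1 and all others 0.\<close>

lemma sum_choose_upper: "(\<Sum>k\<le>a. (k + j - 1) choose k) = ((a + j) choose a)"
proof (induction a)
  case (Suc a)
  then show ?case by (simp add: add.commute)
qed simp

text \<open>For given \<open>f\<close> and \<open>g\<close>, the rows \<open>u (Suc i)\<close> of a common extension \<open>u\<close> and the rows \<open>d i\<close> of a
  common restriction \<open>d\<close> range over the same interval, from \<open>max (f (Suc i)) (g (Suc i))\<close> to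
  \<open>min (f i) (g i)\<close>, while \<open>u 0\<close> is only bounded from below. Reflecting these intervals is the
  bijection behind the commutation of adding and removing strips.\<close>

lemma area_toggle:
  assumes vanish: "\<And>i. i \<ge> L \<Longrightarrow> f i = 0" "\<And>i. i \<ge> L \<Longrightarrow> g i = 0"
    and u0: "u 0 = max (f 0) (g 0) + k"
    and toggle: "\<And>i. u (Suc i) + d i = max (f (Suc i)) (g (Suc i)) + min (f i) (g i)"
  shows "area u + area d = area f + area g + k"
proof -
  have d: "d i = 0" "u (Suc i) = 0" if "i \<ge> L" for i
    using toggle[of i] vanish[of i] vanish[of "Suc i"] that by auto
  have u: "u i = 0" if "i \<ge> Suc L" for i using that d(2)[of "i - 1"] by (cases i) auto
  have "area u + area d = u 0 + (\<Sum>i<L. u (Suc i) + d i)"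
    by (simp only: area_eq[of L d, OF d(1)] area_eq[of "Suc L" u, OF u] sum.lessThan_Suc_shift
        sum.distrib)
  \<comment> \<open>Together with \<open>u 0\<close> the maxima cover the rows 0 to
    \<open>L\<close>, the minima the rows below \<open>L\<close>. As \<open>f\<close> and
    \<open>g\<close> vanish at \<open>L\<close>, they pair up row by row, and max + min is the plain
    sum.\<close>
  also have "\<dots> = k + (\<Sum>i<Suc L. max (f i) (g i)) + (\<Sum>i<L. min (f i) (g i))"
    by (subst sum.lessThan_Suc_shift) (simp add: toggle sum.distrib u0)
  also have "\<dots> = k + (\<Sum>i<L. max (f i) (g i) + min (f i) (g i))"
    using vanish[of L] by (simp add: sum.distrib)
  also have "(\<Sum>i<L. max (f i) (g i) + min (f i) (g i)) = (\<Sum>i<L. f i + g i)"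
    by (intro sum.cong) auto
  finally show ?thesis using vanish by (simp add: area_eq[of L] sum.distrib)
qed

text \<open>The Pieri rule at ones; the factor is h_a(1^j). In the induction
  \<open>tab_num (Suc j)\<close> sums \<open>tab_num j\<close> over removed strips. Adding a strip
  of size \<open>a\<close> and then removing one can be exchanged for removing one and then adding
  one of size \<open>a - k\<close>, once for each \<open>k \<le> a\<close>; the factors for
  \<open>j\<close> then add up to the factor for \<open>Suc j\<close>.\<close>

lemma sum_tab_num_hstrip:
  assumes "f \<in> shapes"
  shows "(\<Sum>g | hstrip f g \<and> area g = area f + a. tab_num j g)
    = ((a + j - 1) choose a) * tab_num j f"
  using assms
proof (induction j arbitrary: f a)
  case 0
  let ?S = "{g. hstrip f g \<and> area g = area f + a}"
  have fin: "finite ?S" using finite_hstrip_right[OF 0] .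
  have "(\<Sum>g\<in>?S. tab_num 0 g) = (\<Sum>g\<in>?S. if g = (\<lambda>_. 0) then 1 else 0)"
    by (intro sum.cong) auto
  also have "\<dots> = of_bool ((\<lambda>_. 0) \<in> ?S)"
    using fin by (subst sum.delta) auto
  also have "\<dots> = of_bool (f = (\<lambda>_. 0) \<and> a = 0)"
    by (auto simp: hstrip_zero_right area_zero)
  \<comment> \<open>Truncated subtraction gives 0 choose 0 for \<open>a = 0\<close>; otherwise
    \<open>a - 1\<close> choose \<open>a\<close> vanishes.\<close>
  also have "\<dots> = ((a + 0 - 1) choose a) * tab_num 0 f"
    by (cases a) auto
  finally show ?case .
next
  case (Suc j)
  let ?U = "{g. hstrip f g \<and> area g = area f + a}"
  let ?D = "{d. hstrip d f}"
  let ?V = "\<lambda>k d. {g. hstrip d g \<and> area g = area d + (a - k)}"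
  \<comment> \<open>Row 0 of the common extension \<open>u\<close> has no partner among the rows of
    the common restriction. Its excess over the lower bound becomes the index \<open>k\<close>, and
    the area count then leaves \<open>a - k\<close> cells for the strip from the restriction to
    \<open>g\<close>.\<close>
  let ?top = "\<lambda>u g. u 0 - max (f 0) (g 0)"
  let ?down = "\<lambda>u g i. max (f (Suc i)) (g (Suc i)) + min (f i) (g i) - u (Suc i)"
  let ?up = "\<lambda>k d g i. case i of 0 \<Rightarrow> max (f 0) (g 0) + k
      | Suc i \<Rightarrow> max (f (Suc i)) (g (Suc i)) + min (f i) (g i) - d i"
  note f = Suc.prems
  have shape: "u \<in> shapes" if "hstrip f u" for u
    using hstrip_shape_right that f by blast
  have downshape: "d \<in> shapes" if "hstrip d f" for d
    using hstrip_shape_left that f by blast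
  have between: "max (f (Suc i)) (g (Suc i)) \<le> x \<longleftrightarrow> f (Suc i) \<le> x \<and> g (Suc i) \<le> x"
      "x \<le> min (f i) (g i) \<longleftrightarrow> x \<le> f i \<and> x \<le> g i" for g i x
    by auto
  have reflect: "p + q - x \<le> q" "p \<le> p + q - x" "x + (p + q - x) = p + q" "p + q - (p + q - x) = x"
    if "p \<le> x" "x \<le> q" for p q x :: nat
    using that by auto
  have down: "?down u g i \<le> f i" "?down u g i \<le> g i" "f (Suc i) \<le> ?down u g i" "g (Suc i) \<le> ?down u g i"
      "u (Suc i) + ?down u g i = max (f (Suc i)) (g (Suc i)) + min (f i) (g i)"
      "max (f (Suc i)) (g (Suc i)) + min (f i) (g i) - ?down u g i = u (Suc i)"
    if "hstrip f u" "hstrip g u" for u g i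
  proof -
    have p: "max (f (Suc i)) (g (Suc i)) \<le> u (Suc i)" and q: "u (Suc i) \<le> min (f i) (g i)"
      using that by (auto simp: hstrip_def)
    show "?down u g i \<le> f i" "?down u g i \<le> g i" "f (Suc i) \<le> ?down u g i" "g (Suc i) \<le> ?down u g i"
      using reflect(1,2)[OF p q] unfolding between by auto
    show "u (Suc i) + ?down u g i = max (f (Suc i)) (g (Suc i)) + min (f i) (g i)"
      "max (f (Suc i)) (g (Suc i)) + min (f i) (g i) - ?down u g i = u (Suc i)"
      using reflect(3,4)[OF p q] by auto
  qed
  have area: "area u + area d = area f + area g + k"
    if fs: "f \<in> shapes" and gs: "g \<in> shapes" and "u 0 = max (f 0) (g 0) + k"
      and "\<And>i. u (Suc i) + d i = max (f (Suc i)) (g (Suc i)) + min (f i) (g i)" for u d g k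
  proof -
    obtain L1 where L1: "\<And>i. i \<ge> L1 \<Longrightarrow> f i = 0" using shapes_vanish[OF fs] by blast
    obtain L2 where L2: "\<And>i. i \<ge> L2 \<Longrightarrow> g i = 0" using shapes_vanish[OF gs] by blast
    show ?thesis by (rule area_toggle[of "max L1 L2"]) (use L1 L2 that in auto)
  qed
  have fwd: "?up (?top u g) (?down u g) g = u" "?top u g \<le> a" "hstrip (?down u g) f"
      "hstrip (?down u g) g" "area g = area (?down u g) + (a - ?top u g)"
    if fu: "hstrip f u" and au: "area u = area f + a" and gu: "hstrip g u" for u g
  proof -
    note dn = down[OF fu gu]
    have top: "u 0 = max (f 0) (g 0) + ?top u g"
      using hstrip_le[OF fu, of 0] hstrip_le[OF gu, of 0] by auto
    show "?up (?top u g) (?down u g) g = u"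
      using top dn(6) by (auto simp: fun_eq_iff split: nat.split)
    have g: "g \<in> shapes" using shape[OF fu] gu hstrip_shape_left by blast
    show h1: "hstrip (?down u g) f" using dn by (auto simp: hstrip_def)
    show h2: "hstrip (?down u g) g" using dn by (auto simp: hstrip_def)
    have ar: "area u + area (?down u g) = area f + area g + ?top u g"
      by (rule area[OF f g top dn(5)])
    have "area (?down u g) \<le> area g" using hstrip_area h2 g by blast
    then show "?top u g \<le> a" "area g = area (?down u g) + (a - ?top u g)"
      using ar au by auto
  qed
  have bwd: "?top (?up k d g) g = k" "?down (?up k d g) g = d" "hstrip f (?up k d g)"
      "hstrip g (?up k d g)" "area (?up k d g) = area f + a"
    if k: "k \<le> a" and df: "hstrip d f" and dg: "hstrip d g"
      and ag: "area g = area d + (a - k)" for k d g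
  proof -
    have g: "g \<in> shapes" using dg downshape[OF df] hstrip_shape_right by blast
    have ineq: "d i \<le> f i" "d i \<le> g i" "f (Suc i) \<le> d i" "g (Suc i) \<le> d i" for i
      using df dg by (auto simp: hstrip_def)
    have p: "max (f (Suc i)) (g (Suc i)) \<le> d i" and q: "d i \<le> min (f i) (g i)" for i
      using ineq by auto
    have up: "?up k d g (Suc i) + d i = max (f (Suc i)) (g (Suc i)) + min (f i) (g i)" for i
      using reflect(3)[OF p q] by (simp add: add.commute)
    have b: "?up k d g (Suc i) \<le> f i" "?up k d g (Suc i) \<le> g i"
        "f (Suc i) \<le> ?up k d g (Suc i)" "g (Suc i) \<le> ?up k d g (Suc i)" for i
      using reflect(1,2)[OF p[of i] q[of i]] unfolding between by auto
    have "f i \<le> ?up k d g i" for i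
      by (cases i, simp, simp only: b)
    with b(1) show "hstrip f (?up k d g)" unfolding hstrip_def by blast
    have "g i \<le> ?up k d g i" for i
      by (cases i, simp, simp only: b)
    with b(2) show "hstrip g (?up k d g)" unfolding hstrip_def by blast
    have "area (?up k d g) + area d = area f + area g + k"
      by (rule area[OF f g _ up]) simp
    then show "area (?up k d g) = area f + a"
      using ag k by auto
    show "?down (?up k d g) g = d" using reflect(4)[OF p q] by (simp add: fun_eq_iff)
    show "?top (?up k d g) g = k" by simp
  qed
  define top down up where defs:
      "top = (\<lambda>(u :: nat \<Rightarrow> nat) (g :: nat \<Rightarrow> nat). ?top u g)" "down = (\<lambda>u g. ?down u g)"
      "up = (\<lambda>k d g. ?up k d g)"
  have fwd': "up (top u g) (down u g) g = u" "top u g \<le> a" "hstrip (down u g) f"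
      "hstrip (down u g) g" "area g = area (down u g) + (a - top u g)"
    if "hstrip f u" "area u = area f + a" "hstrip g u" for u g
    unfolding defs by (rule fwd[OF that])+
  have bwd': "top (up k d g) g = k" "down (up k d g) g = d" "hstrip f (up k d g)"
      "hstrip g (up k d g)" "area (up k d g) = area f + a"
    if "k \<le> a" "hstrip d f" "hstrip d g" "area g = area d + (a - k)" for k d g
    unfolding defs by (rule bwd[OF that])+
  have bij: "(\<Sum>(u, g)\<in>Sigma ?U (\<lambda>u. {g. hstrip g u}). tab_num j g)
    = (\<Sum>(k, d, g)\<in>Sigma {..a} (\<lambda>k. Sigma ?D (?V k)). tab_num j g)"
    by (rule sum.reindex_bij_witness[where j = "\<lambda>(u, g). (top u g, down u g, g)"
        and i = "\<lambda>(k, d, g). (up k d g, g)"])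
      (clarsimp simp: fwd'(1-4) bwd' simp del: diff_is_0_eq' Nat.add_diff_assoc | erule (2) fwd'(5))+
  have "(\<Sum>u\<in>?U. tab_num (Suc j) u) = (\<Sum>(u, g)\<in>Sigma ?U (\<lambda>u. {g. hstrip g u}). tab_num j g)"
    using finite_hstrip_right[OF f] finite_hstrip_left shape
    by (subst sum.Sigma[symmetric]) auto
  also have "\<dots> = (\<Sum>k\<le>a. \<Sum>d\<in>?D. \<Sum>g\<in>?V k d. tab_num j g)"
    unfolding bij using finite_hstrip_left[OF f] finite_hstrip_right downshape
    by (subst sum.Sigma[symmetric], simp, blast)+ (simp add: sum.Sigma)
  also have "\<dots> = (\<Sum>k\<le>a. \<Sum>d\<in>?D. ((a - k + j - 1) choose (a - k)) * tab_num j d)"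
    by (intro sum.cong refl Suc.IH) (auto simp: downshape)
  also have "\<dots> = (\<Sum>k\<le>a. (a - k + j - 1) choose (a - k)) * tab_num (Suc j) f"
    by (simp add: sum_product)
  also have "(\<Sum>k\<le>a. (a - k + j - 1) choose (a - k)) = (\<Sum>k\<le>a. (k + j - 1) choose k)"
    by (rule sum.reindex_bij_witness[where i = "\<lambda>k. a - k" and j = "\<lambda>k. a - k"]) auto
  finally show ?case unfolding sum_choose_upper by simp
qed

section \<open>Semistandard tableaux and the Cauchy identity\<close>

text \<open>Fillings as functions of the row index, matching the zero-padded shapes. The bound
  \<open>m\<close> is the induction variable: removing the letter \<open>m\<close> leads from
  \<open>Suc m\<close> to \<open>m\<close>.\<close>

definition tableaux :: "nat \<Rightarrow> (nat \<Rightarrow> nat) \<Rightarrow> (nat \<Rightarrow> nat list) set" where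
  "tableaux m f = {T. (\<forall>i. length (T i) = f i \<and> sorted (T i) \<and> set (T i) \<subseteq> {..<m}) \<and>
     (\<forall>i j. j < f (Suc i) \<longrightarrow> T i ! j < T (Suc i) ! j)}"

definition content :: "(nat \<Rightarrow> nat list) \<Rightarrow> nat multiset" where
  "content T = (\<Sum>i | T i \<noteq> []. mset (T i))"

lemma content_eq:
  assumes "\<And>i. i \<ge> L \<Longrightarrow> T i = []"
  shows "content T = (\<Sum>i<L. mset (T i))"
proof -
  have "i < L" if "T i \<noteq> []" for i using assms[of i] that by (cases "i < L") auto
  then show ?thesis unfolding content_def by (intro sum.mono_neutral_left) auto
qed

lemma sorted_split_last:
  assumes "sorted xs" "set xs \<subseteq> {..<Suc m}"
  shows "filter (\<lambda>x. x < m) xs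
    @ replicate (length xs - length (filter (\<lambda>x. x < m) xs)) m = xs"
  using assms
proof (induction xs)
  case (Cons x xs)
  show ?case
  proof (cases "x < m")
    case True
    then show ?thesis using Cons by simp
  next
    case False
    then have "y = m" if "y \<in> set (x # xs)" for y using Cons.prems that by fastforce
    then have "x # xs = replicate (length (x # xs)) m" by (metis replicate_eqI)
    moreover have "filter (\<lambda>x. x < m) (x # xs) = []"
      using \<open>\<And>y. y \<in> set (x # xs) \<Longrightarrow> y = m\<close> by (auto simp: filter_empty_conv)
    ultimately show ?thesis by simp
  qed
qed simp

text \<open>The entries equal to the largest letter form a horizontal strip.\<close>

lemma bij_betw_tableaux_Suc:
  assumes "g \<in> shapes"
  shows "bij_betw (\<lambda>(f, T) i. T i @ replicate (g i - f i) m)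
     (SIGMA f:{f. hstrip f g}. tableaux m f) (tableaux (Suc m) g)"
proof (rule bij_betw_byWitness[where f' = "\<lambda>T. (\<lambda>i. length (filter (\<lambda>x. x < m) (T i)),
      \<lambda>i. filter (\<lambda>x. x < m) (T i))"], goal_cases)
  case 1
  show ?case
  proof (clarify, intro conjI ext)
    fix f T i assume h: "hstrip f g" and T: "T \<in> tableaux m f"
    have "set (T i) \<subseteq> {..<m}" "length (T i) = f i" using T by (auto simp: tableaux_def)
    then have "filter (\<lambda>x. x < m) (T i) = T i" by (auto simp: filter_id_conv)
    then show "filter (\<lambda>x. x < m) (T i @ replicate (g i - f i) m) = T i"
      "length (filter (\<lambda>x. x < m) (T i @ replicate (g i - f i) m)) = f i"
      using \<open>length (T i) = f i\<close> by auto
  qed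
next
  case 2
  show ?case
    by (clarsimp simp: fun_eq_iff tableaux_def) (metis sorted_split_last)
next
  case 3
  show ?case
  proof clarify
    fix f T assume h: "hstrip f g" and T: "T \<in> tableaux m f"
    have len: "length (T i) = f i" and sT: "sorted (T i)" and set: "set (T i) \<subseteq> {..<m}" for i
      using T by (auto simp: tableaux_def)
    have col: "T i ! j < T (Suc i) ! j" if "j < f (Suc i)" for i j
      using T that by (auto simp: tableaux_def)
    let ?T = "\<lambda>i. T i @ replicate (g i - f i) m"
    have "length (?T i) = g i" for i using hstrip_le[OF h, of i] len by simp
    moreover have "sorted (?T i)" for i
      using sT set[of i] by (auto simp: sorted_append)
    moreover have "set (?T i) \<subseteq> {..<Suc m}" for i
      using set[of i] by auto
    moreover have "?T i ! j < ?T (Suc i) ! j" if j: "j < g (Suc i)" for i j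
    proof -
      have ji: "j < f i" using j hstrip_ge[OF h, of i] by simp
      then have "T i ! j \<in> set (T i)" using len by simp
      then have "T i ! j < m" using set[of i] by blast
      then show ?thesis using ji j col[of j i] by (auto simp: nth_append len)
    qed
    ultimately show "?T \<in> tableaux (Suc m) g" by (auto simp: tableaux_def)
  qed
next
  case 4
  show ?case
  proof (rule image_subsetI)
    fix T assume T: "T \<in> tableaux (Suc m) g"
    let ?f = "\<lambda>i. length (filter (\<lambda>x. x < m) (T i))"
    let ?T = "\<lambda>i. filter (\<lambda>x. x < m) (T i)"
    have len: "length (T i) = g i" and sT: "sorted (T i)" and set: "set (T i) \<subseteq> {..<Suc m}" for i
      using T by (auto simp: tableaux_def)
    have col: "T i ! j < T (Suc i) ! j" if "j < g (Suc i)" for i j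
      using T that by (auto simp: tableaux_def)
    have le: "?f i \<le> g i" for i using len[of i] length_filter_le[of _ "T i"] by metis
    have nth: "T i ! j = (if j < ?f i then ?T i ! j else m)" if "j < g i" for i j
    proof -
      have "T i ! j = (?T i @ replicate (length (T i) - ?f i) m) ! j"
        using sorted_split_last[OF sT set] by simp
      then show ?thesis using that le[of i] len[of i] by (auto simp: nth_append)
    qed
    have small: "j < ?f i" if "j < g i" "T i ! j < m" for i j
      using nth[OF that(1)] that by (auto split: if_splits)
    have below: "?T i ! j < m" if "j < ?f i" for i j
      using nth_mem[OF that] by simp
    \<comment> \<open>An entry of row i with a cell beneath it is smaller than the entry there,
      which is at most \<open>m\<close>; so it belongs to the letters below
      \<open>m\<close>.\<close>
    have gf: "g (Suc i) \<le> ?f i" for i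
    proof (rule ccontr)
      assume "\<not> g (Suc i) \<le> ?f i"
      then have j: "?f i < g (Suc i)" by simp
      then have "T (Suc i) ! ?f i \<in> set (T (Suc i))" using len by simp
      then have "T i ! ?f i < m" using set[of "Suc i"] col[OF j] by fastforce
      moreover have "?f i < g i"
        using j assms by (auto simp: shapes_def antimono_iff_le_Suc intro: less_le_trans)
      ultimately show False using small by blast
    qed
    have h: "hstrip ?f g" using le gf by (auto simp: hstrip_def)
    have "?T i ! j < ?T (Suc i) ! j" if j: "j < ?f (Suc i)" for i j
    proof -
      have j2: "j < g (Suc i)" using j le[of "Suc i"] by simp
      then have j1: "j < ?f i" using gf[of i] by simp
      then have "j < g i" using le[of i] by simp
      then show ?thesis using col[OF j2] nth[OF j2] nth[of j i] j j1 by simp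
    qed
    then have "?T \<in> tableaux m ?f" using sT by (auto simp: tableaux_def sorted_wrt_filter)
    then show "(?f, ?T) \<in> (SIGMA f:{f. hstrip f g}. tableaux m f)" using h by blast
  qed
qed

lemma tableaux_0: "tableaux 0 g = (if g = (\<lambda>_. 0) then {\<lambda>_. []} else {})"
proof (cases "g = (\<lambda>_. 0)")
  case False
  then obtain i where "g i \<noteq> 0" by blast
  then have "T \<notin> tableaux 0 g" for T
    by (auto simp: tableaux_def intro!: exI[of _ i])
  then show ?thesis using False by auto
qed (auto simp: tableaux_def fun_eq_iff)

lemma finite_tableaux: "g \<in> shapes \<Longrightarrow> finite (tableaux m g)"
proof (induction m arbitrary: g)
  case (Suc m)
  have "finite (SIGMA f:{f. hstrip f g}. tableaux m f)"
    using Suc finite_hstrip_left hstrip_shape_left by (intro finite_SigmaI) auto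
  then show ?case
    using bij_betw_finite[OF bij_betw_tableaux_Suc[OF Suc.prems]] by blast
qed (simp add: tableaux_0)

lemma card_tableaux: "g \<in> shapes \<Longrightarrow> card (tableaux m g) = tab_num m g"
proof (induction m arbitrary: g)
  case (Suc m)
  have "card (tableaux (Suc m) g) = card (SIGMA f:{f. hstrip f g}. tableaux m f)"
    using bij_betw_same_card[OF bij_betw_tableaux_Suc[OF Suc.prems]] by simp
  also have "\<dots> = (\<Sum>f | hstrip f g. card (tableaux m f))"
    using Suc.prems finite_hstrip_left hstrip_shape_left finite_tableaux
    by (intro card_SigmaI) auto
  also have "\<dots> = tab_num (Suc m) g"
    using Suc hstrip_shape_left by (auto intro!: sum.cong)
  finally show ?case .
qed (simp add: tableaux_0)

lemma content_add_letter:
  assumes "g \<in> shapes" "hstrip f g" "T \<in> tableaux m f"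
  shows "content (\<lambda>i. T i @ replicate (g i - f i) x) = content T + replicate_mset (area g - area f) x"
proof -
  obtain L where L: "\<And>i. i \<ge> L \<Longrightarrow> g i = 0" using assms(1) shapes_vanish by blast
  then have Lf: "\<And>i. i \<ge> L \<Longrightarrow> f i = 0" using hstrip_vanish_left[OF assms(2)] by blast
  have len: "length (T i) = f i" for i using assms(3) by (auto simp: tableaux_def)
  then have LT: "\<And>i. i \<ge> L \<Longrightarrow> T i = []" using Lf by (metis length_0_conv)
  have "area g - area f = (\<Sum>i<L. g i - f i)"
    using L Lf hstrip_le[OF assms(2)] by (simp add: area_eq[of L] sum_subtractf_nat)
  moreover have "(\<Sum>i<L. replicate_mset (h i) x) = replicate_mset (\<Sum>i<L. h i) x" for h
    by (induction L) (auto simp: multiset_eq_iff)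
  ultimately show ?thesis
    by (simp add: content_eq[of L] L LT sum.distrib)
qed

lemma content_tableaux:
  assumes "T \<in> tableaux m f"
  shows "set_mset (content T) \<subseteq> {..<m}"
\<comment> \<open>With infinitely many nonempty rows \<open>content\<close> is the empty multiset,
  the default of sums over infinite sets.\<close>
proof (cases "finite {i. T i \<noteq> []}")
  case True
  then show ?thesis using assms by (auto simp: content_def set_mset_sum tableaux_def)
qed (simp add: content_def)

text \<open>The number of copies of the letter \<open>m\<close> is the size of the removed strip.
  Neither \<open>M\<close> nor the inner tableau contains \<open>m\<close>, so the condition on the
  content splits into one on the inner tableau and one on the size of the strip.\<close>

lemma card_content_Suc:
  assumes g: "g \<in> shapes" and M: "set_mset M \<subseteq> {..<m}"
  shows "card {T \<in> tableaux (Suc m) g. content T = M + replicate_mset a m}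
    = (\<Sum>f | hstrip f g \<and> area g = area f + a. card {T \<in> tableaux m f. content T = M})"
proof -
  let ?F = "\<lambda>(f, T) i. T i @ replicate (g i - f i) m"
  let ?P = "\<lambda>(f, T). content T = M \<and> area g = area f + a"
  have "bij_betw ?F {x \<in> (SIGMA f:{f. hstrip f g}. tableaux m f). ?P x}
      {T \<in> tableaux (Suc m) g. content T = M + replicate_mset a m}"
  proof (rule bij_betw_Collect[OF bij_betw_tableaux_Suc[OF g]], clarify)
    fix f T assume h: "hstrip f g" and T: "T \<in> tableaux m f"
    have c: "content (\<lambda>i. T i @ replicate (g i - f i) m) = content T + replicate_mset (area g - area f) m"
      using content_add_letter[OF g h T] .
    have le: "area f \<le> area g" using hstrip_area[OF h g] .
    have T0: "count (content T) m = 0" and M0: "count M m = 0"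
      using content_tableaux[OF T] M by (auto simp: not_in_iff[symmetric])
    show "(content (\<lambda>i. T i @ replicate (g i - f i) m) = M + replicate_mset a m)
        = (content T = M \<and> area g = area f + a)"
      unfolding c
    proof
      assume e: "content T + replicate_mset (area g - area f) m = M + replicate_mset a m"
      then have "count (content T + replicate_mset (area g - area f) m) m = count (M + replicate_mset a m) m"
        by simp
      then have "area g - area f = a" using T0 M0 by simp
      then show "content T = M \<and> area g = area f + a" using e le by auto
    qed auto
  qed
  then have "card {T \<in> tableaux (Suc m) g. content T = M + replicate_mset a m}
      = card {x \<in> (SIGMA f:{f. hstrip f g}. tableaux m f). ?P x}"
    using bij_betw_same_card by fastforce
  also have "{x \<in> (SIGMA f:{f. hstrip f g}. tableaux m f). ?P x}
      = (SIGMA f:{f. hstrip f g \<and> area g = area f + a}. {T \<in> tableaux m f. content T = M})"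
    by auto
  also have "card \<dots> = (\<Sum>f | hstrip f g \<and> area g = area f + a. card {T \<in> tableaux m f. content T = M})"
    using finite_hstrip_left[OF g] finite_tableaux hstrip_shape_left[OF _ g]
    by (intro card_SigmaI) auto
  finally show ?thesis .
qed

lemma shapes_area_0: "{g \<in> shapes. area g = 0} = {\<lambda>_. 0}"
  using shapes_vanish_area zero_in_shapes area_zero by fastforce

text \<open>The coefficient of the monomial \<open>M\<close> in the sum of s_g(x) s_g(1^j). Removing
  the strip of the largest letter from the tableau turns, after exchanging sums, into adding a strip
  to the argument of \<open>tab_num\<close>, which costs the eigenvalue of
  \<open>sum_tab_num_hstrip\<close>.\<close>

lemma sum_tableaux_content_times_tab_num:
  assumes "set_mset M \<subseteq> {..<m}"
  shows "(\<Sum>g | g \<in> shapes \<and> area g = size M. card {T \<in> tableaux m g. content T = M} * tab_num j g)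
    = (\<Prod>i<m. (count M i + j - 1) choose count M i)"
  using assms
proof (induction m arbitrary: M)
  case 0
  have "tab_num j (\<lambda>_. 0) = 1"
    by (induction j) (auto simp: hstrip_zero_right)
  moreover have "{T \<in> tableaux 0 (\<lambda>_. 0). content T = M} = {\<lambda>_. []}"
    using 0 by (auto simp: tableaux_0 content_def)
  ultimately show ?case using 0 by (simp add: shapes_area_0)
next
  case (Suc m)
  define a where "a = count M m"
  define M' where "M' = filter_mset (\<lambda>i. i < m) M"
  have M: "M = M' + replicate_mset a m"
    using Suc.prems by (auto simp: multiset_eq_iff M'_def a_def count_eq_zero_iff)
  have M': "set_mset M' \<subseteq> {..<m}" by (auto simp: M'_def)
  let ?G = "{g. g \<in> shapes \<and> area g = size M}"
  let ?F = "{f. f \<in> shapes \<and> area f = size M'}"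
  let ?c = "\<lambda>f. card {T \<in> tableaux m f. content T = M'}"
  have "(\<Sum>g\<in>?G. card {T \<in> tableaux (Suc m) g. content T = M} * tab_num j g)
      = (\<Sum>g\<in>?G. (\<Sum>f | hstrip f g \<and> area g = area f + a. ?c f) * tab_num j g)"
    by (intro sum.cong refl arg_cong2[where f = "(*)"]) (use card_content_Suc M' M in auto)
  also have "\<dots> = (\<Sum>g\<in>?G. \<Sum>f | f \<in> ?F \<and> hstrip f g. ?c f * tab_num j g)"
    unfolding sum_distrib_right
    by (intro sum.cong refl) (auto simp: M intro: hstrip_shape_left)
  \<comment> \<open>From here the inner shape \<open>f\<close> is fixed and the strip is added to
    it, so that the inner sum only involves \<open>tab_num\<close>.\<close>
  also have "\<dots> = (\<Sum>f\<in>?F. \<Sum>g | g \<in> ?G \<and> hstrip f g. ?c f * tab_num j g)"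
    by (intro sum.swap_restrict finite_shapes_area)
  also have "\<dots> = (\<Sum>f\<in>?F. \<Sum>g | hstrip f g \<and> area g = area f + a. ?c f * tab_num j g)"
    by (intro sum.cong refl) (auto simp: M intro: hstrip_shape_right)
  also have "\<dots> = (\<Sum>f\<in>?F. ?c f * (((a + j - 1) choose a) * tab_num j f))"
    unfolding sum_distrib_left[symmetric]
    by (intro sum.cong refl arg_cong2[where f = "(*)"] sum_tab_num_hstrip) auto
  also have "\<dots> = ((a + j - 1) choose a) * (\<Sum>f\<in>?F. ?c f * tab_num j f)"
    by (simp add: sum_distrib_left mult_ac)
  also have "\<dots> = ((a + j - 1) choose a) * (\<Prod>i<m. (count M' i + j - 1) choose count M' i)"
    by (simp add: Suc.IH[OF M'])
  also have "\<dots> = (\<Prod>i<Suc m. (count M i + j - 1) choose count M i)"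
    by (simp add: a_def M'_def)
  finally show ?case .
qed

section \<open>Partitions as shapes, and Schur functions in terms of tableaux\<close>

definition shape_of :: "nat multiset \<Rightarrow> nat \<Rightarrow> nat" where
  "shape_of \<mu> i = (if i < size \<mu> then rev (sorted_list_of_multiset \<mu>) ! i else 0)"

lemma size_sorted_list_of_multiset [simp]: "length (sorted_list_of_multiset \<mu>) = size \<mu>"
  by (metis mset_sorted_list_of_multiset size_mset)

lemma shape_of_antimono: "antimono (shape_of \<mu>)"
proof (unfold antimono_iff_le_Suc, intro allI)
  fix i
  have "sorted (sorted_list_of_multiset \<mu>)" by simp
  then show "shape_of \<mu> (Suc i) \<le> shape_of \<mu> i"
    by (auto simp: shape_of_def rev_nth intro!: sorted_nth_mono)
qed

lemma shape_of_shapes: "shape_of \<mu> \<in> shapes"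
  using shape_of_antimono by (auto simp: shapes_def shape_of_def intro!: exI[of _ "size \<mu>"])

lemma area_shape_of: "area (shape_of \<mu>) = sum_mset \<mu>"
proof -
  have "area (shape_of \<mu>) = (\<Sum>i<size \<mu>. rev (sorted_list_of_multiset \<mu>) ! i)"
    by (subst area_eq[of "size \<mu>"]) (auto simp: shape_of_def)
  also have "\<dots> = sum_list (rev (sorted_list_of_multiset \<mu>))"
    by (simp add: sum_list_sum_nth atLeast0LessThan)
  also have "\<dots> = sum_mset \<mu>"
    by (metis mset_rev mset_sorted_list_of_multiset sum_mset_sum_list)
  finally show ?thesis .
qed

lemma shape_of_pos_iff:
  assumes "0 \<notin># \<mu>"
  shows "shape_of \<mu> i \<noteq> 0 \<longleftrightarrow> i < size \<mu>"
proof -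
  have "rev (sorted_list_of_multiset \<mu>) ! i \<in># \<mu>" if "i < size \<mu>"
    using that nth_mem[of i "rev (sorted_list_of_multiset \<mu>)"] by simp
  then have "i < size \<mu> \<Longrightarrow> rev (sorted_list_of_multiset \<mu>) ! i \<noteq> 0" using assms by metis
  then show ?thesis by (simp add: shape_of_def)
qed

lemma mset_shape_of:
  assumes "0 \<notin># \<mu>"
  shows "image_mset (shape_of \<mu>) (mset_set {i. shape_of \<mu> i \<noteq> 0}) = \<mu>"
proof -
  have "image_mset (shape_of \<mu>) (mset_set {i. shape_of \<mu> i \<noteq> 0})
      = image_mset (\<lambda>i. rev (sorted_list_of_multiset \<mu>) ! i) (mset_set {..<size \<mu>})"
    unfolding shape_of_pos_iff[OF assms] by (auto simp: lessThan_def shape_of_def intro!: image_mset_cong)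
  also have "\<dots> = mset (map (\<lambda>i. rev (sorted_list_of_multiset \<mu>) ! i) [0..<size \<mu>])"
    by (simp add: atLeast0LessThan[symmetric])
  also have "map (\<lambda>i. rev (sorted_list_of_multiset \<mu>) ! i) [0..<size \<mu>] = rev (sorted_list_of_multiset \<mu>)"
    by (metis length_rev map_nth size_sorted_list_of_multiset)
  finally show ?thesis by simp
qed

text \<open>The support of a shape is an initial segment, and its values read backwards form the
  sorted list of parts.\<close>

lemma shape_of_surj:
  assumes "g \<in> shapes"
  shows "g = shape_of (image_mset g (mset_set {i. g i \<noteq> 0}))"
proof -
  obtain L where L: "\<And>i. i \<ge> L \<Longrightarrow> g i = 0" using assms shapes_vanish by blast
  have anti: "antimono g" using assms by (simp add: shapes_def)
  define l where "l = (LEAST i. g i = 0)"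
  have "g l = 0" unfolding l_def by (rule LeastI[of _ L]) (simp add: L)
  then have zero: "g i = 0" if "i \<ge> l" for i using antimonoD[OF anti that] by simp
  have "g i \<noteq> 0 \<longleftrightarrow> i < l" for i
    using zero[of i] not_less_Least[of i "\<lambda>i. g i = 0"] unfolding l_def by (meson not_le)
  then have S: "{i. g i \<noteq> 0} = {..<l}" by auto
  let ?\<mu> = "image_mset g (mset_set {i. g i \<noteq> 0})"
  let ?xs = "rev (map g [0..<l])"
  have "sorted ?xs"
    unfolding sorted_wrt_rev by (auto simp: sorted_wrt_iff_nth_less intro: antimonoD[OF anti])
  moreover have "mset ?xs = ?\<mu>" unfolding S by (simp add: atLeast0LessThan)
  ultimately have "sorted_list_of_multiset ?\<mu> = ?xs"
    by (metis sorted_list_of_multiset_mset sorted_sort_id)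
  moreover have "size ?\<mu> = l" unfolding S by simp
  ultimately show ?thesis using zero by (auto simp: fun_eq_iff shape_of_def)
qed

lemma bij_betw_shape_of: "bij_betw shape_of (partitions n) {g \<in> shapes. area g = n}"
proof (rule bij_betw_byWitness[where f' = "\<lambda>g. image_mset g (mset_set {i. g i \<noteq> 0})"])
  show "\<forall>\<mu>\<in>partitions n. image_mset (shape_of \<mu>) (mset_set {i. shape_of \<mu> i \<noteq> 0}) = \<mu>"
    using mset_shape_of by (auto simp: partitions_def simp del: neq0_conv)
  show "\<forall>g\<in>{g \<in> shapes. area g = n}. shape_of (image_mset g (mset_set {i. g i \<noteq> 0})) = g"
    using shape_of_surj by force
  show "shape_of ` partitions n \<subseteq> {g \<in> shapes. area g = n}"
    by (auto simp: partitions_def shape_of_shapes area_shape_of)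
  have "0 \<notin># image_mset g (mset_set {i. g i \<noteq> 0})" for g :: "nat \<Rightarrow> nat"
    by (cases "finite {i. g i \<noteq> 0}") auto
  then show "(\<lambda>g. image_mset g (mset_set {i. g i \<noteq> 0})) ` {g \<in> shapes. area g = n} \<subseteq> partitions n"
    by (auto simp: partitions_def area_def sum_unfold_sum_mset)
qed

lemma bij_betw_ssyt:
  "bij_betw (\<lambda>T i. if i < size \<mu> then T ! i else []) {T \<in> ssyt \<mu>. \<Union> (set ` set T) \<subseteq> {..<m}}
     (tableaux m (shape_of \<mu>))"
proof (rule bij_betw_byWitness[where f' = "\<lambda>T. map T [0..<size \<mu>]"], goal_cases)
  case 1
  show ?case
  proof (clarify)
    fix T assume "T \<in> ssyt \<mu>"
    then have "length (map length T) = size \<mu>" by (simp add: ssyt_def)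
    then show "map (\<lambda>i. if i < size \<mu> then T ! i else []) [0..<size \<mu>] = T"
      by (intro nth_equalityI) auto
  qed
next
  case 2
  show ?case by (auto simp: tableaux_def fun_eq_iff shape_of_def)
next
  case 3
  show ?case
  proof clarify
    fix T assume T: "T \<in> ssyt \<mu>" and m: "\<Union> (set ` set T) \<subseteq> {..<m}"
    then have "map length T = rev (sorted_list_of_multiset \<mu>)" by (simp add: ssyt_def)
    then have len: "length T = size \<mu>" "\<And>i. i < size \<mu> \<Longrightarrow> length (T ! i) = shape_of \<mu> i"
      by (metis length_map length_rev size_sorted_list_of_multiset)
        (metis \<open>map length T = rev (sorted_list_of_multiset \<mu>)\<close> length_map length_rev nth_map
          shape_of_def size_sorted_list_of_multiset)
    have z: "shape_of \<mu> i = 0" if "\<not> i < size \<mu>" for i using that by (simp add: shape_of_def)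
    have col: "T ! i ! j < T ! Suc i ! j" if "Suc i < length T" "j < length (T ! Suc i)" for i j
      using T that by (simp add: ssyt_def)
    show "(\<lambda>i. if i < size \<mu> then T ! i else []) \<in> tableaux m (shape_of \<mu>)"
      using T m len z col by (auto simp: tableaux_def ssyt_def)
        (metis nth_mem subsetD lessThan_iff UN_subset_iff | metis less_nat_zero_code Suc_lessD)+
  qed
next
  case 4
  show ?case
  proof clarify
    fix T assume "T \<in> tableaux m (shape_of \<mu>)"
    then have T: "\<And>i. length (T i) = shape_of \<mu> i" "\<And>i. sorted (T i)" "\<And>i. set (T i) \<subseteq> {..<m}"
      "\<And>i j. j < shape_of \<mu> (Suc i) \<Longrightarrow> T i ! j < T (Suc i) ! j"
      by (auto simp: tableaux_def)
    have "map length (map T [0..<size \<mu>]) = rev (sorted_list_of_multiset \<mu>)"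
      by (rule nth_equalityI) (auto simp: T shape_of_def)
    then show "map T [0..<size \<mu>] \<in> ssyt \<mu> \<and> \<Union> (set ` set (map T [0..<size \<mu>])) \<subseteq> {..<m}"
      using T by (auto simp: ssyt_def)
  qed
qed

lemma content_ssyt:
  assumes "T \<in> ssyt \<mu>"
  shows "content (\<lambda>i. if i < size \<mu> then T ! i else []) = mset (concat T)"
proof -
  have "length (map length T) = size \<mu>" using assms by (simp add: ssyt_def)
  then have len: "length T = size \<mu>" by simp
  have "content (\<lambda>i. if i < size \<mu> then T ! i else []) = (\<Sum>i<size \<mu>. mset (T ! i))"
    by (subst content_eq[of "size \<mu>"]) auto
  also have "\<dots> = sum_list (map mset T)"
    by (simp add: sum_list_sum_nth len atLeast0LessThan)
  finally show ?thesis by (simp add: mset_concat)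
qed

text \<open>Every bound \<open>m\<close> above the variables of \<open>M\<close> works, because a
  tableau of content \<open>M\<close> has no letters outside \<open>M\<close>.\<close>

lemma coeff_s_sym:
  assumes "set_mset M \<subseteq> {..<m}"
  shows "coeff (s_sym \<mu>) M = of_nat (card {T \<in> tableaux m (shape_of \<mu>). content T = M})"
proof -
  let ?S = "{T \<in> ssyt \<mu>. \<Union> (set ` set T) \<subseteq> {..<m}}"
  have "bij_betw (\<lambda>T i. if i < size \<mu> then T ! i else []) {T \<in> ?S. mset (concat T) = M}
     {T \<in> tableaux m (shape_of \<mu>). content T = M}"
    by (rule bij_betw_Collect[OF bij_betw_ssyt]) (auto simp: content_ssyt)
  moreover have "{T \<in> ?S. mset (concat T) = M} = {T \<in> ssyt \<mu>. mset (concat T) = M}"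
    using assms by (auto simp flip: set_concat)
  ultimately show ?thesis
    using bij_betw_same_card by (fastforce simp: s_sym_def)
qed

text \<open>The monomials that contribute are the contents of the tableaux with letters below
  \<open>m\<close>; grouping these tableaux by content turns the sum of coefficients into their
  number.\<close>

lemma eval_ones_s_sym: "eval_ones m (s_sym \<mu>) = of_nat (tab_num m (shape_of \<mu>))"
proof -
  let ?S = "tableaux m (shape_of \<mu>)"
  have fin: "finite ?S" by (simp add: finite_tableaux shape_of_shapes)
  have "{M. set_mset M \<subseteq> {..<m} \<and> coeff (s_sym \<mu>) M \<noteq> 0} = content ` ?S"
  proof (intro equalityI subsetI)
    fix M assume "M \<in> {M. set_mset M \<subseteq> {..<m} \<and> coeff (s_sym \<mu>) M \<noteq> 0}"
    then have "card {T \<in> ?S. content T = M} \<noteq> 0" using coeff_s_sym by auto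
    then have "{T \<in> ?S. content T = M} \<noteq> {}" by (metis card.empty)
    then show "M \<in> content ` ?S" by blast
  next
    fix M assume "M \<in> content ` ?S"
    then obtain T where T: "T \<in> ?S" "content T = M" by blast
    then have M: "set_mset M \<subseteq> {..<m}" using content_tableaux by blast
    have "card {T \<in> ?S. content T = M} \<noteq> 0" using T fin by auto
    then show "M \<in> {M. set_mset M \<subseteq> {..<m} \<and> coeff (s_sym \<mu>) M \<noteq> 0}" 
      using M coeff_s_sym[OF M] by simp
  qed
  then have "eval_ones m (s_sym \<mu>) = (\<Sum>M\<in>content ` ?S. coeff (s_sym \<mu>) M)"
    by (simp add: eval_ones_def)
  also have "\<dots> = (\<Sum>M\<in>content ` ?S. of_nat (card {T \<in> ?S. content T = M}))"
    using content_tableaux by (intro sum.cong refl coeff_s_sym) blast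
  also have "\<dots> = of_nat (\<Sum>M\<in>content ` ?S. \<Sum>T | T \<in> ?S \<and> content T = M. 1)"
    by simp
  also have "\<dots> = of_nat (\<Sum>T\<in>?S. 1)"
    using sum.image_gen[OF fin, of "\<lambda>_. 1::nat" content] by metis
  also have "\<dots> = of_nat (tab_num m (shape_of \<mu>))"
    by (simp add: card_tableaux shape_of_shapes)
  finally show ?thesis .
qed

text \<open>For \<open>size M = n\<close> this is the previous count carried over along
  \<open>shape_of\<close>. Otherwise both sides vanish, since a tableau of area \<open>n\<close> has
  a content of size \<open>n\<close>.\<close>

lemma sum_partitions_schur:
  assumes M: "set_mset M \<subseteq> {..<m}"
  shows "(\<Sum>\<mu>\<in>partitions n. eval_ones N (s_sym \<mu>) * coeff (s_sym \<mu>) M)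
    = of_bool (size M = n) * (\<Prod>i<m. of_nat ((count M i + N - 1) choose count M i))"
proof (cases "size M = n")
  case True
  let ?c = "\<lambda>g. card {T \<in> tableaux m g. content T = M}"
  have "(\<Sum>\<mu>\<in>partitions n. eval_ones N (s_sym \<mu>) * coeff (s_sym \<mu>) M)
      = (\<Sum>\<mu>\<in>partitions n. of_nat (?c (shape_of \<mu>) * tab_num N (shape_of \<mu>)))"
    by (simp add: coeff_s_sym[OF M] eval_ones_s_sym mult.commute)
  also have "\<dots> = of_nat (\<Sum>g | g \<in> shapes \<and> area g = n. ?c g * tab_num N g)"
    using sum.reindex_bij_betw[OF bij_betw_shape_of, of "\<lambda>g. of_nat (?c g * tab_num N g)"] by simp
  also have "\<dots> = of_nat (\<Prod>i<m. (count M i + N - 1) choose count M i)"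
    using sum_tableaux_content_times_tab_num[OF M] True by simp
  finally show ?thesis using True by simp
next
  case False
  have "coeff (s_sym \<mu>) M = 0" if "\<mu> \<in> partitions n" for \<mu>
  proof -
    have "size M = n" if T: "T \<in> tableaux m (shape_of \<mu>)" and c: "content T = M" for T
    proof -
      have len: "length (T i) = shape_of \<mu> i" for i using T by (simp add: tableaux_def)
      obtain L where L: "\<And>i. i \<ge> L \<Longrightarrow> shape_of \<mu> i = 0" using shape_of_shapes shapes_vanish by blast
      then have "T i = []" if "i \<ge> L" for i using that len[of i] by simp
      then have "size M = (\<Sum>i<L. length (T i))" using content_eq[of L T] c by auto
      also have "\<dots> = n" using L area_eq[of L "shape_of \<mu>"] len \<open>\<mu> \<in> partitions n\<close>
        by (simp add: area_shape_of partitions_def)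
      finally show ?thesis .
    qed
    then have "{T \<in> tableaux m (shape_of \<mu>). content T = M} = {}" using False by blast
    then show ?thesis unfolding coeff_s_sym[OF M] by (simp only: card.empty of_nat_0)
  qed
  then show ?thesis using False by simp
qed

section \<open>Multiplicative power series\<close>

lemma coeff_simps [simp]:
  "coeff 0 M = 0" "coeff 1 M = of_bool (M = {#})" "coeff (f + g) M = coeff f M + coeff g M"
  "coeff (- f) M = - coeff f M" "coeff (f - g) M = coeff f M - coeff g M"
  "coeff (c *\<^sub>Q f) M = c * coeff f M"
  by (simp_all add: zero_mpseries.rep_eq one_mpseries.rep_eq plus_mpseries.rep_eq
      uminus_mpseries.rep_eq minus_mpseries.rep_eq scaleQ.rep_eq)

lemma coeff_times: "coeff (f * g) M = (\<Sum>(A, B) | A + B = M. coeff f A * coeff g B)"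
  by (simp add: times_mpseries.rep_eq)

lemma coeff_sum [simp]: "coeff (\<Sum>x\<in>S. f x) M = (\<Sum>x\<in>S. coeff (f x) M)"
  by (induction S rule: infinite_finite_induct) auto

lemma scaleQ_mult_left [simp]: "(c *\<^sub>Q f) * g = c *\<^sub>Q (f * g)"
  by (rule mpseries_eqI) (simp add: coeff_times sum_distrib_left case_prod_unfold mult.assoc)

lemma scaleQ_mult_right [simp]: "f * (c *\<^sub>Q g) = c *\<^sub>Q (f * g)"
  using scaleQ_mult_left[of c g f] by (simp add: mult.commute)

lemma scaleQ_scaleQ [simp]: "c *\<^sub>Q (d *\<^sub>Q f) = (c * d) *\<^sub>Q f"
  by (rule mpseries_eqI) simp

lemma scaleQ_1 [simp]: "1 *\<^sub>Q f = f" and scaleQ_0 [simp]: "0 *\<^sub>Q f = 0"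
  by (rule mpseries_eqI, simp)+

lemma scaleQ_sum_right: "c *\<^sub>Q (\<Sum>x\<in>S. f x) = (\<Sum>x\<in>S. c *\<^sub>Q f x)"
  by (rule mpseries_eqI) (simp add: sum_distrib_left)

lemma scaleQ_sum_left: "(\<Sum>x\<in>S. c x) *\<^sub>Q f = (\<Sum>x\<in>S. c x *\<^sub>Q f)"
  by (rule mpseries_eqI) (simp add: sum_distrib_right)

lemma coeff_of_nat: "coeff (of_nat n) M = of_nat n * of_bool (M = {#})"
  by (induction n) (auto simp: algebra_simps)

lemma of_nat_eq_scaleQ: "of_nat n = of_nat n *\<^sub>Q (1 :: mpseries)"
  by (rule mpseries_eqI) (simp add: coeff_of_nat)

lemma of_nat_times_eq_scaleQ: "of_nat n * f = of_nat n *\<^sub>Q (f :: mpseries)"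
  by (subst of_nat_eq_scaleQ) simp

text \<open>The product of \<phi>(x_i) over all variables, for a \<phi> with constant term 1: the
  variables outside \<open>M\<close> then contribute factors 1.\<close>

definition mult_series :: "rat fps \<Rightarrow> mpseries" where
  "mult_series \<phi> = Mpseries (\<lambda>M. \<Prod>i\<in>set_mset M. \<phi> $ count M i)"

lemma coeff_mult_series:
  assumes "\<phi> $ 0 = 1" "finite S" "set_mset M \<subseteq> S"
  shows "coeff (mult_series \<phi>) M = (\<Prod>i\<in>S. \<phi> $ count M i)"
  unfolding mult_series_def coeff_Mpseries using assms
  by (intro prod.mono_neutral_left) (auto simp: count_eq_zero_iff[symmetric])

text \<open>To split a monomial in two is to split each exponent independently, so the sum over
  splittings factors into a product of one-variable convolutions.\<close>

lemma mult_series_mult: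
  assumes \<phi>: "\<phi> $ 0 = 1" and \<psi>: "\<psi> $ 0 = 1"
  shows "mult_series \<phi> * mult_series \<psi> = mult_series (\<phi> * \<psi>)"
proof (rule mpseries_eqI)
  fix M :: "nat multiset"
  let ?S = "set_mset M"
  let ?ms = "\<lambda>f. \<Sum>i\<in>?S. replicate_mset (f i) i"
  have count_ms: "count (?ms f) i = (if i \<in> ?S then f i else 0)" for f i
    by (simp add: count_sum)
  have sub: "set_mset A \<subseteq> ?S" "set_mset B \<subseteq> ?S" if "A + B = M" for A B
    using that by auto
  have "coeff (mult_series \<phi> * mult_series \<psi>) M
      = (\<Sum>(A, B) | A + B = M. \<Prod>i\<in>?S. \<phi> $ count A i * \<psi> $ count B i)"
    unfolding coeff_times prod.distrib
    by (intro sum.cong refl) (auto simp: coeff_mult_series[OF \<phi> _ sub(1)] coeff_mult_series[OF \<psi> _ sub(2)])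
  also have "\<dots> = (\<Sum>f\<in>(\<Pi>\<^sub>E i\<in>?S. {..count M i}). \<Prod>i\<in>?S. \<phi> $ f i * \<psi> $ (count M i - f i))"
  proof (rule sum.reindex_bij_witness[where j = "\<lambda>(A, B). restrict (count A) ?S"
        and i = "\<lambda>f. (?ms f, ?ms (\<lambda>i. count M i - f i))"], goal_cases)
    case (1 a)
    then obtain A B where a: "a = (A, B)" "A + B = M" by auto
    then have c: "count M i = count A i + count B i" for i by auto
    then show ?case using a(1) by (auto simp: multiset_eq_iff count_ms not_in_iff)
  next
    case (2 a)
    then show ?case by auto
  next
    case (3 f)
    then show ?case by (auto simp: fun_eq_iff count_ms PiE_def extensional_def)
  next
    case (4 f)
    then have "f i + (count M i - f i) = count M i" if "i \<in># M" for i
      using that by (auto simp: PiE_def Pi_def)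
    then show ?case by (auto simp: multiset_eq_iff count_ms count_eq_zero_iff)
  next
    case (5 a)
    then show ?case by auto
  qed
  also have "\<dots> = (\<Prod>i\<in>?S. \<Sum>a\<le>count M i. \<phi> $ a * \<psi> $ (count M i - a))"
    by (subst prod_sum_PiE) auto
  also have "\<dots> = coeff (mult_series (\<phi> * \<psi>)) M"
    by (simp add: mult_series_def fps_mult_nth atLeast0AtMost)
  finally show "coeff (mult_series \<phi> * mult_series \<psi>) M = coeff (mult_series (\<phi> * \<psi>)) M" .
qed

lemma mult_series_1: "mult_series 1 = 1"
proof (rule mpseries_eqI)
  fix M :: "nat multiset"
  show "coeff (mult_series 1) M = coeff 1 M"
    by (cases M) (auto simp: mult_series_def intro!: prod_zero)
qed

lemma mult_series_power:
  assumes "\<phi> $ 0 = 1"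
  shows "mult_series \<phi> ^ N = mult_series (\<phi> ^ N)"
  by (induction N) (auto simp: mult_series_1 mult_series_mult assms fps_power_zeroth)

text \<open>The substitution of x_i t for each x_i; the power of t records the degree.\<close>

definition graded :: "mpseries \<Rightarrow> mpseries fps" where
  "graded f = Abs_fps (\<lambda>n. Mpseries (\<lambda>M. of_bool (size M = n) * coeff f M))"

lemma coeff_graded: "coeff (graded f $ n) M = of_bool (size M = n) * coeff f M"
  by (simp add: graded_def)

lemma graded_mult: "graded (f * g) = graded f * graded g"
proof (intro fps_ext mpseries_eqI)
  fix n M
  have pick: "(\<Sum>i=0..n. of_bool (size A = i) * coeff f A * (of_bool (size B = n - i) * coeff g B))
      = of_bool (size A + size B = n) * (coeff f A * coeff g B)" for A B
  proof -
    have "(\<Sum>i=0..n. of_bool (size A = i) * coeff f A * (of_bool (size B = n - i) * coeff g B))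
        = (\<Sum>i=0..n. if i = size A then of_bool (size B = n - i) * (coeff f A * coeff g B) else 0)"
      by (intro sum.cong) auto
    then show ?thesis by auto
  qed
  have "coeff ((graded f * graded g) $ n) M
      = (\<Sum>i=0..n. \<Sum>(A, B) | A + B = M. of_bool (size A = i) * coeff f A * (of_bool (size B = n - i) * coeff g B))"
    by (simp add: fps_mult_nth coeff_times coeff_graded)
  also have "\<dots> = (\<Sum>(A, B) | A + B = M. of_bool (size A + size B = n) * (coeff f A * coeff g B))"
    unfolding pick[symmetric] by (subst sum.swap) (simp add: case_prod_unfold)
  also have "\<dots> = (\<Sum>(A, B) | A + B = M. of_bool (size M = n) * (coeff f A * coeff g B))"
    by (intro sum.cong refl) auto
  also have "\<dots> = coeff (graded (f * g) $ n) M"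
    by (simp add: coeff_graded coeff_times sum_distrib_left case_prod_unfold)
  finally show "coeff (graded (f * g) $ n) M = coeff ((graded f * graded g) $ n) M" ..
qed

lemma graded_1: "graded 1 = 1"
  by (intro fps_ext mpseries_eqI) (auto simp: coeff_graded)

lemma graded_power: "graded (f ^ N) = graded f ^ N"
  by (induction N) (auto simp: graded_1 graded_mult)

section \<open>The series H(t) and E(t) as products over the variables\<close>

definition E_series :: "mpseries fps" where
  "E_series = Abs_fps e_gen"

lemma prod_of_bool: "finite S \<Longrightarrow> (\<Prod>i\<in>S. of_bool (P i)) = (of_bool (\<forall>i\<in>S. P i) :: rat)"
  by (induction S rule: finite_induct) auto

lemma H_series_graded: "H_series = graded (mult_series (Abs_fps (\<lambda>_. 1)))"
  by (intro fps_ext mpseries_eqI) (auto simp: H_series_def h_gen_def coeff_graded mult_series_def)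

lemma E_series_graded: "E_series = graded (mult_series (1 + fps_X))"
proof (intro fps_ext mpseries_eqI)
  fix n and M :: "nat multiset"
  have "(\<Prod>i\<in>set_mset M. (1 + fps_X :: rat fps) $ count M i) = (\<Prod>i\<in>set_mset M. of_bool (count M i \<le> 1))"
  proof (intro prod.cong refl)
    fix i assume "i \<in># M"
    then obtain c where "count M i = Suc c" by (metis count_eq_zero_iff not0_implies_Suc)
    then show "(1 + fps_X :: rat fps) $ count M i = of_bool (count M i \<le> 1)" by auto
  qed
  also have "\<dots> = of_bool (\<forall>i. count M i \<le> 1)"
  proof -
    have "count M i \<le> 1" if "\<forall>i\<in>set_mset M. count M i \<le> 1" for i
      using that by (cases "i \<in># M") (auto simp: not_in_iff)
    then have "(\<forall>i\<in>set_mset M. count M i \<le> 1) \<longleftrightarrow> (\<forall>i. count M i \<le> 1)" by blast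
    then show ?thesis by (simp only: prod_of_bool finite_set_mset)
  qed
  finally show "coeff (E_series $ n) M = coeff (graded (mult_series (1 + fps_X)) $ n) M"
    by (simp add: E_series_def e_gen_def coeff_graded mult_series_def)
qed

definition alternate :: "mpseries fps \<Rightarrow> mpseries fps" where
  "alternate F = Abs_fps (\<lambda>n. (- 1) ^ n *\<^sub>Q F $ n)"

text \<open>The degree is the sum of the exponents, so passing to -t is the same as passing to -x_i
  in every factor.\<close>

lemma alternate_mult_graded:
  "alternate (graded (mult_series \<phi>)) = graded (mult_series (Abs_fps (\<lambda>n. (- 1) ^ n * \<phi> $ n)))"
proof (intro fps_ext mpseries_eqI)
  fix n and M :: "nat multiset"
  have "(\<Prod>i\<in>set_mset M. (- 1) ^ count M i) = ((- 1) ^ size M :: rat)"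
    by (simp add: size_multiset_overloaded_eq power_sum)
  then show "coeff (alternate (graded (mult_series \<phi>)) $ n) M
      = coeff (graded (mult_series (Abs_fps (\<lambda>n. (- 1) ^ n * \<phi> $ n))) $ n) M"
    by (auto simp: alternate_def coeff_graded mult_series_def prod.distrib)
qed

text \<open>Multiplicativity reduces this to (1 - x)^-1 (1 - x) = 1 in one variable.\<close>

lemma H_series_times_alternate_E: "H_series * alternate E_series = 1"
proof -
  have "Abs_fps (\<lambda>_. 1) * Abs_fps (\<lambda>n. (- 1) ^ n * (1 + fps_X) $ n) = (1 :: rat fps)"
  proof -
    have "Abs_fps (\<lambda>n. (- 1) ^ n * (1 + fps_X) $ n) = (1 - fps_X :: rat fps)"
      by (rule fps_ext) (auto simp: fps_X_def)
    then show ?thesis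
      by (intro fps_ext) (auto simp: right_diff_distrib)
  qed
  then show ?thesis
    by (simp add: H_series_graded E_series_graded alternate_mult_graded graded_1
        mult_series_1 mult_series_mult flip: graded_mult)
qed

lemma E_series_times_alternate_H: "E_series * alternate H_series = 1"
proof -
  have "(1 + fps_X) * Abs_fps (\<lambda>n. (- 1) ^ n * Abs_fps (\<lambda>_. 1) $ n) = (1 :: rat fps)"
  proof (rule fps_ext)
    fix n show "((1 + fps_X) * Abs_fps (\<lambda>n. (- 1) ^ n * Abs_fps (\<lambda>_. 1) $ n)) $ n = (1 :: rat fps) $ n"
      by (cases n) (auto simp: distrib_right)
  qed
  then show ?thesis
    by (simp add: H_series_graded E_series_graded alternate_mult_graded graded_1
        mult_series_1 mult_series_mult flip: graded_mult)
qed

text \<open>The coefficients of (1 - x)^-N. At \<open>N = 0\<close> truncated subtraction yields 1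
  for \<open>n = 0\<close> and 0 otherwise, as it must.\<close>

lemma ones_power_nth: "(Abs_fps (\<lambda>_. 1) ^ N :: rat fps) $ n = of_nat ((n + N - 1) choose n)"
proof (induction N arbitrary: n)
  case 0
  then show ?case by (cases n) auto
next
  case (Suc N)
  have "(Abs_fps (\<lambda>_. 1) ^ Suc N :: rat fps) $ n = of_nat (\<Sum>i\<le>n. (i + N - 1) choose i)"
    by (simp add: power_Suc2 fps_mult_nth Suc.IH atLeast0AtMost del: power_Suc)
  then show ?case unfolding sum_choose_upper by simp
qed

lemma one_plus_X_power_nth: "((1 + fps_X) ^ N :: rat fps) $ n = of_nat (N choose n)"
  by (simp flip: fps_binomial_of_nat binomial_gbinomial)

lemma coeff_H_series_power:
  "coeff ((H_series ^ N) $ n) M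
    = of_bool (size M = n) * (\<Prod>i\<in>set_mset M. of_nat ((count M i + N - 1) choose count M i))"
proof -
  have "H_series ^ N = graded (mult_series (Abs_fps (\<lambda>_. 1) ^ N))"
    by (simp add: H_series_graded mult_series_power flip: graded_power)
  then show ?thesis by (simp add: coeff_graded mult_series_def ones_power_nth)
qed

lemma coeff_E_series_power:
  "coeff ((E_series ^ N) $ n) M
    = of_bool (size M = n) * (\<Prod>i\<in>set_mset M. of_nat (N choose count M i))"
proof -
  have "E_series ^ N = graded (mult_series ((1 + fps_X) ^ N))"
    by (simp add: E_series_graded mult_series_power flip: graded_power)
  then show ?thesis by (simp add: coeff_graded mult_series_def one_plus_X_power_nth)
qed

lemma prod_exponents: "(\<Prod>i\<in>#exponents M. \<phi> i) = (\<Prod>i\<in>set_mset M. \<phi> (count M i))"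
  for \<phi> :: "nat \<Rightarrow> rat"
  by (simp add: exponents_def prod_unfold_prod_mset image_mset.compositionality comp_def)

lemma exponents_partitions: "exponents M \<in> partitions (size M)"
proof -
  have "0 \<notin> count M ` set_mset M" by (auto simp flip: not_in_iff)
  then show ?thesis
    by (auto simp: partitions_def exponents_def size_multiset_overloaded_eq sum_unfold_sum_mset)
qed

lemma finite_partitions: "finite (partitions n)"
  using bij_betw_finite[OF bij_betw_shape_of] finite_shapes_area by blast

text \<open>A monomial occurs in \<open>m_sym\<close> of its own exponents only, so a weight
  multiplicative in the parts becomes a product over the variables.\<close>

lemma coeff_sum_m_sym:
  "coeff (\<Sum>\<mu>\<in>partitions n. (\<Prod>i\<in>#\<mu>. \<phi> i) *\<^sub>Q m_sym \<mu>) M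
    = of_bool (size M = n) * (\<Prod>i\<in>set_mset M. \<phi> (count M i))"
proof -
  have "coeff (\<Sum>\<mu>\<in>partitions n. (\<Prod>i\<in>#\<mu>. \<phi> i) *\<^sub>Q m_sym \<mu>) M
      = (\<Sum>\<mu>\<in>partitions n. if \<mu> = exponents M then (\<Prod>i\<in>#\<mu>. \<phi> i) else 0)"
    by (auto simp: m_sym_def intro!: sum.cong)
  also have "\<dots> = of_bool (exponents M \<in> partitions n) * (\<Prod>i\<in>#exponents M. \<phi> i)"
    by (simp add: finite_partitions)
  also have "exponents M \<in> partitions n \<longleftrightarrow> size M = n"
    using exponents_partitions[of M] by (auto simp: partitions_def)
  finally show ?thesis by (simp add: prod_exponents)
qed

lemma H_series_power_m_sym:
  "(H_series ^ N) $ n = (\<Sum>\<mu>\<in>partitions n. (\<Prod>i\<in>#\<mu>. of_nat ((i + N - 1) choose i)) *\<^sub>Q m_sym \<mu>)"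
  by (rule mpseries_eqI) (simp only: coeff_H_series_power coeff_sum_m_sym)

lemma E_series_power_m_sym:
  "(E_series ^ N) $ n = (\<Sum>\<mu>\<in>partitions n. (\<Prod>i\<in>#\<mu>. of_nat (N choose i)) *\<^sub>Q m_sym \<mu>)"
  by (rule mpseries_eqI) (simp only: coeff_E_series_power coeff_sum_m_sym)

lemma H_series_power_s_sym:
  "(H_series ^ N) $ n = (\<Sum>\<mu>\<in>partitions n. eval_ones N (s_sym \<mu>) *\<^sub>Q s_sym \<mu>)"
proof (rule mpseries_eqI)
  fix M :: "nat multiset"
  obtain m where "\<forall>i\<in>set_mset M. i < m"
    using finite_nat_set_iff_bounded[of "set_mset M"] by auto
  then have m: "set_mset M \<subseteq> {..<m}" by auto
  have "(\<Prod>i<m. of_nat ((count M i + N - 1) choose count M i))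
      = (\<Prod>i\<in>set_mset M. of_nat ((count M i + N - 1) choose count M i) :: rat)"
    using m by (intro prod.mono_neutral_right) (auto simp: not_in_iff)
  then show "coeff ((H_series ^ N) $ n) M
      = coeff (\<Sum>\<mu>\<in>partitions n. eval_ones N (s_sym \<mu>) *\<^sub>Q s_sym \<mu>) M"
    by (simp add: coeff_H_series_power sum_partitions_schur[OF m])
qed

section \<open>Expansions over partitions\<close>

text \<open>Only the factor at \<open>i\<close> changes. Cross-multiplying by the old factor states
  this without division.\<close>

lemma prod_count_add_mset:
  fixes g :: "'a \<Rightarrow> nat \<Rightarrow> 'b::comm_monoid_mult"
  assumes "\<And>j. g j 0 = 1"
  shows "(\<Prod>j\<in>set_mset (add_mset i \<nu>). g j (count (add_mset i \<nu>) j)) * g i (count \<nu> i)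
    = g i (Suc (count \<nu> i)) * (\<Prod>j\<in>set_mset \<nu>. g j (count \<nu> j))"
proof -
  let ?S = "set_mset \<nu> - {i}"
  have 1: "(\<Prod>j\<in>set_mset (add_mset i \<nu>). g j (count (add_mset i \<nu>) j))
      = g i (Suc (count \<nu> i)) * (\<Prod>j\<in>?S. g j (count (add_mset i \<nu>) j))"
    by (simp add: prod.insert_remove)
  have 2: "(\<Prod>j\<in>?S. g j (count (add_mset i \<nu>) j)) = (\<Prod>j\<in>?S. g j (count \<nu> j))"
    by (intro prod.cong) auto
  have 3: "(\<Prod>j\<in>set_mset \<nu>. g j (count \<nu> j)) = g i (count \<nu> i) * (\<Prod>j\<in>?S. g j (count \<nu> j))"
    by (cases "i \<in># \<nu>") (auto simp: prod.remove not_in_iff assms)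
  show ?thesis unfolding 1 2 3 by (simp add: mult_ac)
qed

lemma z_part_add_mset: "z_part (add_mset i \<nu>) = of_nat (i * Suc (count \<nu> i)) * z_part \<nu>"
proof -
  let ?g = "\<lambda>i c. of_nat i ^ c * fact c :: rat"
  have "z_part (add_mset i \<nu>) * ?g i (count \<nu> i) = ?g i (Suc (count \<nu> i)) * z_part \<nu>"
    unfolding z_part_def by (rule prod_count_add_mset) simp
  show ?thesis
  proof (cases "i = 0")
    \<comment> \<open>A part 0 makes both sides zero, because it contributes a positive power of
      0.\<close>
    case True
    then show ?thesis by (auto simp: z_part_def intro!: prod_zero bexI[of _ 0])
  next
    case False
    then have "?g i (count \<nu> i) \<noteq> 0" by simp
    moreover have "z_part (add_mset i \<nu>) * ?g i (count \<nu> i)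
        = of_nat (i * Suc (count \<nu> i)) * z_part \<nu> * ?g i (count \<nu> i)"
      using \<open>z_part (add_mset i \<nu>) * ?g i (count \<nu> i) = _\<close> by (simp only: power_Suc fact_Suc of_nat_mult mult_ac)
    ultimately show ?thesis using mult_right_cancel by blast
  qed
qed

definition mult_fact :: "nat multiset \<Rightarrow> rat" where
  "mult_fact \<mu> = (\<Prod>i\<in>set_mset \<mu>. fact (count \<mu> i))"

lemma mult_fact_add_mset: "mult_fact (add_mset i \<nu>) = of_nat (Suc (count \<nu> i)) * mult_fact \<nu>"
proof -
  have "mult_fact (add_mset i \<nu>) * fact (count \<nu> i) = fact (Suc (count \<nu> i)) * mult_fact \<nu>"
    unfolding mult_fact_def by (rule prod_count_add_mset) simp
  then have "mult_fact (add_mset i \<nu>) * fact (count \<nu> i)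
      = of_nat (Suc (count \<nu> i)) * mult_fact \<nu> * fact (count \<nu> i)"
    by (simp only: fact_Suc mult_ac)
  then show ?thesis by (simp only: mult_right_cancel[OF fact_nonzero])
qed

lemma mult_fact_pos: "mult_fact \<mu> > 0"
  by (auto simp: mult_fact_def intro!: prod_pos)

lemma inverse_mult_fact_remove:
  assumes "i \<in># \<mu>"
  shows "1 / mult_fact (\<mu> - {#i#}) = of_nat (count \<mu> i) / mult_fact \<mu>"
proof -
  obtain \<nu> where \<mu>: "\<mu> = add_mset i \<nu>" using assms by (meson mset_add)
  show ?thesis using mult_fact_pos[of \<nu>] by (simp add: \<mu> mult_fact_add_mset del: of_nat_Suc)
qed

lemma partitions_parts: "\<mu> \<in> partitions n \<Longrightarrow> i \<in># \<mu> \<Longrightarrow> 1 \<le> i \<and> i \<le> n"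
  by (cases "i = 0") (auto simp: partitions_def dest!: multi_member_split)

lemma partitions_0: "partitions 0 = {{#}}"
  by (auto simp: partitions_def sum_mset_0_iff) (metis multiset_nonemptyE)

lemma size_le_sum_mset: "0 \<notin># \<mu> \<Longrightarrow> size \<mu> \<le> sum_mset \<mu>"
  by (induction \<mu>) auto

lemma sum_mset_eq_sum_count: "sum_mset \<mu> = (\<Sum>i\<in>set_mset \<mu>. i * count \<mu> i)"
proof (induction \<mu>)
  case (add x \<mu>)
  have "(\<Sum>i\<in>set_mset \<mu> - {x}. i * count (add_mset x \<mu>) i) = (\<Sum>i\<in>set_mset \<mu> - {x}. i * count \<mu> i)"
    by (intro sum.cong) auto
  moreover have "(\<Sum>i\<in>set_mset \<mu>. i * count \<mu> i) = x * count \<mu> x + (\<Sum>i\<in>set_mset \<mu> - {x}. i * count \<mu> i)"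
    by (cases "x \<in># \<mu>") (auto simp: sum.remove not_in_iff)
  ultimately show ?case using add by (simp add: sum.insert_remove)
qed simp

lemma partitions_size: "\<mu> \<in> partitions n \<Longrightarrow> size \<mu> \<le> n"
  using size_le_sum_mset by (auto simp: partitions_def)

text \<open>A partition with a marked part value \<open>i\<close> corresponds to \<open>i\<close>
  and the partition left after removing one copy. The inner sum runs over distinct values, so each
  pair arises once.\<close>

lemma sum_partitions_remove_part:
  "(\<Sum>\<mu>\<in>partitions n. \<Sum>i\<in>set_mset \<mu>. G i (\<mu> - {#i#}))
    = (\<Sum>i=1..n. \<Sum>\<nu>\<in>partitions (n - i). G i \<nu>)"
proof -
  have "(\<Sum>(\<mu>, i)\<in>Sigma (partitions n) set_mset. G i (\<mu> - {#i#}))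
      = (\<Sum>(i, \<nu>)\<in>Sigma {1..n} (\<lambda>i. partitions (n - i)). G i \<nu>)"
  proof (rule sum.reindex_bij_witness[where j = "\<lambda>(\<mu>, i). (i, \<mu> - {#i#})"
        and i = "\<lambda>(i, \<nu>). (add_mset i \<nu>, i)"], goal_cases)
    case (2 a)
    then obtain \<mu> i where a: "a = (\<mu>, i)" "\<mu> \<in> partitions n" "i \<in># \<mu>" by auto
    then have "1 \<le> i \<and> i \<le> n" using partitions_parts by blast
    moreover obtain \<nu> where "\<mu> = add_mset i \<nu>" using a(3) by (meson mset_add)
    ultimately show ?case using a by (auto simp: partitions_def)
  qed (auto simp: partitions_def)
  then show ?thesis by (simp add: sum.Sigma finite_partitions)
qed

text \<open>A product of \<open>l\<close> coefficients of \<open>U\<close> is indexed by a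
  composition, and \<open>fact l / mult_fact \<mu>\<close> of these rearrange to \<mu>. Splitting
  off the first factor \<open>i\<close> gives the share \<open>count \<mu> i\<close> of the
  \<open>Suc l\<close> positions, and the shares add up.\<close>

lemma power_nth_partitions:
  fixes U :: "mpseries fps"
  assumes "U $ 0 = 0"
  shows "(U ^ l) $ n
    = (\<Sum>\<mu>\<in>partitions n. (of_bool (size \<mu> = l) * fact l / mult_fact \<mu>) *\<^sub>Q (\<Prod>i\<in>#\<mu>. U $ i))"
proof (induction l arbitrary: n)
  case 0
  have "(\<Sum>\<mu>\<in>partitions n. (of_bool (size \<mu> = 0) * fact 0 / mult_fact \<mu>) *\<^sub>Q (\<Prod>i\<in>#\<mu>. U $ i))
      = (\<Sum>\<mu>\<in>partitions n. if \<mu> = {#} then 1 else 0)"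
    by (intro sum.cong) (auto simp: mult_fact_def)
  also have "\<dots> = (if {#} \<in> partitions n then 1 else 0)"
    by (simp add: finite_partitions)
  also have "\<dots> = (U ^ 0) $ n"
    by (auto simp: partitions_def)
  finally show ?case ..
next
  case (Suc l)
  define G where "G i \<nu> = (of_bool (size \<nu> = l) * fact l / mult_fact \<nu>) *\<^sub>Q (U $ i * (\<Prod>i\<in>#\<nu>. U $ i))" for i \<nu>
  have "(U ^ Suc l) $ n = (\<Sum>i=0..n. U $ i * U ^ l $ (n - i))"
    by (simp add: fps_mult_nth)
  also have "\<dots> = (\<Sum>i=1..n. U $ i * U ^ l $ (n - i))"
    using assms by (simp add: sum.atLeast_Suc_atMost)
  also have "\<dots> = (\<Sum>i=1..n. \<Sum>\<nu>\<in>partitions (n - i). G i \<nu>)"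
    by (simp add: Suc.IH G_def sum_distrib_left)
  also have "\<dots> = (\<Sum>\<mu>\<in>partitions n. \<Sum>i\<in>set_mset \<mu>. G i (\<mu> - {#i#}))"
    by (rule sum_partitions_remove_part[symmetric])
  also have "\<dots> = (\<Sum>\<mu>\<in>partitions n. (of_bool (size \<mu> = Suc l) * fact (Suc l) / mult_fact \<mu>) *\<^sub>Q (\<Prod>i\<in>#\<mu>. U $ i))"
  proof (intro sum.cong refl)
    fix \<mu> assume "\<mu> \<in> partitions n"
    have "G i (\<mu> - {#i#}) = (of_bool (size \<mu> = Suc l) * fact l * of_nat (count \<mu> i) / mult_fact \<mu>) *\<^sub>Q (\<Prod>i\<in>#\<mu>. U $ i)"
      if i: "i \<in># \<mu>" for i
    proof -
      obtain \<nu> where \<mu>: "\<mu> = add_mset i \<nu>" using i by (meson mset_add)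
      have "G i \<nu> = (of_bool (size \<nu> = l) * fact l * (1 / mult_fact \<nu>)) *\<^sub>Q (\<Prod>i\<in>#\<mu>. U $ i)"
        by (simp add: G_def \<mu>)
      also have "1 / mult_fact \<nu> = of_nat (count \<mu> i) / mult_fact \<mu>"
        using inverse_mult_fact_remove[OF i] by (simp add: \<mu>)
      finally show ?thesis by (simp add: \<mu>)
    qed
    then have "(\<Sum>i\<in>set_mset \<mu>. G i (\<mu> - {#i#}))
        = (\<Sum>i\<in>set_mset \<mu>. of_bool (size \<mu> = Suc l) * fact l * of_nat (count \<mu> i) / mult_fact \<mu>) *\<^sub>Q (\<Prod>i\<in>#\<mu>. U $ i)"
      by (simp add: scaleQ_sum_left)
    also have "(\<Sum>i\<in>set_mset \<mu>. of_bool (size \<mu> = Suc l) * fact l * of_nat (count \<mu> i) / mult_fact \<mu>)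
        = of_bool (size \<mu> = Suc l) * fact l * of_nat (\<Sum>i\<in>set_mset \<mu>. count \<mu> i) / mult_fact \<mu>"
      by (simp add: sum_divide_distrib sum_distrib_left)
    also have "\<dots> = of_bool (size \<mu> = Suc l) * fact (Suc l) / mult_fact \<mu>"
      by (auto simp flip: size_multiset_overloaded_eq)
    finally show "(\<Sum>i\<in>set_mset \<mu>. G i (\<mu> - {#i#}))
        = (of_bool (size \<mu> = Suc l) * fact (Suc l) / mult_fact \<mu>) *\<^sub>Q (\<Prod>i\<in>#\<mu>. U $ i)" .
  qed
  finally show ?case .
qed

text \<open>A partition occurs in exactly one power of \<open>U\<close>, the one given by its
  length.\<close>

lemma sum_powers_nth_partitions:
  fixes U :: "mpseries fps"
  assumes "U $ 0 = 0"
  shows "(\<Sum>l\<le>L. c l *\<^sub>Q (U ^ l) $ n)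
    = (\<Sum>\<mu>\<in>partitions n. (of_bool (size \<mu> \<le> L) * c (size \<mu>) * fact (size \<mu>) / mult_fact \<mu>) *\<^sub>Q (\<Prod>i\<in>#\<mu>. U $ i))"
proof -
  have pick: "(\<Sum>l\<le>L. c l * (of_bool (size \<mu> = l) * fact l / mult_fact \<mu>))
      = of_bool (size \<mu> \<le> L) * c (size \<mu>) * fact (size \<mu>) / mult_fact \<mu>" for \<mu> :: "nat multiset"
  proof -
    have "(\<Sum>l\<le>L. c l * (of_bool (size \<mu> = l) * fact l / mult_fact \<mu>))
        = (\<Sum>l\<le>L. if l = size \<mu> then c l * fact l / mult_fact \<mu> else 0)"
      by (intro sum.cong) auto
    then show ?thesis by auto
  qed
  have "(\<Sum>l\<le>L. c l *\<^sub>Q (U ^ l) $ n)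
    = (\<Sum>\<mu>\<in>partitions n. (\<Sum>l\<le>L. c l * (of_bool (size \<mu> = l) * fact l / mult_fact \<mu>)) *\<^sub>Q (\<Prod>i\<in>#\<mu>. U $ i))"
    unfolding power_nth_partitions[OF assms] scaleQ_sum_right scaleQ_sum_left scaleQ_scaleQ
    by (rule sum.swap)
  then show ?thesis unfolding pick .
qed

lemma multinom_partition:
  assumes "\<mu> \<in> partitions n"
  shows "multinom K n (count \<mu>) = of_nat (K choose size \<mu>) * fact (size \<mu>) / mult_fact \<mu>"
proof -
  have sub: "set_mset \<mu> \<subseteq> {1..n}" using partitions_parts[OF assms] by auto
  have "(\<Sum>i=1..n. count \<mu> i) = size \<mu>"
    unfolding size_multiset_overloaded_eq using sub
    by (intro sum.mono_neutral_right) (auto simp: not_in_iff)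
  moreover have "(\<Prod>i=1..n. fact (count \<mu> i)) = mult_fact \<mu>"
    unfolding mult_fact_def using sub
    by (intro prod.mono_neutral_right) (auto simp: not_in_iff)
  ultimately show ?thesis
    by (simp add: multinom_def binomial_gbinomial gbinomial_mult_fact' atLeast0LessThan)
qed

lemma prod_mset_partition_cong:
  assumes "\<mu> \<in> partitions n" "\<And>i. i \<ge> 1 \<Longrightarrow> f i = g i"
  shows "(\<Prod>i\<in>#\<mu>. f i) = (\<Prod>i\<in>#\<mu>. g i)"
  using partitions_parts[OF assms(1)] assms(2)
  by (intro arg_cong[where f = prod_mset] image_mset_cong) auto

lemma power_nth_multinomial:
  fixes F :: "mpseries fps"
  assumes "F $ 0 = 1"
  shows "(F ^ N) $ n = (\<Sum>\<mu>\<in>partitions n. multinom N n (count \<mu>) *\<^sub>Q (\<Prod>i\<in>#\<mu>. F $ i))"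
proof -
  define U where "U = F - 1"
  have U: "U $ 0 = 0" "F = U + 1" "\<And>i. i \<ge> 1 \<Longrightarrow> U $ i = F $ i" using assms by (simp_all add: U_def)
  have "F ^ N = (\<Sum>l\<le>N. of_nat (N choose l) * U ^ l)"
    unfolding U(2) by (simp add: binomial_ring)
  then have "(F ^ N) $ n = (\<Sum>l\<le>N. of_nat (N choose l) *\<^sub>Q (U ^ l) $ n)"
    by (simp add: fps_sum_nth of_nat_times_eq_scaleQ)
  also have "\<dots> = (\<Sum>\<mu>\<in>partitions n. multinom N n (count \<mu>) *\<^sub>Q (\<Prod>i\<in>#\<mu>. F $ i))"
    unfolding sum_powers_nth_partitions[OF U(1)]
    by (intro sum.cong refl arg_cong2[where f = scaleQ] prod_mset_partition_cong U)
      (auto simp: multinom_partition binomial_eq_0)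
  finally show ?thesis .
qed

text \<open>The negative binomial expansion, with an explicit remainder so that it needs no
  composition of formal power series over a ring with zero divisors.\<close>

lemma negative_binomial_remainder:
  fixes A V :: "'a::comm_ring_1"
  assumes "A * (1 + V) = 1"
  shows "\<exists>R. A ^ N = (\<Sum>l\<le>L. (- 1) ^ l * of_nat ((N + l - 1) choose l) * V ^ l) + V ^ Suc L * R"
proof (induction N)
  case 0
  have "(\<Sum>l\<le>L. (- 1) ^ l * of_nat ((0 + l - 1) choose l) * V ^ l) = (1::'a)"
    by (induction L) (auto simp: binomial_eq_0)
  then show ?case by (intro exI[of _ 0]) simp
next
  case (Suc N)
  let ?T = "\<lambda>N. \<Sum>l\<le>L. (- 1) ^ l * of_nat ((N + l - 1) choose l) * V ^ l"
  let ?c = "(- 1) ^ L * of_nat ((N + L) choose L) :: 'a"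
  obtain R where R: "A ^ N = ?T N + V ^ Suc L * R" using Suc by blast
  \<comment> \<open>By Pascal's rule neighbouring terms combine; only the top term, of order
    \<open>Suc L\<close>, is left over.\<close>
  have step: "(1 + V) * (\<Sum>l\<le>L. (- 1) ^ l * of_nat ((Suc N + l - 1) choose l) * V ^ l)
      = (\<Sum>l\<le>L. (- 1) ^ l * of_nat ((N + l - 1) choose l) * V ^ l)
        + (- 1) ^ L * of_nat ((N + L) choose L) * V ^ Suc L" for L
  proof (induction L)
    case (Suc L)
    have "of_nat (Suc (N + L) choose Suc L) = (of_nat ((N + L) choose L) + of_nat ((N + L) choose Suc L) :: 'a)"
      by simp
    then show ?case using Suc by (simp add: algebra_simps)
  qed simp
  \<comment> \<open>The left-over term joins the remainder, and \<open>A * (1 + V) = 1\<close>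
    absorbs the extra factor \<open>A\<close>.\<close>
  have "A ^ Suc N = A * (((1 + V) * ?T (Suc N) - ?c * V ^ Suc L) + V ^ Suc L * R)"
    unfolding step by (simp add: R)
  also have "\<dots> = (A * (1 + V)) * ?T (Suc N) + V ^ Suc L * (A * (R - ?c))"
    by (simp only: algebra_simps)
  finally show ?case using assms by auto
qed

text \<open>Expands F(-t)^-N with \<open>V\<close> = F(-t) - 1. It serves both the pair H, E and the
  pair E, H, which is why both expansions have the same coefficients.\<close>

lemma power_nth_alternate:
  fixes A F :: "mpseries fps"
  assumes F0: "F $ 0 = 1" and A: "A * alternate F = 1"
  shows "(A ^ N) $ n = (\<Sum>\<mu>\<in>partitions n.
    (eps_part \<mu> * multinom (N + size \<mu> - 1) n (count \<mu>)) *\<^sub>Q (\<Prod>i\<in>#\<mu>. F $ i))"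
proof -
  define V where "V = alternate F - 1"
  have V: "V $ 0 = 0" "\<And>i. i \<ge> 1 \<Longrightarrow> V $ i = (- 1) ^ i *\<^sub>Q F $ i"
    using F0 by (simp_all add: V_def alternate_def)
  have prodV: "(\<Prod>i\<in>#\<mu>. V $ i) = (- 1) ^ n *\<^sub>Q (\<Prod>i\<in>#\<mu>. F $ i)" if "\<mu> \<in> partitions n" for \<mu>
  proof -
    have "(\<Prod>i\<in>#\<mu>. V $ i) = (\<Prod>i\<in>#\<mu>. (- 1) ^ i *\<^sub>Q F $ i)"
      by (rule prod_mset_partition_cong[OF that V(2)])
    also have "\<dots> = (- 1) ^ sum_mset \<mu> *\<^sub>Q (\<Prod>i\<in>#\<mu>. F $ i)"
      by (induction \<mu>) (simp_all add: power_add mult.commute)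
    finally show ?thesis using that by (simp add: partitions_def)
  qed
  have "A * (1 + V) = 1" using A by (simp add: V_def)
  then obtain R where R: "A ^ N = (\<Sum>l\<le>n. (- 1) ^ l * of_nat ((N + l - 1) choose l) * V ^ l) + V ^ Suc n * R"
    using negative_binomial_remainder by blast
  \<comment> \<open>\<open>V\<close> has no constant term, so the remainder starts only in degree
    \<open>n + 1\<close>.\<close>
  have "V ^ Suc n $ i = 0" if "i \<le> n" for i
    using startsby_zero_power_prefix[OF V(1), of "Suc n"] that by auto
  then have "(V ^ Suc n * R) $ n = 0" by (simp add: fps_mult_nth del: power_Suc)
  moreover have "((- 1) ^ l * of_nat m * V ^ l) $ n = ((- 1) ^ l * of_nat m) *\<^sub>Q (V ^ l) $ n" for l m
    by (cases "even l") (auto simp: of_nat_times_eq_scaleQ intro!: mpseries_eqI)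
  ultimately have "(A ^ N) $ n = (\<Sum>l\<le>n. ((- 1) ^ l * of_nat ((N + l - 1) choose l)) *\<^sub>Q (V ^ l) $ n)"
    by (simp add: R fps_sum_nth)
  also have "\<dots> = (\<Sum>\<mu>\<in>partitions n.
    (eps_part \<mu> * multinom (N + size \<mu> - 1) n (count \<mu>)) *\<^sub>Q (\<Prod>i\<in>#\<mu>. F $ i))"
    unfolding sum_powers_nth_partitions[OF V(1)]
  proof (intro sum.cong refl)
    fix \<mu> assume \<mu>: "\<mu> \<in> partitions n"
    have le: "size \<mu> \<le> n" using partitions_size[OF \<mu>] .
    have "sum_mset \<mu> = n" using \<mu> by (simp add: partitions_def)
    \<comment> \<open>One sign comes from the negative binomial series, the other from the
      substitution of -t. Their exponents add up to the parity of
      \<open>n - size \<mu>\<close>.\<close>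
    then have "(- 1) ^ size \<mu> * (- 1) ^ n = eps_part \<mu>"
      using le by (auto simp: eps_part_def minus_one_power_iff)
    then show "(of_bool (size \<mu> \<le> n) * ((- 1) ^ size \<mu> * of_nat ((N + size \<mu> - 1) choose size \<mu>)) * fact (size \<mu>) / mult_fact \<mu>)
        *\<^sub>Q (\<Prod>i\<in>#\<mu>. V $ i)
      = (eps_part \<mu> * multinom (N + size \<mu> - 1) n (count \<mu>)) *\<^sub>Q (\<Prod>i\<in>#\<mu>. F $ i)"
      using le by (simp add: prodV[OF \<mu>] multinom_partition[OF \<mu>] mult_ac flip: \<open>_ = eps_part \<mu>\<close>)
  qed
  finally show ?thesis .
qed

section \<open>Complete, elementary and power sum expansions of H(t)^N and E(t)^N\<close>

lemma h_gen_0: "h_gen 0 = 1" and e_gen_0: "e_gen 0 = 1"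
  by (rule mpseries_eqI, auto simp: h_gen_def e_gen_def)+

lemma H_series_power_h_sym:
  "(H_series ^ N) $ n = (\<Sum>\<mu>\<in>partitions n. multinom N n (count \<mu>) *\<^sub>Q h_sym \<mu>)"
  by (simp add: power_nth_multinomial H_series_def h_gen_0 h_sym_def)

lemma H_series_power_e_sym:
  "(H_series ^ N) $ n
    = (\<Sum>\<mu>\<in>partitions n. (eps_part \<mu> * multinom (N + size \<mu> - 1) n (count \<mu>)) *\<^sub>Q e_sym \<mu>)"
  using power_nth_alternate[OF _ H_series_times_alternate_E]
  by (simp add: E_series_def e_gen_0 e_sym_def)

lemma E_series_power_h_sym:
  "(E_series ^ N) $ n
    = (\<Sum>\<mu>\<in>partitions n. (eps_part \<mu> * multinom (N + size \<mu> - 1) n (count \<mu>)) *\<^sub>Q h_sym \<mu>)"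
  using power_nth_alternate[OF _ E_series_times_alternate_H]
  by (simp add: H_series_def h_gen_0 h_sym_def)

text \<open>At a monomial \<open>M\<close> of degree \<open>n\<close>, the product of p_i and
  h_(n-i) counts the variables with exponent at least \<open>i\<close>. Summed over
  \<open>i\<close>, each variable is counted as often as its exponent, which gives
  \<open>n\<close>.\<close>

lemma h_gen_recursion: "of_nat n *\<^sub>Q h_gen n = (\<Sum>i=1..n. p_gen i * h_gen (n - i))"
proof (rule mpseries_eqI)
  fix M :: "nat multiset"
  have coeff_term: "coeff (p_gen i * h_gen (n - i)) M = of_bool (size M = n) * of_nat (card {x \<in> set_mset M. i \<le> count M x})"
    if i: "1 \<le> i" "i \<le> n" for i
  proof -
    let ?S = "{(A, B). A + B = M \<and> (\<exists>x. A = replicate_mset i x) \<and> size B = n - i}"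
    have "coeff (p_gen i * h_gen (n - i)) M
        = (\<Sum>(A, B) | A + B = M. of_bool ((\<exists>x. A = replicate_mset i x) \<and> size B = n - i))"
      unfolding coeff_times by (intro sum.cong) (auto simp: p_gen_def h_gen_def)
    also have "\<dots> = (\<Sum>x\<in>?S. 1)"
      by (intro sum.mono_neutral_cong_right finite_mset_splittings) auto
    also have "\<dots> = of_nat (card ?S)" by simp
    also have "card ?S = of_bool (size M = n) * card {x \<in> set_mset M. i \<le> count M x}"
    proof (cases "size M = n")
      case True
      have "bij_betw (\<lambda>x. (replicate_mset i x, M - replicate_mset i x)) {x \<in> set_mset M. i \<le> count M x} ?S"
        unfolding bij_betw_def
      proof
        show "inj_on (\<lambda>x. (replicate_mset i x, M - replicate_mset i x)) {x \<in> set_mset M. i \<le> count M x}"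
          using i by (auto simp: inj_on_def dest!: arg_cong[of _ _ set_mset])
        show "(\<lambda>x. (replicate_mset i x, M - replicate_mset i x)) ` {x \<in> set_mset M. i \<le> count M x} = ?S"
        proof (intro equalityI subsetI)
          fix p assume "p \<in> (\<lambda>x. (replicate_mset i x, M - replicate_mset i x)) ` {x \<in> set_mset M. i \<le> count M x}"
          then obtain x where x: "i \<le> count M x" "p = (replicate_mset i x, M - replicate_mset i x)" by auto
          then have "replicate_mset i x \<subseteq># M" by (simp add: count_le_replicate_mset_subset_eq)
          then show "p \<in> ?S" using True x by (auto simp: size_Diff_submset)
        next
          fix p assume "p \<in> ?S"
          then obtain x B where x: "p = (replicate_mset i x, B)" "M = replicate_mset i x + B" by auto
          then have "x \<in> {x \<in> set_mset M. i \<le> count M x}" using i by auto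
          then show "p \<in> (\<lambda>x. (replicate_mset i x, M - replicate_mset i x)) ` {x \<in> set_mset M. i \<le> count M x}"
            using x by (intro image_eqI[of _ _ x]) auto
        qed
      qed
      then show ?thesis using True bij_betw_same_card by fastforce
    next
      case False
      then have S: "?S = {}" using i by auto
      show ?thesis unfolding S using False by simp
    qed
    finally show ?thesis by simp
  qed
  have sum_card: "(\<Sum>i=1..n. card {x \<in> set_mset M. i \<le> count M x}) = n" if "size M = n"
  proof -
    have "(\<Sum>i=1..n. card {x \<in> set_mset M. i \<le> count M x}) = (\<Sum>i=1..n. \<Sum>x\<in>set_mset M. of_bool (i \<le> count M x))"
      by (intro sum.cong refl) (simp add: Int_def)
    also have "\<dots> = (\<Sum>x\<in>set_mset M. \<Sum>i=1..n. of_bool (i \<le> count M x))"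
      by (rule sum.swap)
    also have "\<dots> = (\<Sum>x\<in>set_mset M. count M x)"
    proof (intro sum.cong refl)
      fix x
      have "count M x \<le> n" using that count_le_size by metis
      then have "(\<Sum>i=1..n. of_bool (i \<le> count M x)) = (\<Sum>i=1..count M x. 1::nat)"
        by (intro sum.mono_neutral_cong_right) auto
      then show "(\<Sum>i=1..n. of_bool (i \<le> count M x)) = count M x" by simp
    qed
    finally show ?thesis using that by (simp add: size_multiset_overloaded_eq)
  qed
  have "(\<Sum>i=1..n. of_nat (card {x \<in> set_mset M. i \<le> count M x})) = (of_nat n :: rat)" if "size M = n"
    using sum_card[OF that] by (simp only: of_nat_sum[symmetric])
  then have "(\<Sum>i=1..n. of_bool (size M = n) * of_nat (card {x \<in> set_mset M. i \<le> count M x}))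
      = (of_nat n * of_bool (size M = n) :: rat)" by simp
  moreover have "coeff (\<Sum>i=1..n. p_gen i * h_gen (n - i)) M
      = (\<Sum>i=1..n. of_bool (size M = n) * of_nat (card {x \<in> set_mset M. i \<le> count M x}))"
    unfolding coeff_sum by (intro sum.cong refl coeff_term) auto
  ultimately show "coeff (of_nat n *\<^sub>Q h_gen n) M = coeff (\<Sum>i=1..n. p_gen i * h_gen (n - i)) M"
    by (simp add: h_gen_def)
qed

text \<open>The coefficients of (H^N)' = N Q H^N, where Q = p_1 + p_2 t + ... satisfies H' = Q H by
  the preceding recursion.\<close>

lemma H_series_power_recursion:
  "of_nat n *\<^sub>Q (H_series ^ N) $ n = (\<Sum>i=1..n. of_nat N *\<^sub>Q (p_gen i * (H_series ^ N) $ (n - i)))"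
proof (cases n)
  case 0
  then show ?thesis by simp
next
  case (Suc m)
  define Q where "Q = Abs_fps (\<lambda>n. p_gen (Suc n))"
  have reindex: "(\<Sum>i=1..Suc m. f i) = (\<Sum>i=0..m. f (Suc i))" for m and f :: "nat \<Rightarrow> mpseries"
    by (simp only: One_nat_def sum.shift_bounds_cl_Suc_ivl)
  have "fps_deriv H_series = Q * H_series"
  proof (rule fps_ext)
    fix m
    have "fps_deriv H_series $ m = of_nat (Suc m) *\<^sub>Q h_gen (Suc m)"
      by (simp add: H_series_def of_nat_times_eq_scaleQ del: of_nat_Suc)
    also have "\<dots> = (Q * H_series) $ m"
      unfolding h_gen_recursion reindex by (simp add: fps_mult_nth Q_def H_series_def)
    finally show "fps_deriv H_series $ m = (Q * H_series) $ m" .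
  qed
  then have "fps_deriv (H_series ^ N) = of_nat N * (Q * H_series ^ N)"
    unfolding fps_deriv_power' by (cases N) (simp_all add: mult_ac)
  then have "fps_deriv (H_series ^ N) $ m = of_nat N *\<^sub>Q (Q * H_series ^ N) $ m"
    by (simp add: of_nat_times_eq_scaleQ)
  then show ?thesis unfolding Suc reindex
    by (simp add: fps_mult_nth Q_def scaleQ_sum_right of_nat_times_eq_scaleQ del: of_nat_Suc)
qed

text \<open>Writing \<open>n\<close> as the sum of \<open>i * count \<mu> i\<close> marks a part
  value \<open>i\<close>, and \<open>i * count \<mu> i / z_part \<mu>\<close> is the inverse of
  \<open>z_part\<close> of the partition without that part. The result has the form of
  \<open>H_series_power_recursion\<close>, and for \<open>n > 0\<close> such a recursion determines
  the coefficient.\<close>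

lemma p_sym_sum_recursion:
  "of_nat n *\<^sub>Q (\<Sum>\<mu>\<in>partitions n. (inverse (z_part \<mu>) * c ^ size \<mu>) *\<^sub>Q p_sym \<mu>)
    = (\<Sum>i=1..n. c *\<^sub>Q (p_gen i *
        (\<Sum>\<mu>\<in>partitions (n - i). (inverse (z_part \<mu>) * c ^ size \<mu>) *\<^sub>Q p_sym \<mu>)))"
proof -
  define G where "G i \<nu> = (c * (inverse (z_part \<nu>) * c ^ size \<nu>)) *\<^sub>Q (p_gen i * p_sym \<nu>)" for i \<nu>
  have "of_nat n *\<^sub>Q (inverse (z_part \<mu>) * c ^ size \<mu>) *\<^sub>Q p_sym \<mu> = (\<Sum>i\<in>set_mset \<mu>. G i (\<mu> - {#i#}))"
    if \<mu>: "\<mu> \<in> partitions n" for \<mu>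
  proof -
    have "G i (\<mu> - {#i#}) = (of_nat (i * count \<mu> i) * inverse (z_part \<mu>) * c ^ size \<mu>) *\<^sub>Q p_sym \<mu>"
      if i: "i \<in># \<mu>" for i
    proof -
      obtain \<nu> where \<nu>: "\<mu> = add_mset i \<nu>" using i by (meson mset_add)
      have nz: "rat_of_nat (i * Suc (count \<nu> i)) \<noteq> 0"
        unfolding of_nat_eq_0_iff using partitions_parts[OF \<mu> i] by simp
      have "count \<mu> i = Suc (count \<nu> i)" by (simp add: \<nu>)
      then have "inverse (z_part \<nu>) = of_nat (i * count \<mu> i) * inverse (z_part \<mu>)"
        using nz by (simp only: \<nu> z_part_add_mset inverse_mult_distrib mult.assoc[symmetric]
            right_inverse[OF nz] mult_1_left)
      then show ?thesis by (simp add: G_def \<nu> p_sym_def mult_ac)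
    qed
    then have "(\<Sum>i\<in>set_mset \<mu>. G i (\<mu> - {#i#}))
        = (\<Sum>i\<in>set_mset \<mu>. of_nat (i * count \<mu> i) * inverse (z_part \<mu>) * c ^ size \<mu>) *\<^sub>Q p_sym \<mu>"
      by (simp add: scaleQ_sum_left)
    also have "(\<Sum>i\<in>set_mset \<mu>. of_nat (i * count \<mu> i) * inverse (z_part \<mu>) * c ^ size \<mu>)
        = of_nat (\<Sum>i\<in>set_mset \<mu>. i * count \<mu> i) * inverse (z_part \<mu>) * c ^ size \<mu>"
      by (simp add: sum_distrib_right)
    also have "(\<Sum>i\<in>set_mset \<mu>. i * count \<mu> i) = n"
      using \<mu> by (simp add: partitions_def sum_mset_eq_sum_count)
    finally show ?thesis by (simp add: mult_ac)
  qed
  then have "of_nat n *\<^sub>Q (\<Sum>\<mu>\<in>partitions n. (inverse (z_part \<mu>) * c ^ size \<mu>) *\<^sub>Q p_sym \<mu>)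
      = (\<Sum>\<mu>\<in>partitions n. \<Sum>i\<in>set_mset \<mu>. G i (\<mu> - {#i#}))"
    unfolding scaleQ_sum_right by (intro sum.cong refl) blast
  also have "\<dots> = (\<Sum>i=1..n. \<Sum>\<nu>\<in>partitions (n - i). G i \<nu>)"
    by (rule sum_partitions_remove_part)
  finally show ?thesis
    by (simp add: G_def scaleQ_sum_right sum_distrib_left)
qed

lemma H_series_power_p_sym:
  "(H_series ^ N) $ n = (\<Sum>\<mu>\<in>partitions n. (inverse (z_part \<mu>) * of_nat N ^ size \<mu>) *\<^sub>Q p_sym \<mu>)"
proof (induction n rule: less_induct)
  case (less n)
  show ?case
  proof (cases "n = 0")
    case True
    have "H_series ^ N $ 0 = 1"
      by (simp add: fps_power_zeroth H_series_def h_gen_0)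
    then show ?thesis using True by (simp add: partitions_0 z_part_def p_sym_def)
  next
    case False
    have "of_nat n *\<^sub>Q (H_series ^ N) $ n
        = of_nat n *\<^sub>Q (\<Sum>\<mu>\<in>partitions n. (inverse (z_part \<mu>) * of_nat N ^ size \<mu>) *\<^sub>Q p_sym \<mu>)"
      unfolding p_sym_sum_recursion H_series_power_recursion
      by (intro sum.cong refl) (auto simp: less.IH)
    then have "inverse (of_nat n) *\<^sub>Q of_nat n *\<^sub>Q (H_series ^ N) $ n
        = inverse (of_nat n) *\<^sub>Q of_nat n *\<^sub>Q (\<Sum>\<mu>\<in>partitions n. (inverse (z_part \<mu>) * of_nat N ^ size \<mu>) *\<^sub>Q p_sym \<mu>)"
      by (rule arg_cong)
    then show ?thesis using False by simp
  qed
qed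

section \<open>Words fixed by a permutation\<close>

lemma orbit_eq_of_mem:
  assumes "permutation w" "j \<in> orbit w i"
  shows "orbit w j = orbit w i"
  using orbit_cyclic_eq3[OF cyclic_on_orbit'[OF assms(1)] assms(2)] .

lemma fixed_list_iff:
  assumes w: "w permutes {..<n}" and "length a = n"
  shows "permute_list (inv w) a = a \<longleftrightarrow> (\<forall>i<n. a ! w i = a ! i)"
proof -
  have p: "inv w permutes {..<length a}" using assms permutes_inv by auto
  have bound: "w i < n \<longleftrightarrow> i < n" "inv w i < n \<longleftrightarrow> i < n" for i
    using permutes_in_image[OF w, of i] permutes_in_image[OF p, of i] assms(2) by auto
  have "permute_list (inv w) a = a \<longleftrightarrow> (\<forall>i<n. a ! inv w i = a ! i)"
    using assms(2) by (auto simp: list_eq_iff_nth_eq permute_list_nth[OF p])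
  also have "\<dots> \<longleftrightarrow> (\<forall>i<n. a ! w i = a ! i)"
  proof (intro iffI allI impI)
    fix i assume a: "\<forall>i<n. a ! inv w i = a ! i" "i < n"
    then have "a ! inv w (w i) = a ! w i" using bound(1) by blast
    then show "a ! w i = a ! i" by (simp only: permutes_inverses(2)[OF w])
  next
    fix i assume a: "\<forall>i<n. a ! w i = a ! i" "i < n"
    then have "a ! w (inv w i) = a ! inv w i" using bound(2) by blast
    then show "a ! inv w i = a ! i" by (simp only: permutes_inverses(1)[OF w])
  qed
  finally show ?thesis .
qed

text \<open>A word is fixed exactly if it is constant on each cycle, so it amounts to a choice of
  one letter per orbit.\<close>

lemma bij_betw_fixed_lists:
  assumes w: "w permutes {..<n}"
  shows "bij_betw (\<lambda>g. map (\<lambda>i. g (orbit w i)) [0..<n]) (orbit w ` {..<n} \<rightarrow>\<^sub>E S)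
    {a. length a = n \<and> set a \<subseteq> S \<and> permute_list (inv w) a = a}"
    (is "bij_betw ?F ?G ?A")
proof -
  have perm: "permutation w" unfolding permutation_permutes using w by (intro exI[of _ "{..<n}"]) simp
  have wn: "w i < n" if "i < n" for i using permutes_in_image[OF w, of i] that by auto
  have "inj_on ?F ?G"
  proof (rule inj_onI, rule PiE_ext)
    fix g g' C assume "g \<in> ?G" "g' \<in> ?G" and eq: "?F g = ?F g'" and "C \<in> orbit w ` {..<n}"
    then obtain i where "C = orbit w i" "i < n" by auto
    then show "g C = g' C" using eq by (auto simp: list_eq_iff_nth_eq)
  qed assumption+
  moreover have "?F ` ?G = ?A"
  proof (intro equalityI subsetI)
    fix a assume "a \<in> ?F ` ?G"
    then obtain g where g: "g \<in> ?G" "a = ?F g" by blast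
    have "\<forall>i<n. a ! w i = a ! i"
      using wn by (simp add: g(2) permutation_orbit_step[OF perm])
    moreover have "length a = n" "set a \<subseteq> S" using g by auto
    ultimately show "a \<in> ?A" using fixed_list_iff[OF w] by auto
  next
    fix a assume a: "a \<in> ?A"
    then have len: "length a = n" by simp
    then have inv: "a ! w i = a ! i" if "i < n" for i using a fixed_list_iff[OF w len] that by auto
    have const: "j < n \<and> a ! j = a ! i" if "i < n" "j \<in> orbit w i" for i j
      using that(2,1) by induction (auto simp: inv wn)
    \<comment> \<open>The representative of the orbit is arbitrary: by \<open>const\<close> all its
      positions carry the same letter.\<close>
    define g where "g = restrict (\<lambda>C. a ! (SOME j. j \<in> C)) (orbit w ` {..<n})"
    have gi: "g (orbit w i) = a ! i" if "i < n" for i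
    proof -
      have "(SOME j. j \<in> orbit w i) \<in> orbit w i"
        unfolding some_in_eq by (rule orbit_nonempty)
      then show ?thesis using const[OF that] that by (auto simp: g_def)
    qed
    have "g \<in> ?G" using a len gi by (auto simp: g_def)
    moreover have "a = ?F g" using gi len by (auto simp: list_eq_iff_nth_eq)
    ultimately show "a \<in> ?F ` ?G" by blast
  qed
  ultimately show ?thesis by (simp add: bij_betw_def)
qed

lemma card_fixed_lists:
  assumes "w permutes {..<n}" "finite S"
  shows "card {a. length a = n \<and> set a \<subseteq> S \<and> permute_list (inv w) a = a} = card S ^ card (orbit w ` {..<n})"
  using bij_betw_same_card[OF bij_betw_fixed_lists[OF assms(1)], of S] by (simp add: card_PiE)

lemma orbit_parts:
  fixes n :: nat
  assumes w: "w permutes {..<n}" and C: "C \<in> orbit w ` {..<n}"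
  shows "{i. i < n \<and> orbit w i = C} = C" "finite C" "C \<noteq> {}"
proof -
  have perm: "permutation w" unfolding permutation_permutes using w by (intro exI[of _ "{..<n}"]) simp
  obtain j where j: "j < n" "C = orbit w j" using C by blast
  have sub: "C \<subseteq> {..<n}" unfolding j(2) by (rule permutes_orbit_subset[OF w]) (simp add: j(1))
  then show "finite C" by (rule finite_subset) simp
  show "C \<noteq> {}" unfolding j(2) by (rule orbit_nonempty)
  show "{i. i < n \<and> orbit w i = C} = C"
  proof (intro equalityI subsetI)
    fix i assume "i \<in> {i. i < n \<and> orbit w i = C}"
    then show "i \<in> C" using permutation_self_in_orbit[OF perm, of i] by simp
  next
    fix i assume i: "i \<in> C"
    then have "orbit w i = C" using orbit_eq_of_mem[OF perm] j(2) by blast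
    then show "i \<in> {i. i < n \<and> orbit w i = C}" using sub i by blast
  qed
qed

section \<open>Power sums and orbit counting for coloured words\<close>

lemma p_sym_cycle_type: "p_sym (cycle_type n w) = (\<Prod>C\<in>orbit w ` {..<n}. p_gen (card C))"
  by (simp add: p_sym_def cycle_type_def prod_unfold_prod_mset image_mset.compositionality comp_def)

text \<open>The counting form of \<open>coeff_times\<close>. The sets may be infinite, as the
  variables are unbounded, so finiteness is required of the fibres.\<close>

lemma card_sum_splittings:
  fixes f :: "'a \<Rightarrow> 'c multiset" and g :: "'b \<Rightarrow> 'c multiset"
  assumes "\<And>A. finite {x \<in> X. f x = A}" "\<And>B. finite {y \<in> Y. g y = B}"
  shows "finite {(x, y). x \<in> X \<and> y \<in> Y \<and> f x + g y = M}"
    and "card {(x, y). x \<in> X \<and> y \<in> Y \<and> f x + g y = M}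
      = (\<Sum>(A, B) | A + B = M. card {x \<in> X. f x = A} * card {y \<in> Y. g y = B})"
proof -
  let ?P = "\<lambda>(A, B). {x \<in> X. f x = A} \<times> {y \<in> Y. g y = B}"
  have U: "{(x, y). x \<in> X \<and> y \<in> Y \<and> f x + g y = M} = (\<Union>p\<in>{(A, B). A + B = M}. ?P p)"
    by auto
  show "finite {(x, y). x \<in> X \<and> y \<in> Y \<and> f x + g y = M}"
    unfolding U using assms by (intro finite_UN_I finite_mset_splittings) auto
  have "card (\<Union>p\<in>{(A, B). A + B = M}. ?P p) = (\<Sum>p | case p of (A, B) \<Rightarrow> A + B = M. card (?P p))"
    using assms by (intro card_UN_disjoint finite_mset_splittings) auto
  then show "card {(x, y). x \<in> X \<and> y \<in> Y \<and> f x + g y = M}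
      = (\<Sum>(A, B) | A + B = M. card {x \<in> X. f x = A} * card {y \<in> Y. g y = B})"
    unfolding U by (simp add: case_prod_unfold card_cartesian_product)
qed

text \<open>Each cycle C receives a pair (variable, colour). The variable enters the monomial
  \<open>card C\<close> times, which is the factor \<open>p_gen (card C)\<close>, and the free
  choice of colour gives a factor \<open>N\<close>. Finiteness is carried along because the
  cardinality of an infinite set would be 0.\<close>

lemma coeff_prod_p_gen:
  fixes \<C> :: "nat set set"
  assumes "finite \<C>" "\<And>C. C \<in> \<C> \<Longrightarrow> finite C \<and> C \<noteq> {}"
  shows "finite {g \<in> \<C> \<rightarrow>\<^sub>E UNIV \<times> {..<N}. (\<Sum>C\<in>\<C>. replicate_mset (card C) (fst (g C))) = M}
    \<and> of_nat N ^ card \<C> * coeff (\<Prod>C\<in>\<C>. p_gen (card C)) M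
      = of_nat (card {g \<in> \<C> \<rightarrow>\<^sub>E UNIV \<times> {..<N}. (\<Sum>C\<in>\<C>. replicate_mset (card C) (fst (g C))) = M})"
  using assms
proof (induction \<C> arbitrary: M rule: finite_induct)
  case empty
  have "{g \<in> {} \<rightarrow>\<^sub>E UNIV \<times> {..<N}. (\<Sum>C\<in>{}. replicate_mset (card C) (fst (g C))) = M}
      = (if M = {#} then {\<lambda>_. undefined} else {})"
    by auto
  then show ?case by simp
next
  case (insert C \<C>)
  let ?S = "UNIV \<times> {..<N} :: (nat \<times> nat) set"
  let ?f = "\<lambda>x :: nat \<times> nat. replicate_mset (card C) (fst x)"
  let ?g = "\<lambda>g :: nat set \<Rightarrow> nat \<times> nat. \<Sum>C\<in>\<C>. replicate_mset (card C) (fst (g C))"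
  have IH: "finite {g \<in> \<C> \<rightarrow>\<^sub>E ?S. ?g g = B}"
      "of_nat N ^ card \<C> * coeff (\<Prod>C\<in>\<C>. p_gen (card C)) B = of_nat (card {g \<in> \<C> \<rightarrow>\<^sub>E ?S. ?g g = B})" for B
    using insert.IH insert.prems by auto
  \<comment> \<open>A nonempty cycle is what lets the repeated variable be recovered from the
    multiset.\<close>
  have pos: "card C \<noteq> 0" using insert.prems by auto
  have inj: "replicate_mset (card C) y = replicate_mset (card C) x \<longleftrightarrow> y = x" for x y :: nat
    using pos by (auto dest!: arg_cong[of _ _ set_mset])
  have f: "{p \<in> ?S. ?f p = replicate_mset (card C) x} = {x} \<times> {..<N}" for x
    unfolding inj by auto
  have "finite {x \<in> ?S. ?f x = A}
      \<and> of_nat (card {x \<in> ?S. ?f x = A}) = of_nat N * coeff (p_gen (card C)) A" for A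
  proof (cases "\<exists>x. A = replicate_mset (card C) x")
    case True
    then obtain x where x: "A = replicate_mset (card C) x" by blast
    show ?thesis unfolding x f by (auto simp: p_gen_def)
  next
    case False
    then have "{x \<in> ?S. ?f x = A} = {}" by blast
    then show ?thesis using False by (simp only: p_gen_def coeff_Mpseries) simp
  qed
  then have fin: "finite {x \<in> ?S. ?f x = A}"
    and cf: "of_nat (card {x \<in> ?S. ?f x = A}) = of_nat N * coeff (p_gen (card C)) A" for A
    by blast+
  have upd: "?g (g(C := x)) = ?g g" for g x
    using insert.hyps by (intro sum.cong) auto
  have bij: "bij_betw (\<lambda>(x, g). g(C := x)) {(x, g). x \<in> ?S \<and> g \<in> \<C> \<rightarrow>\<^sub>E ?S \<and> ?f x + ?g g = M}
      {g \<in> insert C \<C> \<rightarrow>\<^sub>E ?S. (\<Sum>C\<in>insert C \<C>. replicate_mset (card C) (fst (g C))) = M}"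
  proof (rule bij_betw_byWitness[where f' = "\<lambda>g. (g C, g(C := undefined))"], goal_cases)
    case 1
    have "g(C := undefined) = g" if "g \<in> \<C> \<rightarrow>\<^sub>E ?S" for g
      using that insert.hyps by (simp add: PiE_def extensional_def fun_upd_idem)
    then show ?case by auto
  next
    case 2
    then show ?case by auto
  next
    case 3
    have "g(C := x) \<in> insert C \<C> \<rightarrow>\<^sub>E ?S"
      "(\<Sum>D\<in>insert C \<C>. replicate_mset (card D) (fst ((g(C := x)) D))) = M"
      if "x \<in> ?S" "g \<in> \<C> \<rightarrow>\<^sub>E ?S" "?f x + ?g g = M" for x g
      using that insert.hyps upd[of g x] by (simp_all add: PiE_fun_upd del: fun_upd_apply) simp
    note upd_mem = this
    show ?case
    proof (rule image_subsetI)
      fix p assume "p \<in> {(x, g). x \<in> ?S \<and> g \<in> \<C> \<rightarrow>\<^sub>E ?S \<and> ?f x + ?g g = M}"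
      then obtain x g where p: "p = (x, g)" "x \<in> ?S" "g \<in> \<C> \<rightarrow>\<^sub>E ?S" "?f x + ?g g = M" by blast
      show "(case p of (x, g) \<Rightarrow> g(C := x))
          \<in> {g \<in> insert C \<C> \<rightarrow>\<^sub>E ?S. (\<Sum>C\<in>insert C \<C>. replicate_mset (card C) (fst (g C))) = M}"
        unfolding p(1) prod.case using upd_mem[OF p(2-4)] by blast
    qed
  next
    case 4
    have "(g C, g(C := undefined)) \<in> {(x, g). x \<in> ?S \<and> g \<in> \<C> \<rightarrow>\<^sub>E ?S \<and> ?f x + ?g g = M}"
      if g: "g \<in> insert C \<C> \<rightarrow>\<^sub>E ?S" "(\<Sum>D\<in>insert C \<C>. replicate_mset (card D) (fst (g D))) = M" for g
    proof -
      have "g C \<in> ?S" using g(1) by blast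
      moreover have "g(C := undefined) \<in> \<C> \<rightarrow>\<^sub>E ?S" using fun_upd_in_PiE[OF insert.hyps(2) g(1)] .
      moreover have "?f (g C) + ?g (g(C := undefined)) = M"
        unfolding upd using g(2) insert.hyps by simp
      ultimately show ?thesis by blast
    qed
    then show ?case by blast
  qed
  note cs = card_sum_splittings[where X = ?S and f = ?f and Y = "\<C> \<rightarrow>\<^sub>E ?S" and g = ?g and M = M, OF fin IH(1)]
  have fin': "finite {g \<in> insert C \<C> \<rightarrow>\<^sub>E ?S. (\<Sum>C\<in>insert C \<C>. replicate_mset (card C) (fst (g C))) = M}"
    using bij_betw_finite[OF bij] cs(1) by blast
  have "of_nat (card {g \<in> insert C \<C> \<rightarrow>\<^sub>E ?S. (\<Sum>C\<in>insert C \<C>. replicate_mset (card C) (fst (g C))) = M})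
      = (\<Sum>(A, B) | A + B = M. (of_nat N * coeff (p_gen (card C)) A) * (of_nat N ^ card \<C> * coeff (\<Prod>C\<in>\<C>. p_gen (card C)) B))"
    unfolding bij_betw_same_card[OF bij, symmetric] cs(2) of_nat_sum
    by (intro sum.cong refl) (auto simp: cf IH(2))
  also have "\<dots> = of_nat N ^ card (insert C \<C>) * coeff (\<Prod>C\<in>insert C \<C>. p_gen (card C)) M"
    using insert.hyps by (simp add: coeff_times sum_distrib_left case_prod_unfold mult_ac)
  finally show ?case using fin' by (simp only: simp_thms)
qed

text \<open>Makes the coefficients of the Frobenius sum into numbers of fixed points on coloured
  words, to which orbit counting applies.\<close>

lemma coeff_p_sym_cycle_type:
  assumes w: "w permutes {..<n}"
  shows "of_nat N ^ card (orbit w ` {..<n}) * coeff (p_sym (cycle_type n w)) M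
    = of_nat (card {a. length a = n \<and> set a \<subseteq> UNIV \<times> {..<N} \<and> mset (map fst a) = M \<and> permute_list (inv w) a = a})"
proof -
  let ?C = "orbit w ` {..<n}" and ?S = "UNIV \<times> {..<N} :: (nat \<times> nat) set"
  have content: "mset (map fst (map (\<lambda>i. g (orbit w i)) [0..<n])) = (\<Sum>C\<in>?C. replicate_mset (card C) (fst (g C)))"
    for g :: "nat set \<Rightarrow> nat \<times> nat"
  proof -
    have "mset (map fst (map (\<lambda>i. g (orbit w i)) [0..<n])) = (\<Sum>i\<in>{..<n}. {#fst (g (orbit w i))#})"
      by (simp add: sum_unfold_sum_mset atLeast0LessThan comp_def)
    also have "\<dots> = (\<Sum>C\<in>?C. \<Sum>i | i \<in> {..<n} \<and> orbit w i = C. {#fst (g (orbit w i))#})"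
      by (rule sum.image_gen) simp
    also have "\<dots> = (\<Sum>C\<in>?C. \<Sum>i\<in>C. {#fst (g C)#})"
    proof (intro sum.cong refl)
      fix C assume "C \<in> ?C"
      then show C: "{i. i \<in> {..<n} \<and> orbit w i = C} = C" using orbit_parts(1)[OF w] by simp
      show "{#fst (g (orbit w i))#} = {#fst (g C)#}" if "i \<in> C" for i
      proof -
        have "orbit w i = C" using that C by blast
        then show ?thesis by (rule arg_cong)
      qed
    qed
    also have "\<dots> = (\<Sum>C\<in>?C. replicate_mset (card C) (fst (g C)))"
    proof (intro sum.cong refl)
      have "(\<Sum>i\<in>C. {#y#}) = replicate_mset (card C) y" for C :: "nat set" and y :: nat
        by (induction C rule: infinite_finite_induct) auto
      then show "(\<Sum>i\<in>C. {#fst (g C)#}) = replicate_mset (card C) (fst (g C))" for C by blast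
    qed
    finally show ?thesis .
  qed
  have "of_nat N ^ card ?C * coeff (p_sym (cycle_type n w)) M
      = of_nat (card {g \<in> ?C \<rightarrow>\<^sub>E ?S. (\<Sum>C\<in>?C. replicate_mset (card C) (fst (g C))) = M})"
    unfolding p_sym_cycle_type
    by (rule conjunct2[OF coeff_prod_p_gen]) (use orbit_parts[OF w] in auto)
  also have "card {g \<in> ?C \<rightarrow>\<^sub>E ?S. (\<Sum>C\<in>?C. replicate_mset (card C) (fst (g C))) = M}
      = card {a \<in> {a. length a = n \<and> set a \<subseteq> ?S \<and> permute_list (inv w) a = a}. mset (map fst a) = M}"
    by (rule bij_betw_same_card[OF bij_betw_Collect[OF bij_betw_fixed_lists[OF w]]])
      (simp only: content)
  finally show ?thesis by (simp add: conj_ac)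
qed

text \<open>The words with content \<open>Y\<close> form a single orbit. The stabiliser of a word
  \<open>a\<close> is a translate of the set of permutations taking a base word \<open>a0\<close> to
  \<open>a\<close>, and these sets partition all permutations.\<close>

lemma sum_card_fixed_lists_mset:
  assumes n: "size Y = n"
  shows "(\<Sum>w | w permutes {..<n}. card {a. mset a = Y \<and> permute_list w a = a}) = fact n"
proof -
  let ?P = "{w. w permutes {..<n}}" and ?A = "{a. mset a = Y}"
  have finP: "finite ?P" by (simp add: finite_permutations)
  have len: "length a = n" if "mset a = Y" for a using that n by auto
  have finA: "finite ?A"
  proof (rule finite_subset)
    show "?A \<subseteq> {a. set a \<subseteq> set_mset Y \<and> length a = n}" using len by auto
  qed (simp add: finite_lists_length_eq)
  obtain a0 where a0: "mset a0 = Y" using ex_mset by blast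
  have coset: "card {w \<in> ?P. permute_list w a = a} = card {w \<in> ?P. permute_list w a0 = a}" if a: "mset a = Y" for a
  proof -
    obtain s where s: "s permutes {..<n}" "permute_list s a0 = a"
      using mset_eq_permutation[of a a0] a a0 len by metis
    have comp: "permute_list (s \<circ> w) a0 = permute_list w a" if "w permutes {..<n}" for w
      using that permute_list_compose[of w a0 s] s len[OF a0] by simp
    have "bij_betw (\<lambda>w. s \<circ> w) {w \<in> ?P. permute_list w a = a} {w \<in> ?P. permute_list w a0 = a}"
    proof (rule bij_betw_byWitness[where f' = "\<lambda>w. inv s \<circ> w"])
      show "\<forall>w\<in>{w \<in> ?P. permute_list w a = a}. inv s \<circ> (s \<circ> w) = w"
        "\<forall>w\<in>{w \<in> ?P. permute_list w a0 = a}. s \<circ> (inv s \<circ> w) = w"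
        using permutes_inv_o[OF s(1)] by (simp_all add: comp_assoc[symmetric])
      show "(\<lambda>w. s \<circ> w) ` {w \<in> ?P. permute_list w a = a} \<subseteq> {w \<in> ?P. permute_list w a0 = a}"
        using comp permutes_compose s(1) by auto
      have "permute_list (inv s \<circ> w) a = permute_list w a0" if "w permutes {..<n}" for w
      proof -
        have "inv s \<circ> w permutes {..<n}" using that s(1) permutes_compose permutes_inv by blast
        from comp[OF this] show ?thesis using permutes_inv_o[OF s(1)] by (simp add: comp_assoc[symmetric])
      qed
      then show "(\<lambda>w. inv s \<circ> w) ` {w \<in> ?P. permute_list w a0 = a} \<subseteq> {w \<in> ?P. permute_list w a = a}"
        using permutes_compose permutes_inv[OF s(1)] by auto
    qed
    then show ?thesis by (rule bij_betw_same_card)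
  qed
  have "(\<Sum>w\<in>?P. card {a. mset a = Y \<and> permute_list w a = a}) = (\<Sum>w\<in>?P. \<Sum>a | a \<in> ?A \<and> permute_list w a = a. 1)"
    by simp
  also have "\<dots> = (\<Sum>a\<in>?A. \<Sum>w | w \<in> ?P \<and> permute_list w a = a. 1)"
    by (rule sum.swap_restrict[OF finP finA])
  also have "\<dots> = (\<Sum>a\<in>?A. card {w \<in> ?P. permute_list w a0 = a})"
    using coset by (intro sum.cong) auto
  also have "\<dots> = (\<Sum>a\<in>?A. \<Sum>w | w \<in> ?P \<and> permute_list w a0 = a. 1)"
    by simp
  also have "\<dots> = (\<Sum>w\<in>?P. 1)"
    by (rule sum.group[OF finP finA]) (use a0 len[OF a0] in auto)
  also have "\<dots> = fact n"
    by (simp add: card_permutations)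
  finally show ?thesis .
qed

text \<open>A colouring of \<open>M\<close> is an orbit, under permutation of positions, of words over pairs
  (variable, colour) whose monomial is \<open>M\<close>.\<close>

definition colourings :: "nat \<Rightarrow> nat multiset \<Rightarrow> (nat \<times> nat) multiset set" where
  "colourings N M = {Y. set_mset Y \<subseteq> UNIV \<times> {..<N} \<and> image_mset fst Y = M}"

text \<open>The pairs of one fixed colour form an arbitrary monomial, and the sum of all monomials
  is the product of the (1 - x_i)^-1; each colour contributes one such factor.\<close>

lemma coeff_ones_power_colourings:
  "finite (colourings N M) \<and> coeff (mult_series (Abs_fps (\<lambda>_. 1)) ^ N) M = of_nat (card (colourings N M))"
proof (induction N arbitrary: M)
  case 0
  have "colourings 0 M = (if M = {#} then {{#}} else {})"
    by (auto simp: colourings_def)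
  then show ?case by simp
next
  case (Suc N)
  let ?L = "filter_mset (\<lambda>x. snd x < N)" and ?R = "filter_mset (\<lambda>x :: nat \<times> nat. \<not> snd x < N)"
  let ?X = "{Y. set_mset Y \<subseteq> UNIV \<times> {..<N}} :: (nat \<times> nat) multiset set"
  let ?T = "{(Y, B). Y \<in> ?X \<and> B \<in> (UNIV :: nat multiset set) \<and> image_mset fst Y + B = M}"
  have X: "{Y \<in> ?X. image_mset fst Y = A} = colourings N A" for A
    by (auto simp: colourings_def)
  have bij: "bij_betw (\<lambda>(Y, B). Y + image_mset (\<lambda>x. (x, N)) B) ?T (colourings (Suc N) M)"
  proof (rule bij_betw_byWitness[where f' = "\<lambda>Y. (?L Y, image_mset fst (?R Y))"], goal_cases)
    case 1
    have "?L Y = Y" "?R Y = {#}" if "Y \<in> ?X" for Y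
      using that by (auto simp: filter_mset_eq_conv)
    moreover have "?L (image_mset (\<lambda>x. (x, N)) B) = {#}" "?R (image_mset (\<lambda>x. (x, N)) B) = image_mset (\<lambda>x. (x, N)) B" for B :: "nat multiset"
      by (auto simp: filter_mset_image_mset comp_def)
    ultimately show ?case by (auto simp: image_mset.compositionality comp_def)
  next
    case 2
    have "image_mset (\<lambda>x. (x, N)) (image_mset fst (?R Y)) = ?R Y" if "set_mset Y \<subseteq> UNIV \<times> {..<Suc N}" for Y
    proof -
      have "image_mset (\<lambda>x. (fst x, N)) (?R Y) = image_mset (\<lambda>x. x) (?R Y)"
        using that by (intro image_mset_cong) fastforce
      then show ?thesis by (simp add: image_mset.compositionality comp_def)
    qed
    then show ?case by (auto simp: colourings_def simp flip: multiset_partition)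
  next
    case 3
    then show ?case by (auto simp: colourings_def image_mset.compositionality comp_def)
  next
    case 4
    then show ?case by (auto simp: colourings_def simp flip: image_mset_union multiset_partition)
  qed
  note cs = card_sum_splittings[where X = ?X and f = "image_mset fst" and Y = "UNIV :: nat multiset set" and g = "\<lambda>B. B" and M = M]
  have fin: "finite {Y \<in> ?X. image_mset fst Y = A}" for A unfolding X using Suc.IH by blast
  have "finite (colourings (Suc N) M)"
    using bij_betw_finite[OF bij] cs(1)[OF fin] by simp
  moreover have "of_nat (card (colourings (Suc N) M)) = (\<Sum>(A, B) | A + B = M. of_nat (card (colourings N A)) * 1 :: rat)"
    unfolding bij_betw_same_card[OF bij, symmetric] using cs(2)[OF fin]
    by (simp add: X[unfolded mem_Collect_eq] case_prod_unfold)
  moreover have "\<dots> = coeff (mult_series (Abs_fps (\<lambda>_. 1)) ^ Suc N) M"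
    using Suc.IH by (simp add: power_Suc2 coeff_times mult_series_def case_prod_unfold del: power_Suc)
  ultimately show ?case by simp
qed

text \<open>Counts pairs of a permutation and a coloured word fixed by it. Each colouring accounts
  for \<open>fact n\<close> of them, and the number of colourings is the coefficient of
  H(t)^N.\<close>

lemma sum_permutations_p_sym:
  "(\<Sum>w | w permutes {..<n}. of_nat N ^ card (orbit w ` {..<n}) *\<^sub>Q p_sym (cycle_type n w))
    = fact n *\<^sub>Q (H_series ^ N) $ n"
proof (rule mpseries_eqI)
  fix M :: "nat multiset"
  let ?X = "{a. length a = n \<and> set a \<subseteq> UNIV \<times> {..<N} \<and> mset (map fst a) = M}"
  let ?P = "{w. w permutes {..<n}}"
  have "coeff (\<Sum>w\<in>?P. of_nat N ^ card (orbit w ` {..<n}) *\<^sub>Q p_sym (cycle_type n w)) M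
      = of_nat (\<Sum>w\<in>?P. card {a \<in> ?X. permute_list (inv w) a = a})"
    by (simp add: coeff_p_sym_cycle_type conj_ac)
  also have "(\<Sum>w\<in>?P. card {a \<in> ?X. permute_list (inv w) a = a}) = (\<Sum>w\<in>?P. card {a \<in> ?X. permute_list w a = a})"
    by (rule sum.reindex_bij_witness[where i = inv and j = inv])
      (auto simp: permutes_inv permutes_inv_inv)
  also have "\<dots> = of_bool (size M = n) * (fact n * card (colourings N M))"
  proof (cases "size M = n")
    case True
    have "card {a \<in> ?X. permute_list w a = a} = (\<Sum>Y\<in>colourings N M. card {a. mset a = Y \<and> permute_list w a = a})"
      if "w \<in> ?P" for w
    proof -
      have "{a \<in> ?X. permute_list w a = a} = (\<Union>Y\<in>colourings N M. {a. mset a = Y \<and> permute_list w a = a})"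
      proof -
        have "length a = n" if "image_mset fst (mset a) = M" for a
          using that True by (metis size_image_mset size_mset)
        then show ?thesis by (auto simp: colourings_def)
      qed
      moreover have "finite {a. mset a = Y \<and> permute_list w a = a}" for Y
        by (rule finite_subset[OF _ finite_lists_length_eq[of "set_mset Y" "size Y"]]) auto
      ultimately show ?thesis using coeff_ones_power_colourings[of N M]
        by (auto intro!: card_UN_disjoint)
    qed
    then have "(\<Sum>w\<in>?P. card {a \<in> ?X. permute_list w a = a})
        = (\<Sum>w\<in>?P. \<Sum>Y\<in>colourings N M. card {a. mset a = Y \<and> permute_list w a = a})"
      by (intro sum.cong) auto
    also have "\<dots> = (\<Sum>Y\<in>colourings N M. fact n)"
      by (subst sum.swap, intro sum.cong refl sum_card_fixed_lists_mset)
        (use True in \<open>auto simp: colourings_def\<close>)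
    finally show ?thesis using True by simp
  next
    case False
    then have empty: "{a \<in> ?X. permute_list w a = a} = {}" for w by auto
    show ?thesis unfolding empty using False by simp
  qed
  also have "of_nat \<dots> = coeff (fact n *\<^sub>Q (H_series ^ N) $ n) M"
    using coeff_ones_power_colourings[of N M]
    by (simp add: H_series_graded coeff_graded flip: graded_power)
  finally show "coeff (\<Sum>w\<in>?P. of_nat N ^ card (orbit w ` {..<n}) *\<^sub>Q p_sym (cycle_type n w)) M
      = coeff (fact n *\<^sub>Q (H_series ^ N) $ n) M" .
qed

section \<open>The cycle lemma and parking functions\<close>

text \<open>The count telescopes: the minimum of \<open>S\<close> over the window \<open>{c..<c + N}\<close> increases by one
  when \<open>c\<close> moves past a good position and stays the same otherwise.\<close>

lemma cycle_lemma:
  fixes S :: "nat \<Rightarrow> int"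
  assumes "N \<ge> 1" "k \<ge> 1"
    and step: "\<And>j. S (Suc j) \<le> S j + 1" and period: "\<And>j. S (j + N) = S j + int k"
  shows "card {c. c < N \<and> (\<forall>t\<in>{1..N}. S c < S (c + t))} = k"
proof -
  define M where "M c = Min (S ` {c..<c + N})" for c
  let ?good = "\<lambda>c. \<forall>t\<in>{1..N}. S c < S (c + t)"
  have fin: "finite (S ` {c..<c + N})" "S ` {c..<c + N} \<noteq> {}" for c using assms(1) by auto
  have "M (Suc c) = M c + of_bool (?good c)" for c
  proof (cases "?good c")
    case True
    have "S c + 1 \<le> S j" if j: "j \<in> {Suc c..<Suc c + N}" for j
    proof -
      have "j = c + (j - c)" "j - c \<in> {1..N}" using j by auto
      then have "S c < S j" using True by metis
      then show ?thesis by simp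
    qed
    then have "S c + 1 \<le> M (Suc c)" unfolding M_def using fin[of "Suc c"] by (intro Min.boundedI) auto
    moreover have "M (Suc c) \<le> S (Suc c)" unfolding M_def using fin assms(1) by (intro Min_le) auto
    moreover have "M c = S c"
      unfolding M_def
    proof (rule Min_eqI)
      fix y assume "y \<in> S ` {c..<c + N}"
      then obtain j where j: "j \<in> {c..<c + N}" "y = S j" by blast
      show "S c \<le> y"
      proof (cases "j = c")
        case False
        then have "j = c + (j - c)" "j - c \<in> {1..N}" using j by auto
        then show ?thesis using True j(2) by (metis less_imp_le)
      qed (simp add: j)
    qed (use assms(1) in auto)
    ultimately show ?thesis using True step[of c] by simp
  next
    case False
    then obtain t where t: "t \<in> {1..N}" "S (c + t) \<le> S c" by (auto simp: not_less)
    \<comment> \<open>A full period raises \<open>S\<close> by \<open>k > 0\<close>, so the witness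
      \<open>c + t\<close> lies strictly inside both windows. It keeps \<open>c\<close> and
      \<open>c + N\<close> from affecting the minimum.\<close>
    have "t \<noteq> N" using t period[of c] assms(2) by auto
    then have t': "c + t \<in> {Suc c..<c + N}" using t by auto
    have split1: "{c..<c + N} = insert c {Suc c..<c + N}" using assms(1) by auto
    have split2: "{Suc c..<Suc c + N} = insert (c + N) {Suc c..<c + N}" using assms(1) by auto
    let ?W = "S ` {Suc c..<c + N}"
    have W: "finite ?W" "?W \<noteq> {}" using t' by auto
    have "Min ?W \<le> S (c + t)" using t' by (intro Min_le) auto
    then have le: "Min ?W \<le> S c" "Min ?W \<le> S (c + N)" using t(2) period[of c] by auto
    have "M c = Min ?W"
      unfolding M_def split1 image_insert Min_insert[OF W] by (rule min.absorb2[OF le(1)])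
    moreover have "M (Suc c) = Min ?W"
      unfolding M_def split2 image_insert Min_insert[OF W] by (rule min.absorb2[OF le(2)])
    ultimately show ?thesis using False by simp
  qed
  then have tele: "M m = M 0 + (\<Sum>c<m. of_bool (?good c))" for m
    by (induction m) auto
  \<comment> \<open>Shifting the window by a full period adds \<open>k\<close> to its minimum, so
    exactly \<open>k\<close> of the \<open>N\<close> steps were increments.\<close>
  have "M N = Min (S ` {N..<N + N})" by (simp add: M_def)
  also have "{N..<N + N} = (\<lambda>j. j + N) ` {0..<N}" by simp
  also have "S ` (\<lambda>j. j + N) ` {0..<N} = (\<lambda>x. x + int k) ` (S ` {0..<N})"
    unfolding image_image period ..
  also have "Min ((\<lambda>x. x + int k) ` (S ` {0..<N})) = M 0 + int k"
    using fin[of 0] by (subst mono_Min_commute[symmetric]) (auto simp: M_def mono_def)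
  finally have "(\<Sum>c<N. of_bool (?good c)) = int k" using tele[of N] by simp
  moreover have "(\<Sum>c<N. of_bool (?good c)) = int (card ({..<N} \<inter> {c. ?good c}))"
    by simp
  moreover have "{..<N} \<inter> {c. ?good c} = {c. c < N \<and> ?good c}" by auto
  ultimately show ?thesis by simp
qed

section \<open>Parking functions as good positions in the cycle lemma\<close>

lemma card_filter_sort:
  fixes a :: "nat list"
  shows "card {i. i < length a \<and> P (sort a ! i)} = card {i. i < length a \<and> P (a ! i)}"
proof -
  have "size (filter_mset P (mset (sort a))) = size (filter_mset P (mset a))" by simp
  then have "length (filter P (sort a)) = length (filter P a)"
    unfolding mset_filter[symmetric] size_mset .
  then show ?thesis by (simp add: length_filter_conv_card)
qed

text \<open>Distances are measured from the top letter: \<open>N - x < t\<close> says that x is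
  among the \<open>t\<close> largest letters. As N = (k + i r) + r (n - i), the bound on the entry
  at sorted position i says that its distance from \<open>N\<close> is at least \<open>r\<close>
  times the number of entries from i on.\<close>

lemma parking_iff_count:
  fixes r k n :: nat
  defines "N \<equiv> r * n + k"
  assumes r: "r \<ge> 1" and k: "k \<ge> 1" and len: "length a = n" and set: "set a \<subseteq> {1..N}"
  shows "a \<in> parking_functions r k n \<longleftrightarrow> (\<forall>t\<in>{1..N}. r * card {i. i < n \<and> N - a ! i < t} < t)"
proof -
  define b where "b = sort a"
  have lb: "length b = n" by (simp add: b_def len)
  have mono: "b ! i \<le> b ! j" if "i \<le> j" "j < n" for i j
    using that lb by (auto simp: b_def intro!: sorted_nth_mono)
  have "b ! i \<in> set b" if "i < n" for i using that lb by simp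
  then have bN: "b ! i \<le> N" if "i < n" for i using that set by (fastforce simp: b_def)
  have cnt: "card {i. i < n \<and> N - a ! i < t} = card {i. i < n \<and> N - b ! i < t}" for t
    using card_filter_sort[of a "\<lambda>x. N - x < t"] len by (simp add: b_def)
  have "a \<in> parking_functions r k n \<longleftrightarrow> (\<forall>i<n. b ! i \<le> k + i * r)"
    using len set by (auto simp: parking_functions_def b_def)
  also have "\<dots> \<longleftrightarrow> (\<forall>t\<in>{1..N}. r * card {i. i < n \<and> N - b ! i < t} < t)"
  proof (intro iffI ballI allI impI)
    fix t assume park: "\<forall>i<n. b ! i \<le> k + i * r" and t: "t \<in> {1..N}"
    let ?J = "{i. i < n \<and> N - b ! i < t}"
    define c where "c = card ?J"
    have cn: "c \<le> n" unfolding c_def using card_mono[of "{..<n}" ?J] by auto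
    show "r * card ?J < t"
    proof (cases "c = 0")
      case False
      \<comment> \<open>The sorted position of the smallest of the \<open>c\<close> entries with
        distance below \<open>t\<close>.\<close>
      define i where "i = n - c"
      have i: "i < n" "c = n - i" using False cn by (auto simp: i_def)
      have "N - b ! i < t"
      proof (rule ccontr)
        assume *: "\<not> N - b ! i < t"
        have "?J \<subseteq> {Suc i..<n}"
        proof
          fix j assume j: "j \<in> ?J"
          have "\<not> j \<le> i"
          proof
            assume "j \<le> i"
            then have "b ! j \<le> b ! i" using mono i by simp
            then show False using * j by auto
          qed
          then show "j \<in> {Suc i..<n}" using j by auto
        qed
        then have "c \<le> n - Suc i" unfolding c_def using card_mono[of "{Suc i..<n}" ?J] by simp
        then show False using i by simp
      qed
      moreover have "b ! i + c * r \<le> N"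
      proof -
        have "k + i * r + c * r = N" using i by (simp add: N_def algebra_simps flip: add_mult_distrib2)
        then show ?thesis using park i by (metis add_le_mono1)
      qed
      ultimately show ?thesis using bN[OF i(1)] by (simp add: c_def[symmetric] mult.commute)
    next
      case True
      then show ?thesis using t unfolding c_def[symmetric] by simp
    qed
  next
    fix i assume *: "\<forall>t\<in>{1..N}. r * card {i. i < n \<and> N - b ! i < t} < t" and i: "i < n"
    show "b ! i \<le> k + i * r"
    proof (rule ccontr)
      assume big: "\<not> b ! i \<le> k + i * r"
      \<comment> \<open>The distance from \<open>N\<close> to the bound at position
        \<open>i\<close>; a violation there puts all \<open>n - i\<close> entries from
        \<open>i\<close> on at distance below \<open>t\<close>.\<close>
      define t where "t = r * (n - i)"
      have Nt: "N = t + (k + i * r)" using i by (simp add: N_def t_def algebra_simps flip: add_mult_distrib2)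
      have "t \<in> {1..N}" using Nt i r by (auto simp: t_def)
      moreover have "{i..<n} \<subseteq> {i. i < n \<and> N - b ! i < t}"
      proof
        fix j assume j: "j \<in> {i..<n}"
        then have "b ! i \<le> b ! j" using mono by simp
        then show "j \<in> {i. i < n \<and> N - b ! i < t}" using big Nt bN[of j] j \<open>t \<in> _\<close> by auto
      qed
      then have "n - i \<le> card {i. i < n \<and> N - b ! i < t}"
        using card_mono[of "{i. i < n \<and> N - b ! i < t}" "{i..<n}"] by simp
      then have "t \<le> r * card {i. i < n \<and> N - b ! i < t}" by (simp add: t_def)
      ultimately show False using * by fastforce
    qed
  qed
  finally show ?thesis unfolding cnt .
qed

definition cyclic_shift :: "nat \<Rightarrow> nat \<Rightarrow> nat \<Rightarrow> nat" where
  "cyclic_shift N c v = (v - 1 + c) mod N + 1"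

lemma mod_add_cancel_less:
  fixes c i j N :: nat
  assumes "(c + i) mod N = (c + j) mod N" "i < N" "j < N"
  shows "i = j"
proof -
  have "i = j" if "(c + i) mod N = (c + j) mod N" "i \<le> j" "j < N" for i j
  proof -
    have "(c + j) mod N = (c + i) mod N" "c + i \<le> c + j" using that by auto
    then obtain s where "c + j = c + i + N * s" by (rule mod_eq_nat1E)
    then have "j = i + N * s" by simp
    then show ?thesis using that(3) by (cases s) auto
  qed
  then show ?thesis using assms by (metis nat_le_linear)
qed

lemma cyclic_shift_range: "N \<ge> 1 \<Longrightarrow> cyclic_shift N c v \<in> {1..N}"
  by (auto simp: cyclic_shift_def Suc_le_eq)

lemma inj_on_cyclic_shift: "inj_on (cyclic_shift N c) {1..N}"
proof (rule inj_onI)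
  fix u v assume u: "u \<in> {1..N}" and v: "v \<in> {1..N}" and "cyclic_shift N c u = cyclic_shift N c v"
  then have "(c + (u - 1)) mod N = (c + (v - 1)) mod N" by (simp add: cyclic_shift_def add.commute)
  then have "u - 1 = v - 1" by (rule mod_add_cancel_less) (use u v in auto)
  then show "u = v" using u v by auto
qed

text \<open>The shift lowers the distance from the top letter by \<open>c\<close> modulo
  \<open>N\<close>, so the letters that end up at distance below \<open>t\<close> are those whose
  distance lies in the cyclic window of length \<open>t\<close> starting at
  \<open>c\<close>.\<close>

lemma cyclic_shift_window:
  assumes v: "v \<in> {1..N}" and t: "t \<le> N"
  shows "(\<Sum>j<t. of_bool (N - v = (c + j) mod N)) = (of_bool (N - cyclic_shift N c v < t) :: nat)"
proof -
  define y where "y = N - cyclic_shift N c v"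
  define q where "q = (v - 1 + c) div N"
  have yN: "y < N" using v cyclic_shift_range[of N c v] by (auto simp: y_def)
  have "v - 1 + c = N * q + (v - 1 + c) mod N" by (simp add: q_def)
  moreover have "(v - 1 + c) mod N + 1 + y = N"
    using cyclic_shift_range[of N c v] v by (simp add: y_def cyclic_shift_def)
  ultimately have "c + y = N * q + (N - v)" using v by auto
  moreover have "N - v < N" using v by auto
  ultimately have y: "(c + y) mod N = N - v" by simp
  have "(\<Sum>j<t. of_bool (N - v = (c + j) mod N)) = (\<Sum>j<t. if j = y then 1 else 0 :: nat)"
  proof (intro sum.cong refl)
    fix j assume "j \<in> {..<t}"
    then have "j < N" using t by simp
    then have "N - v = (c + j) mod N \<longleftrightarrow> j = y"
      using y yN mod_add_cancel_less by metis
    then show "of_bool (N - v = (c + j) mod N) = (if j = y then 1 else 0 :: nat)" by simp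
  qed
  then show ?thesis by (simp add: y_def)
qed

lemma card_parking_shifts:
  fixes r k n :: nat
  defines "N \<equiv> r * n + k"
  assumes r: "r \<ge> 1" and k: "k \<ge> 1" and len: "length a = n" and set: "set a \<subseteq> {1..N}"
  shows "card {c. c < N \<and> map (cyclic_shift N c) a \<in> parking_functions r k n} = k"
proof -
  have N: "N \<ge> 1" using k by (simp add: N_def)
  define cnt where "cnt j = card {i. i < n \<and> N - a ! i = j}" for j
  \<comment> \<open>A walk that rises by 1 at each distance and falls by \<open>r\<close> for every
    letter of \<open>a\<close> found there. The counting criterion for the shift by \<open>c\<close>
    compares its later values with \<open>S c\<close>.\<close>
  define S where "S m = (\<Sum>j<m. 1 - int r * int (cnt (j mod N)))" for m
  have a: "a ! i \<in> {1..N}" if "i < n" for i using set len nth_mem[of i a] that by blast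
  have window: "(\<Sum>j<t. cnt ((c + j) mod N)) = card {i. i < n \<and> N - cyclic_shift N c (a ! i) < t}"
    if t: "t \<le> N" for c t
  proof -
    have card_eq: "card {i. i < n \<and> P i} = (\<Sum>i<n. of_bool (P i))" for P :: "nat \<Rightarrow> bool"
      by (simp add: Int_def)
    have "(\<Sum>j<t. cnt ((c + j) mod N)) = (\<Sum>i<n. \<Sum>j<t. of_bool (N - a ! i = (c + j) mod N))"
      unfolding cnt_def card_eq by (rule sum.swap)
    also have "\<dots> = (\<Sum>i<n. of_bool (N - cyclic_shift N c (a ! i) < t))"
      using cyclic_shift_window[OF a t] by (intro sum.cong) auto
    finally show ?thesis unfolding card_eq .
  qed
  have S_add: "S (c + t) = S c + (int t - int r * int (\<Sum>j<t. cnt ((c + j) mod N)))" for c t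
    by (induction t) (auto simp: S_def algebra_simps)
  have good: "map (cyclic_shift N c) a \<in> parking_functions r k n \<longleftrightarrow> (\<forall>t\<in>{1..N}. S c < S (c + t))" for c
  proof -
    have "map (cyclic_shift N c) a \<in> parking_functions r k n
        \<longleftrightarrow> (\<forall>t\<in>{1..N}. r * card {i. i < n \<and> N - map (cyclic_shift N c) a ! i < t} < t)"
      unfolding N_def
      by (rule parking_iff_count) (use r k len cyclic_shift_range N in \<open>auto simp: N_def\<close>)
    also have "\<dots> \<longleftrightarrow> (\<forall>t\<in>{1..N}. S c < S (c + t))"
    proof (intro ball_cong refl)
      have less: "S c < S c + (int t - int r * int X) \<longleftrightarrow> r * X < t" for t X
        by (simp flip: of_nat_mult)
      fix t assume t: "t \<in> {1..N}"
      have "{i. i < n \<and> N - map (cyclic_shift N c) a ! i < t} = {i. i < n \<and> N - cyclic_shift N c (a ! i) < t}"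
        using len by auto
      then have count: "card {i. i < n \<and> N - map (cyclic_shift N c) a ! i < t} = (\<Sum>j<t. cnt ((c + j) mod N))"
        using window[of t c] t by simp
      show "r * card {i. i < n \<and> N - map (cyclic_shift N c) a ! i < t} < t \<longleftrightarrow> S c < S (c + t)"
        unfolding S_add less count ..
    qed
    finally show ?thesis .
  qed
  have "S (Suc j) \<le> S j + 1" for j by (simp add: S_def)
  \<comment> \<open>A full period rises by \<open>N\<close> and meets all \<open>n\<close> letters,
    so the gain is \<open>N - r * n = k\<close>; this is what fixes the modulus
    \<open>N\<close>.\<close>
  moreover have "S (j + N) = S j + int k" for j
  proof -
    have "N - cyclic_shift N j v < N" for v using cyclic_shift_range[OF N, of j v] N by auto
    then have "{i. i < n \<and> N - cyclic_shift N j (a ! i) < N} = {..<n}" by auto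
    then have "(\<Sum>i<N. cnt ((j + i) mod N)) = n" using window[of N j] by simp
    then show ?thesis unfolding S_add by (simp add: N_def)
  qed
  ultimately show ?thesis unfolding good by (rule cycle_lemma[OF N k])
qed

section \<open>The Frobenius characteristic\<close>

lemma card_fixed_parking_functions:
  fixes r k n :: nat
  defines "N \<equiv> r * n + k"
  assumes r: "r \<ge> 1" and k: "k \<ge> 1" and w: "w permutes {..<n}"
  shows "N * card {a \<in> parking_functions r k n. permute_list (inv w) a = a}
    = k * N ^ card (orbit w ` {..<n})"
proof -
  let ?W = "{a. length a = n \<and> set a \<subseteq> {1..N} \<and> permute_list (inv w) a = a}"
  let ?P = "parking_functions r k n"
  have N: "N \<ge> 1" using k by (simp add: N_def)
  have finW: "finite ?W"
    by (rule finite_subset[OF _ finite_lists_length_eq[of "{1..N}" n]]) auto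
  have inv: "inv w permutes {..<n}" using w by (rule permutes_inv)
  \<comment> \<open>The largest bound on an entry, at position \<open>n - 1\<close>, is still at
    most \<open>N\<close>, so parking functions are words over the letters being shifted.\<close>
  have "x \<le> N" if a: "a \<in> ?P" and x: "x \<in> set a" for a x
  proof -
    have "x \<in> set (sort a)" using x by simp
    then obtain i where "i < length (sort a)" "sort a ! i = x" unfolding in_set_conv_nth by blast
    then have i: "i < n" "x = sort a ! i" using a by (auto simp: parking_functions_def)
    then have "x \<le> k + i * r" using a by (auto simp: parking_functions_def)
    also have "\<dots> \<le> N" using i(1) by (simp add: N_def mult.commute)
    finally show ?thesis .
  qed
  then have PW: "{a \<in> ?P. permute_list (inv w) a = a} = {a \<in> ?W. a \<in> ?P}"
    by (auto simp: parking_functions_def)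
  have bij: "bij_betw (map (cyclic_shift N c)) ?W ?W" for c
  proof -
    have inj: "inj_on (map (cyclic_shift N c)) ?W"
    proof (rule inj_onI)
      fix a b assume ab: "a \<in> ?W" "b \<in> ?W" and eq: "map (cyclic_shift N c) a = map (cyclic_shift N c) b"
      have "inj_on (cyclic_shift N c) (set a \<union> set b)"
        using inj_on_cyclic_shift by (rule inj_on_subset) (use ab in auto)
      then show "a = b" using eq by (rule map_inj_on[rotated])
    qed
    have "map (cyclic_shift N c) a \<in> ?W" if a: "a \<in> ?W" for a
    proof -
      have "permute_list (inv w) (map (cyclic_shift N c) a) = map (cyclic_shift N c) a"
        using a inv by (subst permute_list_map) auto
      then show ?thesis using a cyclic_shift_range[OF N] by auto
    qed
    then have "map (cyclic_shift N c) ` ?W \<subseteq> ?W" by blast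
    then have "map (cyclic_shift N c) ` ?W = ?W" using inj finW by (intro endo_inj_surj)
    then show ?thesis using inj by (simp add: bij_betw_def)
  qed
  \<comment> \<open>Every shift permutes the fixed words, so the count does not depend on
    \<open>c\<close>. Counting pairs (shift, word) the other way gives \<open>k\<close> for each
    word.\<close>
  have shift: "card {a \<in> ?W. map (cyclic_shift N c) a \<in> ?P} = card {a \<in> ?W. a \<in> ?P}" for c
    by (rule bij_betw_same_card[OF bij_betw_Collect[OF bij]]) (rule refl)
  have "N * card {a \<in> ?W. a \<in> ?P} = (\<Sum>c\<in>{..<N}. card {a \<in> ?W. map (cyclic_shift N c) a \<in> ?P})"
    unfolding shift by simp
  also have "\<dots> = (\<Sum>c\<in>{..<N}. \<Sum>a | a \<in> ?W \<and> map (cyclic_shift N c) a \<in> ?P. 1)"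
    by simp
  also have "\<dots> = (\<Sum>a\<in>?W. \<Sum>c | c \<in> {..<N} \<and> map (cyclic_shift N c) a \<in> ?P. 1)"
    by (rule sum.swap_restrict[OF _ finW]) simp
  also have "\<dots> = (\<Sum>a\<in>?W. k)"
  proof (rule sum.cong[OF refl])
    fix a assume "a \<in> ?W"
    then show "(\<Sum>c | c \<in> {..<N} \<and> map (cyclic_shift N c) a \<in> ?P. 1) = k"
      using card_parking_shifts[OF r k, of a n] by (simp add: N_def)
  qed
  also have "\<dots> = k * card ?W" by simp
  also have "card ?W = N ^ card (orbit w ` {..<n})"
    using card_fixed_lists[OF w, of "{1..N}"] by simp
  finally show ?thesis unfolding PW .
qed

lemma F_park_eq_H_series_power:
  assumes "r \<ge> 1" "k \<ge> 1"
  shows "F_park r k n = (of_nat k / of_nat (r * n + k)) *\<^sub>Q (H_series ^ (r * n + k)) $ n"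
proof -
  define N where "N = r * n + k"
  have N: "of_nat N \<noteq> (0 :: rat)" using assms(2) by (simp add: N_def del: of_nat_add)
  have fixed: "of_nat (card {a \<in> parking_functions r k n. permute_list (inv w) a = a})
      = (of_nat k / of_nat N :: rat) * of_nat N ^ card (orbit w ` {..<n})"
    if "w permutes {..<n}" for w
  proof -
    have "of_nat (N * card {a \<in> parking_functions r k n. permute_list (inv w) a = a})
        = (of_nat (k * N ^ card (orbit w ` {..<n})) :: rat)"
      using card_fixed_parking_functions[OF assms that] unfolding N_def by (rule arg_cong)
    then show ?thesis using N by (simp add: field_simps)
  qed
  have "F_park r k n = (1 / fact n) *\<^sub>Q (of_nat k / of_nat N) *\<^sub>Q
      (\<Sum>w | w permutes {..<n}. of_nat N ^ card (orbit w ` {..<n}) *\<^sub>Q p_sym (cycle_type n w))"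
    unfolding F_park_def frobenius_def scaleQ_sum_right[of "of_nat k / of_nat N"] scaleQ_scaleQ
    by (intro arg_cong2[where f = scaleQ] sum.cong refl) (simp add: fixed)
  also have "\<dots> = (of_nat k / of_nat N) *\<^sub>Q (H_series ^ N) $ n"
    unfolding sum_permutations_p_sym by simp
  finally show ?thesis unfolding N_def .
qed

section \<open>The ring of symmetric functions and the involution\<close>

lemma symmetric_functions_mult:
  assumes "f \<in> symmetric_functions" "g \<in> symmetric_functions"
  shows "f * g \<in> symmetric_functions"
proof -
  obtain d where d: "\<And>M. coeff f M \<noteq> 0 \<Longrightarrow> size M \<le> d"
    using assms(1) by (auto simp: symmetric_functions_def)
  obtain e where e: "\<And>M. coeff g M \<noteq> 0 \<Longrightarrow> size M \<le> e"
    using assms(2) by (auto simp: symmetric_functions_def)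
  have "size M \<le> d + e" if M: "coeff (f * g) M \<noteq> 0" for M
  proof -
    obtain p where "p \<in> {(A, B). A + B = M}" "(case p of (A, B) \<Rightarrow> coeff f A * coeff g B) \<noteq> 0"
      using M unfolding coeff_times by (rule sum.not_neutral_contains_not_neutral)
    then obtain A B where "A + B = M" "coeff f A \<noteq> 0" "coeff g B \<noteq> 0" by auto
    then show ?thesis using d[of A] e[of B] by auto
  qed
  moreover have "coeff (f * g) (image_mset \<pi> M) = coeff (f * g) M" if \<pi>: "bij \<pi>" for \<pi> M
  proof -
    have inv: "image_mset \<pi> (image_mset (inv \<pi>) A) = A" "image_mset (inv \<pi>) (image_mset \<pi> A) = A" for A
      using bij_is_surj[OF \<pi>] bij_is_inj[OF \<pi>]
      by (simp_all add: image_mset.compositionality comp_def surj_f_inv_f)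
    have eq: "coeff f (image_mset \<pi> A) = coeff f A" "coeff g (image_mset \<pi> A) = coeff g A" for A
      using assms \<pi> by (auto simp: symmetric_functions_def)
    show ?thesis unfolding coeff_times
      by (rule sum.reindex_bij_witness[where i = "\<lambda>(A, B). (image_mset \<pi> A, image_mset \<pi> B)"
            and j = "\<lambda>(A, B). (image_mset (inv \<pi>) A, image_mset (inv \<pi>) B)"])
        (auto simp: inv eq simp flip: image_mset_union, metis inv(1) eq)
  qed
  ultimately show ?thesis unfolding symmetric_functions_def by blast
qed

lemma symmetric_functions_add:
  assumes "f \<in> symmetric_functions" "g \<in> symmetric_functions"
  shows "f + g \<in> symmetric_functions"
proof -
  obtain d where d: "\<And>M. coeff f M \<noteq> 0 \<Longrightarrow> size M \<le> d"
    using assms(1) by (auto simp: symmetric_functions_def)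
  obtain e where e: "\<And>M. coeff g M \<noteq> 0 \<Longrightarrow> size M \<le> e"
    using assms(2) by (auto simp: symmetric_functions_def)
  have "size M \<le> max d e" if "coeff (f + g) M \<noteq> 0" for M
    using that d[of M] e[of M] by (cases "coeff f M = 0") auto
  moreover have "\<forall>\<pi>. bij \<pi> \<longrightarrow> (\<forall>M. coeff (f + g) (image_mset \<pi> M) = coeff (f + g) M)"
    using assms by (simp add: symmetric_functions_def)
  ultimately show ?thesis unfolding symmetric_functions_def by blast
qed

lemma symmetric_functions_scaleQ: "f \<in> symmetric_functions \<Longrightarrow> c *\<^sub>Q f \<in> symmetric_functions"
  by (auto simp: symmetric_functions_def)

lemma symmetric_functions_0: "0 \<in> symmetric_functions"
  and symmetric_functions_1: "1 \<in> symmetric_functions"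
  by (auto simp: symmetric_functions_def)

lemma symmetric_functions_e_gen: "e_gen n \<in> symmetric_functions"
proof -
  have "coeff (e_gen n) (image_mset \<pi> M) = coeff (e_gen n) M" if \<pi>: "bij \<pi>" for \<pi> M
  proof -
    have "count (image_mset \<pi> M) (\<pi> i) = count M i" for i
    proof -
      have "\<pi> -` {\<pi> i} = {i}" using bij_is_inj[OF \<pi>] by (auto simp: inj_def)
      then show ?thesis by (cases "i \<in># M") (auto simp: count_image_mset not_in_iff)
    qed
    then have "(\<forall>i. count (image_mset \<pi> M) i \<le> 1) \<longleftrightarrow> (\<forall>i. count M i \<le> 1)"
      using bij_is_surj[OF \<pi>] by (metis surj_def)
    then show ?thesis by (simp add: e_gen_def)
  qed
  moreover have "size M \<le> n" if "coeff (e_gen n) M \<noteq> 0" for M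
    using that by (auto simp: e_gen_def)
  ultimately show ?thesis unfolding symmetric_functions_def by blast
qed

lemma symmetric_functions_e_sym: "e_sym \<mu> \<in> symmetric_functions"
  unfolding e_sym_def
  by (induction \<mu>) (auto intro: symmetric_functions_1 symmetric_functions_mult symmetric_functions_e_gen)

lemma omega_e_sym:
  assumes "is_omega \<omega>"
  shows "\<omega> (e_sym \<mu>) = h_sym \<mu>"
proof (induction \<mu>)
  case (add i \<mu>)
  have "\<omega> (e_gen i * e_sym \<mu>) = \<omega> (e_gen i) * \<omega> (e_sym \<mu>)"
    using assms symmetric_functions_e_gen symmetric_functions_e_sym unfolding is_omega_def by blast
  then show ?case using add assms by (simp add: e_sym_def h_sym_def is_omega_def)
qed (use assms in \<open>simp add: e_sym_def h_sym_def is_omega_def\<close>)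

lemma omega_sum_e_sym:
  assumes \<omega>: "is_omega \<omega>" and "finite S"
  shows "\<omega> (\<Sum>\<mu>\<in>S. c \<mu> *\<^sub>Q e_sym \<mu>) = (\<Sum>\<mu>\<in>S. c \<mu> *\<^sub>Q h_sym \<mu>)"
proof -
  have "(\<Sum>\<mu>\<in>S. c \<mu> *\<^sub>Q e_sym \<mu>) \<in> symmetric_functions
      \<and> \<omega> (\<Sum>\<mu>\<in>S. c \<mu> *\<^sub>Q e_sym \<mu>) = (\<Sum>\<mu>\<in>S. c \<mu> *\<^sub>Q h_sym \<mu>)"
    using assms(2)
  proof (induction S rule: finite_induct)
    case empty
    \<comment> \<open>That the involution preserves 0 is obtained from its linearity with scalar
      0.\<close>
    have "\<omega> (0 *\<^sub>Q 0) = 0 *\<^sub>Q \<omega> 0"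
      using \<omega> symmetric_functions_0 unfolding is_omega_def by blast
    then show ?case by (simp add: symmetric_functions_0)
  next
    case (insert \<mu> S)
    have s: "c \<mu> *\<^sub>Q e_sym \<mu> \<in> symmetric_functions"
      by (intro symmetric_functions_scaleQ symmetric_functions_e_sym)
    have "\<omega> (c \<mu> *\<^sub>Q e_sym \<mu>) = c \<mu> *\<^sub>Q \<omega> (e_sym \<mu>)"
      using \<omega> symmetric_functions_e_sym unfolding is_omega_def by blast
    then have "\<omega> (c \<mu> *\<^sub>Q e_sym \<mu> + (\<Sum>\<mu>\<in>S. c \<mu> *\<^sub>Q e_sym \<mu>)) = c \<mu> *\<^sub>Q h_sym \<mu> + (\<Sum>\<mu>\<in>S. c \<mu> *\<^sub>Q h_sym \<mu>)"
      using \<omega> s insert.IH omega_e_sym[OF \<omega>] unfolding is_omega_def by metis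
    then show ?case using insert s symmetric_functions_add by auto
  qed
  then show ?thesis ..
qed

text \<open>The axioms determine the image of a combination of the \<open>e_sym\<close>. Replacing
  each \<open>e_sym\<close> by \<open>h_sym\<close> with unchanged coefficients turns the expansion
  of H(t)^N into that of E(t)^N.\<close>

lemma omega_H_series_power:
  assumes \<omega>: "is_omega \<omega>"
  shows "\<omega> (c *\<^sub>Q (H_series ^ N) $ n) = c *\<^sub>Q (E_series ^ N) $ n"
proof -
  have "\<omega> (\<Sum>\<mu>\<in>partitions n. (c * (eps_part \<mu> * multinom (N + size \<mu> - 1) n (count \<mu>))) *\<^sub>Q e_sym \<mu>)
      = (\<Sum>\<mu>\<in>partitions n. (c * (eps_part \<mu> * multinom (N + size \<mu> - 1) n (count \<mu>))) *\<^sub>Q h_sym \<mu>)"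
    by (rule omega_sum_e_sym[OF \<omega> finite_partitions])
  then show ?thesis
    by (simp add: H_series_power_e_sym E_series_power_h_sym scaleQ_sum_right)
qed

theorem theorem2p1:
  fixes r k :: nat
  assumes "r \<ge> 1" and "k \<ge> 1"
  shows "F_park r k 0 = 1 \<and>
    (\<forall>n\<ge>1.
      F_park r k n = (of_nat k / of_nat (r * n + k)) *\<^sub>Q
        (\<Sum>\<mu>\<in>partitions n. multinom (r * n + k) n (count \<mu>) *\<^sub>Q h_sym \<mu>) \<and>
      F_park r k n = (of_nat k / of_nat (r * n + k)) *\<^sub>Q
        (\<Sum>\<mu>\<in>partitions n.
          (eps_part \<mu> * multinom (r * n + k + size \<mu> - 1) n (count \<mu>)) *\<^sub>Q e_sym \<mu>) \<and>
      F_park r k n = (of_nat k / of_nat (r * n + k)) *\<^sub>Q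
        (\<Sum>\<mu>\<in>partitions n.
          (\<Prod>i\<in>#\<mu>. of_nat ((i + r * n + k - 1) choose i)) *\<^sub>Q m_sym \<mu>) \<and>
      F_park r k n = (of_nat k / of_nat (r * n + k)) *\<^sub>Q
        (\<Sum>\<mu>\<in>partitions n. eval_ones (r * n + k) (s_sym \<mu>) *\<^sub>Q s_sym \<mu>) \<and>
      F_park r k n = of_nat k *\<^sub>Q
        (\<Sum>\<mu>\<in>partitions n.
          (inverse (z_part \<mu>) * of_nat (r * n + k) ^ (size \<mu> - 1)) *\<^sub>Q p_sym \<mu>) \<and>
      (\<forall>\<omega>. is_omega \<omega> \<longrightarrow>
        \<omega> (F_park r k n) = (of_nat k / of_nat (r * n + k)) *\<^sub>Q
          (\<Sum>\<mu>\<in>partitions n.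
            (\<Prod>i\<in>#\<mu>. of_nat ((r * n + k) choose i)) *\<^sub>Q m_sym \<mu>)) \<and>
      F_park r k n = (of_nat k / of_nat (r * n + k)) *\<^sub>Q
        fps_nth (H_series ^ (r * n + k)) n)"
proof (intro conjI allI impI)
  note F = F_park_eq_H_series_power[OF assms]
  show "F_park r k 0 = 1"
    using assms(2) by (simp add: F fps_power_zeroth H_series_def h_gen_0)
  fix n :: nat assume n: "n \<ge> 1"
  show "F_park r k n = (of_nat k / of_nat (r * n + k)) *\<^sub>Q
        (\<Sum>\<mu>\<in>partitions n. multinom (r * n + k) n (count \<mu>) *\<^sub>Q h_sym \<mu>)"
    unfolding F H_series_power_h_sym ..
  show "F_park r k n = (of_nat k / of_nat (r * n + k)) *\<^sub>Q
        (\<Sum>\<mu>\<in>partitions n.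
          (eps_part \<mu> * multinom (r * n + k + size \<mu> - 1) n (count \<mu>)) *\<^sub>Q e_sym \<mu>)"
    unfolding F H_series_power_e_sym ..
  show "F_park r k n = (of_nat k / of_nat (r * n + k)) *\<^sub>Q
        (\<Sum>\<mu>\<in>partitions n.
          (\<Prod>i\<in>#\<mu>. of_nat ((i + r * n + k - 1) choose i)) *\<^sub>Q m_sym \<mu>)"
    unfolding F H_series_power_m_sym add.assoc ..
  show "F_park r k n = (of_nat k / of_nat (r * n + k)) *\<^sub>Q
        (\<Sum>\<mu>\<in>partitions n. eval_ones (r * n + k) (s_sym \<mu>) *\<^sub>Q s_sym \<mu>)"
    unfolding F H_series_power_s_sym ..
  show "F_park r k n = of_nat k *\<^sub>Q
        (\<Sum>\<mu>\<in>partitions n.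
          (inverse (z_part \<mu>) * of_nat (r * n + k) ^ (size \<mu> - 1)) *\<^sub>Q p_sym \<mu>)"
  proof -
    have "of_nat k / of_nat (r * n + k) * (inverse (z_part \<mu>) * of_nat (r * n + k) ^ size \<mu>)
        = of_nat k * (inverse (z_part \<mu>) * of_nat (r * n + k) ^ (size \<mu> - 1))"
      if \<mu>: "\<mu> \<in> partitions n" for \<mu>
    proof -
      \<comment> \<open>A partition of \<open>n \<ge> 1\<close> has a part, so one factor
        \<open>r * n + k\<close> cancels and \<open>size \<mu> - 1\<close> is a true
        predecessor.\<close>
      obtain l where "size \<mu> = Suc l" using \<mu> n by (cases "size \<mu>") (auto simp: partitions_def)
      moreover have "of_nat (r * n + k) \<noteq> (0 :: rat)"
        unfolding of_nat_eq_0_iff using assms(2) by simp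
      ultimately show ?thesis by (simp del: of_nat_add of_nat_mult)
    qed
    then show ?thesis unfolding F H_series_power_p_sym scaleQ_sum_right scaleQ_scaleQ
      by (intro sum.cong refl arg_cong2[where f = scaleQ])
  qed
  show "\<omega> (F_park r k n) = (of_nat k / of_nat (r * n + k)) *\<^sub>Q
          (\<Sum>\<mu>\<in>partitions n.
            (\<Prod>i\<in>#\<mu>. of_nat ((r * n + k) choose i)) *\<^sub>Q m_sym \<mu>)"
    if "is_omega \<omega>" for \<omega>
    unfolding F omega_H_series_power[OF that] E_series_power_m_sym ..
  show "F_park r k n = (of_nat k / of_nat (r * n + k)) *\<^sub>Q fps_nth (H_series ^ (r * n + k)) n"
    by (rule F)
qed

end
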